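(* Let $n\in\mathbb{N}$ ($n\ge 1$), $\mu>0$, $\beta>1$, $R\ge 1$, and let $1<p<p_S(n)$ if $n\ge 2$, and $1<p<\infty$ if $n=1$. Assume that $f\in H^1(\mathbb{R}^n)$ and $g\in L^2(\mathbb{R}^n)$ are both non-negative and that $f$ does not vanish identically. Then there exist a constant $\varepsilon_0=\varepsilon_0(f,g,n,p,\mu,\beta,R)>0$ and a positive constant $C$ independent of $\varepsilon$ such that the following holds for every $0<\varepsilon\le\varepsilon_0$: if $T>0$ and $u$ is an energy solution over $[0,T)$ of $$u_{tt}-\Delta u+\frac{\mu}{(1+t)^\beta}u_t=|u|^p,\qquad u(x,0)=\varepsilon f(x),\quad u_t(x,0)=\varepsilon g(x),$$ satisfying $$\operatorname{supp} u\subset\{(x,t)\in\mathbb{R}^n\times[0,T): |x|\le t+R\},$$ then $$T\le C\,\varepsilon^{-2p(p-1)/\gamma(p,n)}.$$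
   Context: Functions are real-valued. Define $\gamma(p,n):=2+(n+1)p-(n-1)p^2$ (so $\gamma(p,1)=2+2p$). For $n\ge 2$, $p_S(n)$ (the Strauss exponent) is the positive root of the quadratic equation $\gamma(p,n)=0$, i.e. $p_S(n)=\frac{n+1+\sqrt{n^2+10n-7}}{2(n-1)}$. Energy solution: $u$ is an energy solution over $[0,T)$ of the initial value problem if $$u\in C([0,T),H^1(\mathbb{R}^n))\cap C^1([0,T),L^2(\mathbb{R}^n))\cap L^p_{\rm loc}(\mathbb{R}^n\times(0,T)),$$ $u(\cdot,0)=\varepsilon f$, $u_t(\cdot,0)=\varepsilon g$, and $$\int_{\mathbb{R}^n}u_t(x,t)\phi(x,t)\,dx-\int_{\mathbb{R}^n}u_t(x,0)\phi(x,0)\,dx+\int_0^t ds\int_{\mathbb{R}^n}\left\{-u_t(x,s)\phi_t(x,s)+\nabla u(x,s)\cdot\nabla\phi(x,s)\right\}dx$$ $$+\int_0^t ds\int_{\mathbb{R}^n}\frac{\mu u_t(x,s)}{(1+s)^{\beta}}\phi(x,s)\,dx=\int_0^t ds\int_{\mathbb{R}^n}|u(x,s)|^p\phi(x,s)\,dx$$ for every $\phi\in C_0^\infty(\mathbb{R}^n\times[0,T))$ and every $t\in[0,T)$. *)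

theory Defs
  imports "HOL-Analysis.Analysis"
begin

definition strauss_gamma :: "real \<Rightarrow> nat \<Rightarrow> real" where
  "strauss_gamma p n = 2 + (real n + 1) * p - (real n - 1) * p\<^sup>2"

text \<open>Meaningful for \<open>n \<ge> 2\<close> only; see \<open>strauss_exponent_iff\<close>.\<close>

definition strauss_exponent :: "nat \<Rightarrow> real" where
  "strauss_exponent n =
     (real n + 1 + sqrt ((real n)\<^sup>2 + 10 * real n - 7)) / (2 * (real n - 1))"

lemma strauss_exponent_iff:
  assumes "n \<ge> 2"
  shows "p > 0 \<and> strauss_gamma p n = 0 \<longleftrightarrow> p = strauss_exponent n"
proof -
  define m :: real where "m = real n - 1"
  define d where "d = sqrt ((real n)\<^sup>2 + 10 * real n - 7)"
  have m: "m \<ge> 1" and n: "real n = m + 1"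
    using assms by (auto simp: m_def)
  have D: "(real n)\<^sup>2 + 10 * real n - 7 = (m + 2)\<^sup>2 + 8 * m"
    by (simp add: n power2_eq_square algebra_simps)
  have d2: "d\<^sup>2 = (m + 2)\<^sup>2 + 8 * m"
    unfolding d_def D using m by simp
  have dpos: "d > m + 2"
    unfolding d_def D using m by (intro real_less_rsqrt) auto
  have fac: "4 * m * strauss_gamma p n = (d - (2 * m * p - (m + 2))) * (d + (2 * m * p - (m + 2)))"
  proof -
    have "(d - (2 * m * p - (m + 2))) * (d + (2 * m * p - (m + 2))) = d\<^sup>2 - (2 * m * p - (m + 2))\<^sup>2"
      by (simp add: power2_eq_square algebra_simps)
    then show ?thesis
      by (simp only: d2 strauss_gamma_def n) (simp add: power2_eq_square algebra_simps)
  qed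
  have S: "strauss_exponent n = (m + 2 + d) / (2 * m)"
    unfolding strauss_exponent_def d_def by (simp add: n)
  show ?thesis
  proof
    assume p: "p > 0 \<and> strauss_gamma p n = 0"
    then have "m * p > 0" using m by simp
    then have "d + (2 * m * p - (m + 2)) > 0" using dpos by simp
    with fac p have "2 * m * p = m + 2 + d" by auto
    then show "p = strauss_exponent n"
      unfolding S using m by (simp add: field_simps)
  next
    assume p: "p = strauss_exponent n"
    then have "2 * m * p = m + 2 + d" unfolding S using m by simp
    with fac have "4 * m * strauss_gamma p n = 0" by simp
    moreover have "p > 0" unfolding p S using m dpos by (intro divide_pos_pos) auto
    ultimately show "p > 0 \<and> strauss_gamma p n = 0" using m by simp
  qed
qed


text \<open>Smoothness on a set that need not be open: derivatives are taken within \<open>S\<close>, so on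
  \<open>\<real>\<^sup>n \<times> [0,T)\<close> this is smoothness up to and including \<open>t = 0\<close>.  It is used only
  for \<open>S = UNIV\<close> and \<open>S = UNIV \<times> {0..<T}\<close>, where these derivatives are unique.\<close>

primrec Ck_on :: "nat \<Rightarrow> ('a::euclidean_space \<Rightarrow> real) \<Rightarrow> 'a set \<Rightarrow> bool" where
  "Ck_on 0 f S \<longleftrightarrow> continuous_on S f"
| "Ck_on (Suc k) f S \<longleftrightarrow> f differentiable_on S \<and>
     (\<forall>b\<in>Basis. Ck_on k (\<lambda>x. frechet_derivative f (at x within S) b) S)"

definition smooth_on :: "('a::euclidean_space \<Rightarrow> real) \<Rightarrow> 'a set \<Rightarrow> bool" where
  "smooth_on f S \<longleftrightarrow> (\<forall>k. Ck_on k f S)"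

definition test_function :: "'a::euclidean_space set \<Rightarrow> ('a \<Rightarrow> real) \<Rightarrow> bool" where
  "test_function S \<phi> \<longleftrightarrow> smooth_on \<phi> S \<and>
     (\<exists>K. compact K \<and> K \<subseteq> S \<and> (\<forall>z\<in>S - K. \<phi> z = 0))"

definition grad :: "(real^'n \<Rightarrow> real) \<Rightarrow> real^'n \<Rightarrow> real^'n" where
  "grad \<phi> x = (\<chi> i. frechet_derivative \<phi> (at x) (axis i 1))"


text \<open>Elements of the function spaces are represented by functions; equality in these spaces is
  equality almost everywhere.\<close>

definition L2 :: "('a::euclidean_space \<Rightarrow> 'b::euclidean_space) \<Rightarrow> bool" where
  "L2 f \<longleftrightarrow> f \<in> borel_measurable lebesgue \<and> integrable lebesgue (\<lambda>x. (norm (f x))\<^sup>2)"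

definition L2_norm :: "('a::euclidean_space \<Rightarrow> 'b::euclidean_space) \<Rightarrow> real" where
  "L2_norm f = sqrt (LINT x|lebesgue. (norm (f x))\<^sup>2)"

definition Lp_loc :: "real \<Rightarrow> 'a::euclidean_space set \<Rightarrow> ('a \<Rightarrow> real) \<Rightarrow> bool" where
  "Lp_loc p S f \<longleftrightarrow> f \<in> borel_measurable (lebesgue_on S) \<and>
     (\<forall>K. compact K \<and> K \<subseteq> S \<longrightarrow> set_integrable lebesgue K (\<lambda>z. \<bar>f z\<bar> powr p))"

definition has_weak_grad :: "(real^'n \<Rightarrow> real) \<Rightarrow> (real^'n \<Rightarrow> real^'n) \<Rightarrow> bool" where
  "has_weak_grad f G \<longleftrightarrow>
     (\<forall>\<phi>. test_function UNIV \<phi> \<longrightarrow>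
        (LINT x|lebesgue. f x *\<^sub>R grad \<phi> x) = - (LINT x|lebesgue. \<phi> x *\<^sub>R G x))"

definition H1 :: "(real^'n \<Rightarrow> real) \<Rightarrow> bool" where
  "H1 f \<longleftrightarrow> L2 f \<and> (\<exists>G. L2 G \<and> has_weak_grad f G)"

text \<open>For \<open>H1 f\<close> this is determined up to equality almost everywhere.\<close>

definition weak_grad :: "(real^'n \<Rightarrow> real) \<Rightarrow> real^'n \<Rightarrow> real^'n" where
  "weak_grad f = (SOME G. L2 G \<and> has_weak_grad f G)"

definition H1_norm :: "(real^'n \<Rightarrow> real) \<Rightarrow> real" where
  "H1_norm f = sqrt ((L2_norm f)\<^sup>2 + (L2_norm (weak_grad f))\<^sup>2)"


definition C_H1 :: "real \<Rightarrow> (real^'n \<Rightarrow> real \<Rightarrow> real) \<Rightarrow> bool" where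
  "C_H1 T u \<longleftrightarrow> (\<forall>t\<in>{0..<T}. H1 (\<lambda>x. u x t) \<and>
     ((\<lambda>s. H1_norm (\<lambda>x. u x s - u x t)) \<longlongrightarrow> 0) (at t within {0..<T}))"

definition C_L2 :: "real \<Rightarrow> (real^'n \<Rightarrow> real \<Rightarrow> real) \<Rightarrow> bool" where
  "C_L2 T v \<longleftrightarrow> (\<forall>t\<in>{0..<T}. L2 (\<lambda>x. v x t) \<and>
     ((\<lambda>s. L2_norm (\<lambda>x. v x s - v x t)) \<longlongrightarrow> 0) (at t within {0..<T}))"

text \<open>\<open>u \<in> C\<^sup>1([0,T), L\<^sup>2)\<close> with derivative \<open>ut\<close>, which is a limit of difference quotients
  in \<open>L\<^sup>2\<close> and hence unique up to equality almost everywhere at each time.\<close>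

definition C1_L2 :: "real \<Rightarrow> (real^'n \<Rightarrow> real \<Rightarrow> real) \<Rightarrow> (real^'n \<Rightarrow> real \<Rightarrow> real) \<Rightarrow> bool" where
  "C1_L2 T u ut \<longleftrightarrow> C_L2 T u \<and> C_L2 T ut \<and>
     (\<forall>t\<in>{0..<T}. ((\<lambda>s. L2_norm (\<lambda>x. (u x s - u x t) / (s - t) - ut x t)) \<longlongrightarrow> 0)
        (at t within {0..<T}))"

text \<open>Local integrability on \<open>\<real>\<^sup>n \<times> (0,T)\<close> says nothing near \<open>t = 0\<close>, where \<open>\<phi>\<close> need not
  vanish, and the Bochner integral of a non-integrable function is \<open>0\<close>.  The existence of the
  integral of \<open>\<bar>u\<bar>\<^sup>p \<phi>\<close>, implicit in the integral identity, is therefore stated explicitly.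
  All other integrals exist by \<open>C_H1\<close> and \<open>C1_L2\<close>.\<close>

definition energy_solution ::
  "real \<Rightarrow> real \<Rightarrow> real \<Rightarrow> real \<Rightarrow> (real^'n \<Rightarrow> real) \<Rightarrow> (real^'n \<Rightarrow> real) \<Rightarrow> real
    \<Rightarrow> (real^'n \<Rightarrow> real \<Rightarrow> real) \<Rightarrow> bool" where
  "energy_solution \<mu> \<beta> p \<epsilon> f g T u \<longleftrightarrow>
     C_H1 T u \<and> Lp_loc p (UNIV \<times> {0<..<T}) (\<lambda>(x, t). u x t) \<and>
     (AE x in lebesgue. u x 0 = \<epsilon> * f x) \<and>
     (\<exists>ut. C1_L2 T u ut \<and> (AE x in lebesgue. ut x 0 = \<epsilon> * g x) \<and>
       (\<forall>\<phi>. test_function (UNIV \<times> {0..<T}) \<phi> \<longrightarrow> (\<forall>t\<in>{0..<T}.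
          set_integrable lebesgue (UNIV \<times> {0..t}) (\<lambda>(x, s). \<bar>u x s\<bar> powr p * \<phi> (x, s)) \<and>
          (LINT x|lebesgue. ut x t * \<phi> (x, t)) - (LINT x|lebesgue. ut x 0 * \<phi> (x, 0))
          + (LINT s:{0..t}|lebesgue. (LINT x|lebesgue.
               - ut x s * vector_derivative (\<lambda>r. \<phi> (x, r)) (at s within {0..<T})
               + weak_grad (\<lambda>y. u y s) x \<bullet> grad (\<lambda>y. \<phi> (y, s)) x))
          + (LINT s:{0..t}|lebesgue. (LINT x|lebesgue.
               \<mu> * ut x s / (1 + s) powr \<beta> * \<phi> (x, s)))
          = (LINT s:{0..t}|lebesgue. (LINT x|lebesgue. \<bar>u x s\<bar> powr p * \<phi> (x, s))))))"

text \<open>The support, relative to \<open>S\<close>, of a function given up to equality almost everywhere.\<close>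

definition ess_support :: "'a::euclidean_space set \<Rightarrow> ('a \<Rightarrow> real) \<Rightarrow> 'a set" where
  "ess_support S f =
     {z \<in> S. \<forall>U. open U \<and> z \<in> U \<longrightarrow> \<not> (AE w in lebesgue. w \<in> U \<inter> S \<longrightarrow> f w = 0)}"

end

theory Submission
  imports Defs
begin

text \<open>Let \<open>F(t)\<close> be the integral of \<open>u(x,t)\<close> over \<open>x\<close>.  Testing with a function that is \<open>1\<close> on the
  support of \<open>u\<close> gives \<open>F'' + \<mu> (1+t)^(-\<beta>) F' = P\<close>, where \<open>P(t)\<close> is the integral of \<open>\<bar>u\<bar>^p\<close>; since the
  damping is integrable in time, it costs only a constant factor.  Hoelder's inequality on the ball of
  radius \<open>t+R\<close> bounds \<open>P\<close> from below by a multiple of \<open>(1+t)^(-n(p-1)) \<bar>F\<bar>^p\<close>.  Testing with a positive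
  radial solution \<open>\<psi>\<close> of \<open>\<Delta>\<psi> = \<psi>\<close> shows that the integral of \<open>u \<psi>\<close> grows at least like \<open>\<epsilon> e^t\<close>, and as
  \<open>\<psi>\<close> grows at most like \<open>\<bar>x\<bar>^(-(n-1)/2) e^\<bar>x\<bar>\<close>, Hoelder's inequality gives the second bound
  \<open>P \<ge> c \<epsilon>^p (1+t)^((n-1)(1-p/2))\<close>.  The second bound starts an iteration of the first one, which
  forces \<open>F(T')\<close> to be infinite unless \<open>T'\<close> is bounded by the stated power of \<open>\<epsilon>\<close>.\<close>

subsection \<open>Smooth functions and cutoffs\<close>

text \<open>Two features of energy solutions shape the argument. The equation holds only after
  integration in time, where the integral of |u|^p over space is merely integrable; so the time
  derivative \<open>V\<close> of a moment of \<open>u\<close> need not be differentiable, and every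
  differential inequality is stated through increments \<open>V b - V a\<close>. Moreover the
  support condition concerns almost every point of space-time, whereas moments are needed at every
  time; continuity in L2 transfers it, at the price of enlarging the radius t + R by 1.

  The exponent arises as follows. On the scale X, two integrations in time turn the second bound on
  P into F >= G with G of order \<epsilon>^p X^(2+e), where e = (n-1)(1-p/2). Feeding F >= G into
  the first bound and integrating twice again multiplies G by about X^(2-n(p-1)) G^(p-1), that is,
  by \<epsilon>^(p(p-1)) X^(\<gamma>/2), because 2 - n(p-1) + (2+e)(p-1) = \<gamma>(p,n)/2. If this
  factor is large, the bounds on F grow without limit; so it is bounded, and \<gamma> > 0, which p <
  p_S guarantees, lets the inequality be solved for X.\<close>

text \<open>On such a set the derivative within the set is unique.\<close>

definition thick :: "'a::euclidean_space set \<Rightarrow> bool" where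
  "thick S \<longleftrightarrow> (\<forall>x\<in>S. \<forall>i\<in>Basis. \<forall>e>0. \<exists>d. 0 < \<bar>d\<bar> \<and> \<bar>d\<bar> < e \<and> x + d *\<^sub>R i \<in> S)"

lemma thick_UNIV [simp]: "thick UNIV"
  unfolding thick_def
proof (intro ballI allI impI)
  fix e :: real assume "e > 0"
  then show "\<exists>d. 0 < \<bar>d\<bar> \<and> \<bar>d\<bar> < e \<and> x + d *\<^sub>R i \<in> UNIV" for x i :: 'a
    by (intro exI[of _ "e / 2"]) auto
qed

lemma half_open_step:
  fixes s T e :: real
  assumes "s \<in> {0..<T}" "e > 0"
  shows "\<exists>d. 0 < \<bar>d\<bar> \<and> \<bar>d\<bar> < e \<and> s + d \<in> {0..<T}"
proof -
  have "0 < min e (T - s) / 2" using assms by auto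
  moreover have "min e (T - s) / 2 < e" "s + min e (T - s) / 2 < T"
    using assms by (auto simp: min_def field_simps)
  ultimately show ?thesis using assms by (intro exI[of _ "min e (T - s) / 2"]) auto
qed

lemma thick_strip: "thick ((UNIV :: 'a::euclidean_space set) \<times> {0..<T::real})"
  unfolding thick_def
proof (intro ballI allI impI)
  fix x :: "'a \<times> real" and i :: "'a \<times> real" and e :: real
  assume x: "x \<in> UNIV \<times> {0..<T}" and i: "i \<in> Basis" and e: "e > 0"
  obtain y s where xs: "x = (y, s)" "s \<in> {0..<T}" using x by auto
  obtain d where "0 < \<bar>d\<bar>" "\<bar>d\<bar> < e" "s + d \<in> {0..<T}"
    using half_open_step[OF xs(2) e] by blast
  moreover have "snd i = 0 \<or> snd i = 1" using i by (auto simp: Basis_prod_def)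
  ultimately show "\<exists>d. 0 < \<bar>d\<bar> \<and> \<bar>d\<bar> < e \<and> x + d *\<^sub>R i \<in> UNIV \<times> {0..<T}"
    using xs by (intro exI[of _ d]) (cases i, auto)
qed

section \<open>Calculus of smooth functions relative to a set\<close>

lemma frechet_derivative_thick:
  assumes "thick S" "x \<in> S" "(f has_derivative f') (at x within S)"
  shows "frechet_derivative f (at x within S) = f'"
proof -
  have "(f has_derivative frechet_derivative f (at x within S)) (at x within S)"
    using assms(3) differentiable_def frechet_derivative_works by blast
  then show ?thesis
    using assms by (intro frechet_derivative_unique_within[of f _ x S]) (auto simp: thick_def)
qed

lemma Ck_on_cong:
  assumes "\<And>x. x \<in> S \<Longrightarrow> f x = g x"
  shows "Ck_on k f S \<longleftrightarrow> Ck_on k g S"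
  using assms
proof (induction k arbitrary: f g)
  case 0
  then show ?case by (auto cong: continuous_on_cong)
next
  case (Suc k)
  have eq: "(f has_derivative D) (at x within S) \<longleftrightarrow> (g has_derivative D) (at x within S)" if "x \<in> S" for x D
    using has_derivative_transform[OF that, of g f D] has_derivative_transform[OF that, of f g D] Suc.prems
    by fastforce
  have 1: "f differentiable_on S \<longleftrightarrow> g differentiable_on S"
    using eq by (auto simp: differentiable_on_def differentiable_def)
  have 2: "frechet_derivative f (at x within S) = frechet_derivative g (at x within S)" if "x \<in> S" for x
    using eq[OF that] by (simp add: frechet_derivative_def)
  have "Ck_on k (\<lambda>x. frechet_derivative f (at x within S) b) S
      \<longleftrightarrow> Ck_on k (\<lambda>x. frechet_derivative g (at x within S) b) S" for b
    by (rule Suc.IH) (simp add: 2)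
  then show ?case by (simp add: 1)
qed

text \<open>\<open>Ck_on\<close> refers to the chosen \<open>frechet_derivative\<close>; uniqueness
  on a thick set lets any derivative found by the usual rules take its place.\<close>

lemma Ck_on_SucI:
  assumes S: "thick S" and f: "\<And>x. x \<in> S \<Longrightarrow> (f has_derivative f' x) (at x within S)"
    and k: "\<And>b. b \<in> Basis \<Longrightarrow> Ck_on k (\<lambda>x. f' x b) S"
  shows "Ck_on (Suc k) f S"
proof -
  have "Ck_on k (\<lambda>x. frechet_derivative f (at x within S) b) S" if "b \<in> Basis" for b
    using Ck_on_cong[of S "\<lambda>x. frechet_derivative f (at x within S) b" "\<lambda>x. f' x b" k]
      frechet_derivative_thick[OF S _ f] k[OF that] by auto
  then show ?thesis using f by (auto simp: differentiable_on_def differentiable_def)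
qed

lemma Ck_on_SucE:
  assumes "Ck_on (Suc k) f S"
  obtains f' where "\<And>x. x \<in> S \<Longrightarrow> (f has_derivative f' x) (at x within S)"
    "\<And>b. b \<in> Basis \<Longrightarrow> Ck_on k (\<lambda>x. f' x b) S"
  using assms that[of "\<lambda>x. frechet_derivative f (at x within S)"]
  by (auto simp: differentiable_on_def frechet_derivative_works)

lemma Ck_on_Suc_imp: "Ck_on (Suc k) f S \<Longrightarrow> Ck_on k f S"
proof (induction k arbitrary: f)
  case 0
  then show ?case by (auto intro: differentiable_imp_continuous_on)
next
  case (Suc k)
  then show ?case unfolding Ck_on.simps(2)[of "Suc k"] Ck_on.simps(2)[of k] by blast
qed

lemma Ck_on_const: "thick S \<Longrightarrow> Ck_on k (\<lambda>x. c) S"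
  by (induction k arbitrary: c)
     (auto intro!: Ck_on_SucI[where f' = "\<lambda>_ _. 0"] simp del: Ck_on.simps(2))

lemma Ck_on_linear: "thick S \<Longrightarrow> bounded_linear f \<Longrightarrow> Ck_on k f S"
  by (cases k) (auto intro!: Ck_on_SucI[where f' = "\<lambda>_. f"] Ck_on_const linear_continuous_on
      bounded_linear_imp_has_derivative simp del: Ck_on.simps(2))

lemma Ck_on_add: "thick S \<Longrightarrow> Ck_on k f S \<Longrightarrow> Ck_on k g S \<Longrightarrow> Ck_on k (\<lambda>x. f x + g x) S"
proof (induction k arbitrary: f g)
  case 0
  then show ?case by (auto intro: continuous_intros)
next
  case (Suc k)
  from Suc.prems(2) obtain f' where f': "\<And>x. x \<in> S \<Longrightarrow> (f has_derivative f' x) (at x within S)"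
    "\<And>b. b \<in> Basis \<Longrightarrow> Ck_on k (\<lambda>x. f' x b) S" by (rule Ck_on_SucE) auto
  from Suc.prems(3) obtain g' where g': "\<And>x. x \<in> S \<Longrightarrow> (g has_derivative g' x) (at x within S)"
    "\<And>b. b \<in> Basis \<Longrightarrow> Ck_on k (\<lambda>x. g' x b) S" by (rule Ck_on_SucE) auto
  show ?case
    using Suc.IH[OF Suc.prems(1) f'(2) g'(2)] Suc.prems(1)
    by (intro Ck_on_SucI[where f' = "\<lambda>x h. f' x h + g' x h"]) (auto intro!: has_derivative_add f' g')
qed

lemma Ck_on_mult: "thick S \<Longrightarrow> Ck_on k f S \<Longrightarrow> Ck_on k g S \<Longrightarrow> Ck_on k (\<lambda>x. f x * g x) S"
proof (induction k arbitrary: f g)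
  case 0
  then show ?case by (auto intro: continuous_intros)
next
  case (Suc k)
  from Suc.prems(2) obtain f' where f': "\<And>x. x \<in> S \<Longrightarrow> (f has_derivative f' x) (at x within S)"
    "\<And>b. b \<in> Basis \<Longrightarrow> Ck_on k (\<lambda>x. f' x b) S" by (rule Ck_on_SucE) auto
  from Suc.prems(3) obtain g' where g': "\<And>x. x \<in> S \<Longrightarrow> (g has_derivative g' x) (at x within S)"
    "\<And>b. b \<in> Basis \<Longrightarrow> Ck_on k (\<lambda>x. g' x b) S" by (rule Ck_on_SucE) auto
  note lo = Ck_on_Suc_imp[OF Suc.prems(2)] Ck_on_Suc_imp[OF Suc.prems(3)]
  have "Ck_on k (\<lambda>x. f x * g' x b + f' x b * g x) S" if "b \<in> Basis" for b
    using Suc.IH[OF Suc.prems(1) lo(1) g'(2)[OF that]] Suc.IH[OF Suc.prems(1) f'(2)[OF that] lo(2)]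
    by (rule Ck_on_add[OF Suc.prems(1)])
  then show ?case
    using has_derivative_mult[OF f'(1) g'(1)]
    by (intro Ck_on_SucI[OF Suc.prems(1), where f' = "\<lambda>x h. f x * g' x h + f' x h * g x"])
qed

lemma has_real_derivative_frechet:
  fixes h :: "real \<Rightarrow> real"
  assumes "h differentiable_on UNIV"
  shows "(h has_real_derivative frechet_derivative h (at y) 1) (at y)"
proof -
  have d: "(h has_derivative frechet_derivative h (at y)) (at y)"
    using assms by (auto simp: differentiable_on_def frechet_derivative_works)
  have "frechet_derivative h (at y) x = frechet_derivative h (at y) 1 * x" for x
    using linear_scale[OF has_derivative_linear[OF d], of x 1] by simp
  then have "frechet_derivative h (at y) = (*) (frechet_derivative h (at y) 1)" by (rule ext)
  then show ?thesis using d unfolding has_field_derivative_def by metis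
qed

lemma Ck_on_Suc_real:
  fixes h :: "real \<Rightarrow> real"
  shows "Ck_on (Suc k) h UNIV \<longleftrightarrow> (\<exists>h'. (\<forall>y. (h has_real_derivative h' y) (at y)) \<and> Ck_on k h' UNIV)"
proof
  assume "Ck_on (Suc k) h UNIV"
  then show "\<exists>h'. (\<forall>y. (h has_real_derivative h' y) (at y)) \<and> Ck_on k h' UNIV"
    using has_real_derivative_frechet[of h]
    by (intro exI[of _ "\<lambda>y. frechet_derivative h (at y) 1"]) auto
next
  assume "\<exists>h'. (\<forall>y. (h has_real_derivative h' y) (at y)) \<and> Ck_on k h' UNIV"
  then obtain h' where "\<And>y. (h has_real_derivative h' y) (at y)" "Ck_on k h' UNIV" by blast
  then show "Ck_on (Suc k) h UNIV"
    by (intro Ck_on_SucI[where f' = "\<lambda>y x. h' y * x"]) (auto simp: has_field_derivative_def)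
qed

lemma Ck_on_compose:
  fixes h :: "real \<Rightarrow> real"
  shows "thick S \<Longrightarrow> Ck_on k h UNIV \<Longrightarrow> Ck_on k q S \<Longrightarrow> Ck_on k (\<lambda>x. h (q x)) S"
proof (induction k arbitrary: h q)
  case 0
  then show ?case by (auto intro: continuous_on_compose2)
next
  case (Suc k)
  from Suc.prems(2) obtain h' where h': "\<And>y. (h has_real_derivative h' y) (at y)" "Ck_on k h' UNIV"
    unfolding Ck_on_Suc_real by blast
  from Suc.prems(3) obtain q' where q': "\<And>x. x \<in> S \<Longrightarrow> (q has_derivative q' x) (at x within S)"
    "\<And>b. b \<in> Basis \<Longrightarrow> Ck_on k (\<lambda>x. q' x b) S" by (rule Ck_on_SucE) auto
  have "((\<lambda>x. h (q x)) has_derivative (\<lambda>v. h' (q x) * q' x v)) (at x within S)" if "x \<in> S" for x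
    using has_derivative_compose[OF q'(1)[OF that]] h'(1)[of "q x"]
    by (auto simp: has_field_derivative_def)
  then show ?case
    using Suc.IH[OF Suc.prems(1) h'(2) Ck_on_Suc_imp[OF Suc.prems(3)]] q'(2) Suc.prems(1)
    by (intro Ck_on_SucI[where f' = "\<lambda>x v. h' (q x) * q' x v"]) (auto intro: Ck_on_mult)
qed

lemma smooth_on_const: "thick S \<Longrightarrow> smooth_on (\<lambda>x. c) S"
  by (simp add: smooth_on_def Ck_on_const)

lemma smooth_on_linear: "thick S \<Longrightarrow> bounded_linear f \<Longrightarrow> smooth_on f S"
  by (simp add: smooth_on_def Ck_on_linear)

lemma smooth_on_add: "thick S \<Longrightarrow> smooth_on f S \<Longrightarrow> smooth_on g S \<Longrightarrow> smooth_on (\<lambda>x. f x + g x) S"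
  by (simp add: smooth_on_def Ck_on_add)

lemma smooth_on_mult: "thick S \<Longrightarrow> smooth_on f S \<Longrightarrow> smooth_on g S \<Longrightarrow> smooth_on (\<lambda>x. f x * g x) S"
  by (simp add: smooth_on_def Ck_on_mult)

lemma smooth_on_compose:
  fixes h :: "real \<Rightarrow> real"
  shows "thick S \<Longrightarrow> smooth_on h UNIV \<Longrightarrow> smooth_on q S \<Longrightarrow> smooth_on (\<lambda>x. h (q x)) S"
  by (simp add: smooth_on_def Ck_on_compose)

lemma smooth_on_imp_continuous_on: "smooth_on f S \<Longrightarrow> continuous_on S f"
  unfolding smooth_on_def by (metis Ck_on.simps(1))

lemma smooth_on_deriv:
  fixes h :: "real \<Rightarrow> real"
  assumes "smooth_on h UNIV"
  shows "(h has_real_derivative deriv h y) (at y)" "smooth_on (deriv h) UNIV"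
proof -
  have "Ck_on (Suc 0) h UNIV" using assms unfolding smooth_on_def by blast
  then have *: "\<And>y. (h has_real_derivative deriv h y) (at y)"
    unfolding Ck_on_Suc_real using DERIV_imp_deriv by metis
  then show "(h has_real_derivative deriv h y) (at y)" .
  have "Ck_on k (deriv h) UNIV" for k
  proof -
    have "Ck_on (Suc k) h UNIV" using assms unfolding smooth_on_def by blast
    then obtain h' where "\<And>y. (h has_real_derivative h' y) (at y)" "Ck_on k h' UNIV"
      unfolding Ck_on_Suc_real by blast
    moreover from this have "h' = deriv h" using DERIV_imp_deriv by (metis ext)
    ultimately show ?thesis by simp
  qed
  then show "smooth_on (deriv h) UNIV" by (simp add: smooth_on_def)
qed

text \<open>One differentiation in a fixed direction leaves a linear function of \<open>x\<close>,
  for which \<open>Ck_on_linear\<close> settles all orders. The map \<open>L\<close> covers the norm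
  on space and the norm of the space component on space-time alike.\<close>

lemma smooth_on_sqnorm:
  assumes "thick S" "bounded_linear (L :: 'a::euclidean_space \<Rightarrow> 'b::euclidean_space)"
  shows "smooth_on (\<lambda>x. (norm (L x))\<^sup>2) S"
proof -
  have d: "((\<lambda>x. (norm (L x))\<^sup>2) has_derivative (\<lambda>v. 2 * (L x \<bullet> L v))) (at x within S)" for x
    unfolding power2_norm_eq_inner using assms(2)
    by (auto intro!: derivative_eq_intros bounded_linear_imp_has_derivative simp: inner_commute)
  have "Ck_on k (\<lambda>x. 2 * (L x \<bullet> L b)) S" for k b
    by (intro Ck_on_linear assms(1) bounded_linear_const_mult bounded_linear_inner_left_comp assms(2))
  then have "Ck_on (Suc k) (\<lambda>x. (norm (L x))\<^sup>2) S" for k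
    by (intro Ck_on_SucI[OF assms(1) d])
  then show ?thesis unfolding smooth_on_def using Ck_on_Suc_imp by blast
qed

text \<open>The classical function exp (-1/x), enlarged by polynomials in 1/x to a family closed
  under differentiation: q(1/x) exp (-1/x) has derivative r(1/x) exp (-1/x) with r(y) = y^2 (q(y) -
  q'(y)). Smoothness then is an induction on the order over all \<open>q\<close> at once.\<close>

definition flat :: "real poly \<Rightarrow> real \<Rightarrow> real" where
  "flat q x = (if x > 0 then poly q (1 / x) * exp (- (1 / x)) else 0)"

lemma flat_lim: "((\<lambda>x. poly q (1 / x) * exp (- (1 / x))) \<longlongrightarrow> 0) (at_right (0::real))"
proof -
  have "((\<lambda>x. poly q x * exp (- x)) \<longlongrightarrow> (0::real)) at_top"
  proof -
    have "((\<lambda>x. x ^ k * exp (- x)) \<longlongrightarrow> (0::real)) at_top" for k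
      using tendsto_power_div_exp_0[of k] by (simp add: exp_minus divide_inverse)
    then have "((\<lambda>x. \<Sum>k\<le>degree q. coeff q k * (x ^ k * exp (- x))) \<longlongrightarrow> (\<Sum>k\<le>degree q. coeff q k * 0)) at_top"
      by (intro tendsto_intros)
    then show ?thesis by (simp add: poly_altdef sum_distrib_right mult.assoc)
  qed
  moreover have "filterlim (\<lambda>x::real. 1 / x) at_top (at_right 0)"
    using filterlim_inverse_at_top_right by (simp add: inverse_eq_divide)
  ultimately show ?thesis by (rule filterlim_compose)
qed

lemma flat_deriv: "(flat q has_real_derivative flat ([:0, 0, 1:] * (q - pderiv q)) x) (at x)"
proof (cases x "0 :: real" rule: linorder_cases)
  case less
  have "((\<lambda>x. 0) has_real_derivative 0) (at x)" by simp
  then have "(flat q has_real_derivative 0) (at x)"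
    by (rule has_field_derivative_transform_within_open[where S = "{..<0}"])
       (use less in \<open>auto simp: flat_def\<close>)
  then show ?thesis using less by (simp add: flat_def)
next
  case greater
  have "((\<lambda>x. poly q (1 / x) * exp (- (1 / x))) has_real_derivative
      flat ([:0, 0, 1:] * (q - pderiv q)) x) (at x)"
    using greater by (auto simp: flat_def field_simps power2_eq_square
        intro!: derivative_eq_intros DERIV_chain2[OF poly_DERIV])
  then show ?thesis
    by (rule has_field_derivative_transform_within_open[where S = "{0<..}"])
       (use greater in \<open>auto simp: flat_def\<close>)
next
  case equal
  \<comment> \<open>To the right of 0 the difference quotient again belongs to the family, with
    polynomial y q(y), so \<open>flat_lim\<close> applies to it.\<close>
  have "((\<lambda>y. flat q y / y) \<longlongrightarrow> 0) (at_right 0)"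
  proof (rule Lim_transform_eventually[OF flat_lim[of "[:0, 1:] * q"]])
    show "\<forall>\<^sub>F x in at_right 0. poly ([:0, 1:] * q) (1 / x) * exp (- (1 / x)) = flat q x / x"
      by (rule eventually_at_rightI[of 0 1]) (auto simp: flat_def)
  qed
  moreover have "((\<lambda>y. flat q y / y) \<longlongrightarrow> 0) (at_left 0)"
    by (rule Lim_transform_eventually[OF tendsto_const])
       (rule eventually_at_leftI[of "-1" 0], auto simp: flat_def)
  ultimately have "((\<lambda>y. flat q y / y) \<longlongrightarrow> 0) (at 0)"
    using filterlim_split_at by blast
  then show ?thesis using equal by (simp add: has_field_derivative_iff flat_def)
qed

lemma smooth_flat: "smooth_on (flat q) UNIV"
proof -
  have "Ck_on k (flat q) UNIV" for k
  proof (induction k arbitrary: q)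
    case 0
    show ?case
      using DERIV_isCont[OF flat_deriv[of q]] by (auto intro: continuous_at_imp_continuous_on)
  next
    case (Suc k)
    then show ?case unfolding Ck_on_Suc_real using flat_deriv by blast
  qed
  then show ?thesis by (simp add: smooth_on_def)
qed

text \<open>A quotient-free cutoff: with \<open>f x = exp (- 1 / x)\<close> for \<open>x > 0\<close> and \<open>f x = 0\<close> otherwise,
  the function \<open>e * f (1 - e * f x)\<close> equals \<open>1\<close> for \<open>x \<le> 0\<close> and \<open>0\<close> for \<open>x \<ge> 1\<close>.\<close>

lemma smooth_cutoff:
  fixes a b :: real
  assumes "a < b"
  obtains \<eta> where "smooth_on \<eta> UNIV" "\<And>s. s \<le> a \<Longrightarrow> \<eta> s = 1" "\<And>s. s \<ge> b \<Longrightarrow> \<eta> s = 0"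
    "\<And>s. \<eta> s \<ge> 0"
proof -
  define l where "l s = (s - a) / (b - a)" for s
  define \<eta> where "\<eta> s = exp 1 * flat 1 (1 + (- exp 1) * flat 1 (l s))" for s
  have "l = (\<lambda>s. 1 / (b - a) * s + (- a / (b - a)))" by (auto simp: l_def fun_eq_iff diff_divide_distrib)
  moreover have "smooth_on (\<lambda>s. 1 / (b - a) * s + (- a / (b - a))) UNIV"
    by (intro smooth_on_add smooth_on_mult smooth_on_const smooth_on_linear) (auto intro: bounded_linear_ident)
  ultimately have "smooth_on \<eta> UNIV"
    unfolding \<eta>_def
    by (intro smooth_on_mult smooth_on_const smooth_on_compose[OF _ smooth_flat] smooth_on_add) auto
  moreover have "\<eta> s = 1" if "s \<le> a" for s
  proof -
    have "l s \<le> 0" using that assms by (auto simp: l_def divide_le_0_iff)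
    then show ?thesis by (simp add: \<eta>_def flat_def flip: exp_add)
  qed
  moreover have "\<eta> s = 0" if "s \<ge> b" for s
  proof -
    have "l s \<ge> 1" using that assms by (auto simp: l_def)
    then have "exp 1 * exp (- (1 / l s)) \<ge> (1::real)" "l s > 0" by (auto simp flip: exp_add)
    then show ?thesis by (simp add: \<eta>_def flat_def)
  qed
  moreover have "\<eta> s \<ge> 0" for s by (simp add: \<eta>_def flat_def)
  ultimately show ?thesis using that by blast
qed

text \<open>Everywhere convergent power series are closed under \<open>diffs\<close>, which permits
  induction on the order with \<open>c\<close> arbitrary.\<close>

lemma smooth_powser:
  fixes c :: "nat \<Rightarrow> real"
  assumes "\<And>y. summable (\<lambda>n. c n * y ^ n)"
  shows "smooth_on (\<lambda>x. \<Sum>n. c n * x ^ n) UNIV"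
proof -
  have "Ck_on k (\<lambda>x. \<Sum>n. c n * x ^ n) UNIV" for k
    using assms
  proof (induction k arbitrary: c)
    case 0
    then show ?case
      using DERIV_isCont[OF termdiffs_strong_converges_everywhere[OF 0]]
      by (auto intro: continuous_at_imp_continuous_on)
  next
    case (Suc k)
    have "summable (\<lambda>n. diffs c n * y ^ n)" for y
      by (rule termdiff_converges_all) (rule Suc.prems)
    then show ?case unfolding Ck_on_Suc_real
      using termdiffs_strong_converges_everywhere[OF Suc.prems] Suc.IH[of "diffs c"]
      by (intro exI[of _ "\<lambda>x. \<Sum>n. diffs c n * x ^ n"]) simp
  qed
  then show ?thesis by (simp add: smooth_on_def)
qed

subsection \<open>A positive radial solution of the modified Helmholtz equation\<close>

text \<open>In dimension \<open>d\<close> the Laplacian of \<open>\<bar>x\<bar>^(2k)\<close> is \<open>2k (2k + d - 2) \<bar>x\<bar>^(2k-2)\<close>, so \<open>\<Delta>\<psi> = \<psi>\<close> is solved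
  by \<open>\<psi>(x) = bessel_psi d (\<bar>x\<bar>\<^sup>2)\<close>.\<close>

primrec bessel_coeff :: "real \<Rightarrow> nat \<Rightarrow> real" where
  "bessel_coeff d 0 = 1"
| "bessel_coeff d (Suc k) = bessel_coeff d k / ((2 * real k + 2) * (2 * real k + d))"

definition bessel_psi :: "real \<Rightarrow> real \<Rightarrow> real" where
  "bessel_psi d r = (\<Sum>k. bessel_coeff d k * r ^ k)"

lemma bessel_coeff_pos: "d > 0 \<Longrightarrow> bessel_coeff d k > 0"
  by (induction k) (auto intro!: divide_pos_pos mult_pos_pos)

text \<open>The left side is the factor by which \<open>bessel_coeff d k * fact (2 * k)\<close>
  changes from \<open>k\<close> to \<open>Suc k\<close>; the right side telescopes. With q = 2k + d,
  logarithms reduce the claim to ln (1 - (d-1)/q) <= -(d-1)/q and ln (1 + 2/q) <= 2/q. The decay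
  exponent (d-1)/2 originates here.\<close>

lemma bessel_coeff_ratio:
  fixes d :: real
  assumes "d \<ge> 1"
  shows "(2 * real k + 1) / (2 * real k + d) \<le> ((2 * real k + d) / (2 * real k + 2 + d)) powr ((d - 1) / 2)"
proof -
  define q where "q = 2 * real k + d"
  have q: "q > 0" using assms by (simp add: q_def)
  have "ln (1 - c) \<le> - c" if "c < 1" for c :: real
    using ln_add_one_self_le_self2[of "- c"] that by simp
  moreover have "(d - 1) / q < 1" using q assms by (simp add: q_def)
  ultimately have 1: "ln (1 - (d - 1) / q) \<le> - ((d - 1) / q)" by blast
  have "ln ((q + 2) / q) = ln (1 + 2 / q)" using q by (simp add: add_divide_distrib)
  also have "\<dots> \<le> 2 / q" using q by (intro ln_add_one_self_le_self) auto
  finally have "(d - 1) / 2 * ln ((q + 2) / q) \<le> (d - 1) / 2 * (2 / q)"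
    using assms by (intro mult_left_mono) auto
  then have 2: "- ((d - 1) / q) \<le> (d - 1) / 2 * ln (q / (q + 2))"
    using q by (simp add: ln_div algebra_simps diff_divide_distrib)
  have eq: "(2 * real k + 1) / q = 1 - (d - 1) / q" using q by (simp add: q_def field_simps)
  have pos: "(2 * real k + 1) / q > 0" using q by simp
  have "(2 * real k + 1) / q = exp (ln ((2 * real k + 1) / q))" using pos by simp
  also have "\<dots> \<le> exp ((d - 1) / 2 * ln (q / (q + 2)))" using order_trans[OF 1 2] eq by simp
  also have "\<dots> = (q / (q + 2)) powr ((d - 1) / 2)" using q by (simp add: powr_def)
  finally show ?thesis by (simp add: q_def add_ac)
qed

text \<open>Comparison with the coefficients 1/(2k)! of cosh: the gain over them, of order
  k^(-(d-1)/2), is what becomes the decay factor next to the exponential.\<close>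

lemma bessel_coeff_bound:
  fixes d :: real
  assumes "d \<ge> 1"
  shows "bessel_coeff d k * fact (2 * k) \<le> (d / (2 * real k + d)) powr ((d - 1) / 2)"
proof (induction k)
  case 0
  then show ?case using assms by simp
next
  case (Suc k)
  have f: "(fact (2 * Suc k) :: real) = (2 * real k + 2) * ((2 * real k + 1) * fact (2 * k))"
    by (simp add: algebra_simps)
  have "bessel_coeff d (Suc k) * fact (2 * Suc k)
      = (bessel_coeff d k * fact (2 * k)) * ((2 * real k + 1) / (2 * real k + d))"
    using assms unfolding f bessel_coeff.simps by (simp add: divide_simps)
  also have "\<dots> \<le> (d / (2 * real k + d)) powr ((d - 1) / 2)
      * ((2 * real k + d) / (2 * real k + 2 + d)) powr ((d - 1) / 2)"
    using assms by (intro mult_mono Suc bessel_coeff_ratio) auto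
  also have "\<dots> = (d / (2 * real (Suc k) + d)) powr ((d - 1) / 2)"
    using assms by (simp add: add_ac flip: powr_mult)
  finally show ?case .
qed

lemma bessel_coeff_summable:
  fixes d y :: real
  assumes "d \<ge> 1"
  shows "summable (\<lambda>k. bessel_coeff d k * y ^ k)"
proof (rule summable_comparison_test')
  show "summable (\<lambda>k. inverse (fact k) * \<bar>y\<bar> ^ k)" by (rule summable_exp)
  fix k
  have "bessel_coeff d k * fact k \<le> bessel_coeff d k * fact (2 * k)"
    using bessel_coeff_pos[of d k] assms by (intro mult_left_mono fact_mono) auto
  also have "\<dots> \<le> (d / (2 * real k + d)) powr ((d - 1) / 2)" by (rule bessel_coeff_bound[OF assms])
  also have "\<dots> \<le> 1" using assms by (intro powr_le1) auto
  finally have "bessel_coeff d k \<le> inverse (fact k)" by (simp add: field_simps)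
  then show "norm (bessel_coeff d k * y ^ k) \<le> inverse (fact k) * \<bar>y\<bar> ^ k"
    using bessel_coeff_pos[of d k] assms by (auto simp: abs_mult power_abs intro!: mult_right_mono)
qed

lemma bessel_psi_smooth: "d \<ge> 1 \<Longrightarrow> smooth_on (bessel_psi d) UNIV"
  unfolding bessel_psi_def by (intro smooth_powser bessel_coeff_summable)

lemma bessel_psi_ge_1:
  assumes "d \<ge> 1" "r \<ge> 0"
  shows "bessel_psi d r \<ge> 1"
proof -
  have "(\<Sum>k\<in>{0}. bessel_coeff d k * r ^ k) \<le> bessel_psi d r"
    unfolding bessel_psi_def
    using assms bessel_coeff_pos[of d] by (intro sum_le_suminf bessel_coeff_summable) (auto simp: less_imp_le)
  then show ?thesis by simp
qed

lemma bessel_psi_mono: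
  assumes "d \<ge> 1" "0 \<le> r" "r \<le> s"
  shows "bessel_psi d r \<le> bessel_psi d s"
  unfolding bessel_psi_def
  using assms bessel_coeff_pos[of d]
  by (intro suminf_le bessel_coeff_summable mult_left_mono power_mono) (auto simp: less_imp_le)

lemma bessel_psi_ode:
  assumes d: "d \<ge> 1"
  shows "4 * r * deriv (deriv (bessel_psi d)) r + 2 * d * deriv (bessel_psi d) r = bessel_psi d r"
proof -
  let ?c = "bessel_coeff d"
  note s0 = bessel_coeff_summable[OF d]
  have s1: "summable (\<lambda>k. diffs ?c k * y ^ k)" for y by (rule termdiff_converges_all[OF s0])
  have s2: "summable (\<lambda>k. diffs (diffs ?c) k * y ^ k)" for y by (rule termdiff_converges_all[OF s1])
  have d1: "deriv (bessel_psi d) = (\<lambda>y. \<Sum>k. diffs ?c k * y ^ k)"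
    unfolding bessel_psi_def
    using termdiffs_strong_converges_everywhere[OF s0] by (intro ext DERIV_imp_deriv)
  have d2: "deriv (deriv (bessel_psi d)) = (\<lambda>y. \<Sum>k. diffs (diffs ?c) k * y ^ k)"
    unfolding d1
    using termdiffs_strong_converges_everywhere[OF s1] by (intro ext DERIV_imp_deriv)
  have "(\<lambda>k. r * (diffs (diffs ?c) k * r ^ k)) sums (r * (\<Sum>k. diffs (diffs ?c) k * r ^ k))"
    using s2 by (intro sums_mult summable_sums)
  then have "(\<lambda>k. real (Suc k) * diffs ?c (Suc k) * r ^ Suc k) sums (r * (\<Sum>k. diffs (diffs ?c) k * r ^ k))"
    by (simp add: diffs_def mult_ac)
  \<comment> \<open>The term with \<open>k = 0\<close> vanishes, so the index shift leaves no
    boundary term.\<close>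
  then have A: "(\<lambda>k. real k * diffs ?c k * r ^ k) sums (r * (\<Sum>k. diffs (diffs ?c) k * r ^ k))"
    using sums_Suc_iff[of "\<lambda>k. real k * diffs ?c k * r ^ k"] by simp
  have B: "(\<lambda>k. diffs ?c k * r ^ k) sums (\<Sum>k. diffs ?c k * r ^ k)" using s1 by (rule summable_sums)
  have "(\<lambda>k. 4 * (real k * diffs ?c k * r ^ k) + 2 * d * (diffs ?c k * r ^ k)) sums
     (4 * (r * (\<Sum>k. diffs (diffs ?c) k * r ^ k)) + 2 * d * (\<Sum>k. diffs ?c k * r ^ k))"
    by (intro sums_add sums_mult A B)
  moreover have "4 * (real k * diffs ?c k * r ^ k) + 2 * d * (diffs ?c k * r ^ k) = ?c k * r ^ k" for k
  proof -
    have "(2 * real k + 2) * (2 * real k + d) \<noteq> 0" using d by (simp add: add_nonneg_eq_0_iff)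
    then have "4 * (real k * diffs ?c k) + 2 * d * diffs ?c k = ?c k"
      by (simp add: diffs_def divide_simps) (simp add: algebra_simps)
    then show ?thesis by (metis (no_types, lifting) distrib_right mult.assoc)
  qed
  ultimately have "(\<lambda>k. ?c k * r ^ k) sums
     (4 * (r * (\<Sum>k. diffs (diffs ?c) k * r ^ k)) + 2 * d * (\<Sum>k. diffs ?c k * r ^ k))" by simp
  then show ?thesis unfolding d2 unfolding d1 by (simp add: bessel_psi_def sums_iff mult.assoc)
qed

text \<open>Used with m = 2k: a factor (2k+1)^(-N) turns 1/(2k)! into at most N!/(2k+N)!, up to the
  constant a coefficient of a shifted exponential series. Each step in \<open>N\<close> rests on m +
  N + 1 <= (N+1)(m+1).\<close>

lemma fact_add_le: "(fact (m + N) :: real) \<le> fact N * fact m * (real m + 1) ^ N"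
proof (induction N)
  case (Suc N)
  have "(fact (m + Suc N) :: real) = (real m + real N + 1) * fact (m + N)" by (simp add: algebra_simps)
  also have "\<dots> \<le> (real m + real N + 1) * (fact N * fact m * (real m + 1) ^ N)"
    by (intro mult_left_mono Suc) auto
  also have "\<dots> \<le> ((real N + 1) * (real m + 1)) * (fact N * fact m * (real m + 1) ^ N)"
    by (intro mult_right_mono) (auto simp: algebra_simps)
  also have "\<dots> = fact (Suc N) * fact m * (real m + 1) ^ Suc N" by (simp add: algebra_simps)
  finally show ?case .
qed auto

lemma even_exp_sum_le:
  fixes y :: real
  assumes "y \<ge> 0"
  shows "(\<Sum>k<K. y ^ (2 * k + N) / fact (2 * k + N)) \<le> exp y"
proof -
  have "(\<Sum>k<K. y ^ (2 * k + N) / fact (2 * k + N)) = (\<Sum>m\<in>(\<lambda>k. 2 * k + N) ` {..<K}. y ^ m / fact m)"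
    by (subst sum.reindex) (auto simp: inj_on_def)
  also have "\<dots> \<le> (\<Sum>m. y ^ m / fact m)"
    using summable_exp[of y] assms by (intro sum_le_suminf) (auto simp: field_simps)
  also have "\<dots> = exp y" by (simp add: exp_def scaleR_conv_of_real field_simps)
  finally show ?thesis .
qed

text \<open>Multiplied by y^a with a = (d-1)/2, the k-th term of the series at y^2 is at most d^a
  z^a y^(2k)/(2k)!, where z = y/(2k+1). Since z^a <= 1 + z^N for an integer N >= a, it is dominated
  by two series, each made of terms of the series of exp y.\<close>

lemma bessel_psi_growth:
  assumes d: "d \<ge> 1"
  obtains K where "K > 0" "\<And>r. r \<ge> 0 \<Longrightarrow> bessel_psi d (r\<^sup>2) \<le> K * (1 + r) powr (- (d - 1) / 2) * exp r"
proof -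
  define a where "a = (d - 1) / 2"
  have a: "a \<ge> 0" using d by (simp add: a_def)
  obtain N :: nat where N: "real N \<ge> a" using real_arch_simple by blast
  define M where "M = d powr a * (1 + fact N)"
  have M: "M > 0" using d by (auto simp: M_def intro!: mult_pos_pos add_pos_pos)
  have term_le: "bessel_coeff d k * (y\<^sup>2) ^ k * y powr a
      \<le> d powr a * (y ^ (2 * k + 0) / fact (2 * k + 0) + fact N * (y ^ (2 * k + N) / fact (2 * k + N)))"
    if y: "y \<ge> 1" for y k
  proof -
    define z where "z = y / (2 * real k + 1)"
    have z: "z > 0" using y by (simp add: z_def)
    have z1: "z powr a \<le> 1 + z ^ N"
    proof (cases "z \<le> 1")
      case True
      then have "z powr a \<le> 1" using z a by (intro powr_le1) auto
      then show ?thesis using z by (simp add: add_increasing2)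
    next
      case False
      then have "z powr a \<le> z powr real N" using N by (intro powr_mono) auto
      then show ?thesis using z by (simp add: powr_realpow)
    qed
    have zN: "z ^ N * (y ^ (2 * k) / fact (2 * k)) \<le> fact N * (y ^ (2 * k + N) / fact (2 * k + N))"
    proof -
      have "z ^ N * (y ^ (2 * k) / fact (2 * k)) = y ^ (2 * k + N) / (fact (2 * k) * (2 * real k + 1) ^ N)"
        by (simp add: z_def power_divide power_add mult_ac)
      also have "\<dots> \<le> y ^ (2 * k + N) / (fact (2 * k + N) / fact N)"
        using y fact_add_le[of "2 * k" N]
        by (intro divide_left_mono) (auto simp: field_simps)
      finally show ?thesis by (simp add: mult_ac)
    qed
    have "bessel_coeff d k * fact (2 * k) \<le> (d / (2 * real k + d)) powr a"
      using bessel_coeff_bound[OF d, of k] by (simp add: a_def)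
    also have "\<dots> \<le> (d / (2 * real k + 1)) powr a"
      using d a by (intro powr_mono2 divide_left_mono) auto
    finally have "bessel_coeff d k \<le> (d / (2 * real k + 1)) powr a / fact (2 * k)"
      by (simp add: field_simps)
    then have "bessel_coeff d k * (y\<^sup>2) ^ k * y powr a
        \<le> (d / (2 * real k + 1)) powr a / fact (2 * k) * (y\<^sup>2) ^ k * y powr a"
      using y by (intro mult_right_mono) auto
    also have "\<dots> = d powr a * (z powr a * (y ^ (2 * k) / fact (2 * k)))"
      using y d by (simp add: z_def powr_divide power_mult)
    also have "\<dots> \<le> d powr a * ((1 + z ^ N) * (y ^ (2 * k) / fact (2 * k)))"
      using z1 y by (intro mult_left_mono mult_right_mono) auto
    also have "\<dots> \<le> d powr a * (y ^ (2 * k + 0) / fact (2 * k + 0) + fact N * (y ^ (2 * k + N) / fact (2 * k + N)))"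
      using zN by (intro mult_left_mono) (auto simp: distrib_right add_divide_distrib)
    finally show ?thesis .
  qed
  have main: "bessel_psi d (y\<^sup>2) * y powr a \<le> M * exp y" if y: "y \<ge> 1" for y
    unfolding bessel_psi_def suminf_mult2[OF bessel_coeff_summable[OF d]]
  proof (rule suminf_le_const[OF summable_mult2[OF bessel_coeff_summable[OF d]]])
    fix K
    have "(\<Sum>k<K. bessel_coeff d k * (y\<^sup>2) ^ k * y powr a)
       \<le> (\<Sum>k<K. d powr a * (y ^ (2 * k + 0) / fact (2 * k + 0) + fact N * (y ^ (2 * k + N) / fact (2 * k + N))))"
      by (intro sum_mono term_le y)
    also have "\<dots> = d powr a * ((\<Sum>k<K. y ^ (2 * k + 0) / fact (2 * k + 0))
        + fact N * (\<Sum>k<K. y ^ (2 * k + N) / fact (2 * k + N)))"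
      by (simp only: sum_distrib_left sum.distrib distrib_left)
    also have "\<dots> \<le> d powr a * (exp y + fact N * exp y)"
      using y by (intro mult_left_mono add_mono even_exp_sum_le) auto
    also have "\<dots> = M * exp y" by (simp add: M_def algebra_simps)
    finally show "(\<Sum>k<K. bessel_coeff d k * (y\<^sup>2) ^ k * y powr a) \<le> M * exp y" .
  qed
  show ?thesis
  proof (rule that[of "M * exp 1"])
    show "M * exp 1 > 0" using M by simp
    fix r :: real assume r: "r \<ge> 0"
    \<comment> \<open>Moving the argument to 1 + r >= 1, where \<open>main\<close> applies, avoids a
      separate treatment of small r and costs only the factor \<open>exp 1\<close>.\<close>
    have "bessel_psi d (r\<^sup>2) \<le> bessel_psi d ((1 + r)\<^sup>2)"
      using r by (intro bessel_psi_mono d power_mono) auto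
    also have "\<dots> \<le> M * exp (1 + r) * (1 + r) powr (- a)"
      using main[of "1 + r"] r by (simp add: powr_minus field_simps)
    finally show "bessel_psi d (r\<^sup>2) \<le> M * exp 1 * (1 + r) powr (- (d - 1) / 2) * exp r"
      by (simp add: a_def exp_add mult_ac minus_divide_left)
  qed
qed

section \<open>Exponential integrals over balls\<close>

lemma power_Suc_diff_le:
  fixes k :: real
  assumes "k \<ge> 0"
  shows "(k + 1) ^ d - k ^ d \<le> real d * (k + 1) ^ (d - 1)"
proof (induction d)
  case (Suc d)
  have "(k + 1) ^ Suc d - k ^ Suc d = (k + 1) * ((k + 1) ^ d - k ^ d) + k ^ d" by (simp add: algebra_simps)
  also have "\<dots> \<le> (k + 1) * (real d * (k + 1) ^ (d - 1)) + (k + 1) ^ d"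
    using assms Suc by (intro add_mono mult_left_mono power_mono) auto
  also have "\<dots> = real (Suc d) * (k + 1) ^ (Suc d - 1)"
    by (cases d) (simp_all add: algebra_simps)
  finally show ?case .
qed auto

lemma set_integrable_cball:
  fixes f :: "'a::euclidean_space \<Rightarrow> real"
  assumes "continuous_on UNIV f"
  shows "set_integrable lebesgue (cball c r) f"
proof -
  have "set_integrable lborel (cball c r) f"
    unfolding set_integrable_def
    using assms by (intro borel_integrable_compact) (auto intro: continuous_on_subset)
  then show ?thesis
    unfolding set_integrable_def using assms borel_measurable_continuous_onI[OF assms]
    by (subst integrable_completion) (auto intro!: borel_measurable_scaleR)
qed

text \<open>Summation over unit shells in place of polar coordinates: the shell from k to k + 1 has
  volume of order at most (1+k)^(n-1), and the integrand there is at most exp (b (k+1)). The factor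
  1/(1 - exp (-b)) is the sum of the geometric series; with it the bounds for ball and shell add up
  exactly in the induction step.\<close>

lemma integral_exp_norm_nat:
  assumes b: "b > 0"
  shows "(LINT x:cball (0::'a::euclidean_space) (real k)|lebesgue. exp (b * norm x))
    \<le> unit_ball_vol (DIM('a)) * DIM('a) / (1 - exp (- b)) * exp (b * k) * (1 + real k) ^ (DIM('a) - 1)"
proof (induction k)
  case 0
  have "(LINT x:cball (0::'a) 0|lebesgue. exp (b * norm x)) = (LINT x:cball (0::'a) 0|lebesgue. 1)"
    by (rule set_lebesgue_integral_cong) auto
  also have "\<dots> = 0" by (simp add: set_lebesgue_integral_def)
  finally show ?case using b by simp
next
  case (Suc k)
  let ?B = "\<lambda>k. cball (0::'a) (real k)"
  let ?n = "DIM('a)"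
  define C where "C = unit_ball_vol (real ?n) * ?n / (1 - exp (- b))"
  have C: "C \<ge> 0" "C * (1 - exp (- b)) = unit_ball_vol (real ?n) * ?n" using b by (auto simp: C_def)
  define D where "D = ?B (Suc k) - ?B k"
  have U: "?B (Suc k) = ?B k \<union> D" unfolding D_def by auto
  have int: "set_integrable lebesgue (?B j) (\<lambda>x. exp (b * norm x))" for j
    by (intro set_integrable_cball continuous_intros)
  have Ds: "D \<in> sets lebesgue" by (auto simp: D_def)
  have intD: "set_integrable lebesgue D (\<lambda>x. exp (b * norm x))"
    by (rule set_integrable_subset[OF int[of "Suc k"]]) (use Ds in \<open>auto simp: D_def\<close>)
  have fm: "?B j \<in> fmeasurable lebesgue" for j
    by (simp add: lmeasurable_cball)
  have "emeasure lebesgue D < \<infinity>"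
    using fmeasurable_Diff[OF fm[of "Suc k"], of "?B k"] unfolding D_def fmeasurable_def by auto
  then have "(LINT x:D|lebesgue. exp (b * norm x)) \<le> (LINT x:D|lebesgue. exp (b * Suc k))"
    using b Ds
    by (intro set_integral_mono intD) (auto simp: D_def set_integrable_def)
  also have "\<dots> = exp (b * Suc k) * measure lebesgue D"
    using fmeasurable_Diff[OF fm[of "Suc k"], of "?B k"] Ds
    by (simp add: set_lebesgue_integral_def D_def fmeasurableD2)
  also have "measure lebesgue D = unit_ball_vol (real ?n) * ((real k + 1) ^ ?n - real k ^ ?n)"
    unfolding D_def using fm
    by (subst measure_Diff) (use fmeasurableD2[OF fm[of "Suc k"]] in
      \<open>auto simp: content_cball algebra_simps\<close>)
  also have "exp (b * Suc k) * (unit_ball_vol (real ?n) * ((real k + 1) ^ ?n - real k ^ ?n))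
      \<le> exp (b * Suc k) * (unit_ball_vol (real ?n) * (?n * (real k + 1) ^ (?n - 1)))"
    by (intro mult_left_mono power_Suc_diff_le) auto
  also have "\<dots> = C * (1 - exp (- b)) * exp (b * Suc k) * (1 + real k) ^ (?n - 1)"
    by (subst C(2)) (simp add: mult_ac add_ac)
  finally have D: "(LINT x:D|lebesgue. exp (b * norm x)) \<le> C * (1 - exp (- b)) * exp (b * Suc k) * (1 + real k) ^ (?n - 1)" .
  have "(LINT x:?B (Suc k)|lebesgue. exp (b * norm x))
      = (LINT x:?B k|lebesgue. exp (b * norm x)) + (LINT x:D|lebesgue. exp (b * norm x))"
    unfolding U by (rule set_integral_Un) (use int intD in \<open>auto simp: D_def\<close>)
  also have "\<dots> \<le> C * exp (b * k) * (1 + real k) ^ (?n - 1)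
      + C * (1 - exp (- b)) * exp (b * Suc k) * (1 + real k) ^ (?n - 1)"
    using Suc D by (simp add: C_def)
  also have "\<dots> = C * exp (b * Suc k) * (1 + real k) ^ (?n - 1)"
  proof -
    have "exp (b * k) = exp (- b) * exp (b * Suc k)" by (simp add: algebra_simps flip: exp_add)
    then show ?thesis by (simp add: algebra_simps)
  qed
  also have "\<dots> \<le> C * exp (b * Suc k) * (1 + real (Suc k)) ^ (?n - 1)"
    using C by (intro mult_left_mono power_mono) auto
  finally show ?case by (simp add: C_def)
qed

lemma integral_exp_norm:
  assumes b: "b > 0"
  obtains K where "K > 0" "\<And>\<rho>. \<rho> \<ge> 0 \<Longrightarrow>
    (LINT x:cball (0::'a::euclidean_space) \<rho>|lebesgue. exp (b * norm x)) \<le> K * exp (b * \<rho>) * (1 + \<rho>) ^ (DIM('a) - 1)"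
proof -
  let ?n = "DIM('a)"
  define C where "C = unit_ball_vol (real ?n) * ?n / (1 - exp (- b))"
  have C: "C > 0" using b by (auto simp: C_def)
  show ?thesis
  proof (rule that[of "C * exp b * 2 ^ (?n - 1)"])
    show "C * exp b * 2 ^ (?n - 1) > 0" using C by simp
    fix \<rho> :: real assume r: "\<rho> \<ge> 0"
    define k where "k = nat \<lceil>\<rho>\<rceil>"
    have k: "\<rho> \<le> k" "k \<le> \<rho> + 1" using r by (auto simp: k_def)
    have "(LINT x:cball (0::'a) \<rho>|lebesgue. exp (b * norm x)) \<le> (LINT x:cball (0::'a) (real k)|lebesgue. exp (b * norm x))"
    proof -
      have "integrable lebesgue (\<lambda>x. indicator (cball 0 s) x *\<^sub>R exp (b * norm (x::'a)))" for s
        unfolding set_integrable_def[symmetric] by (intro set_integrable_cball continuous_intros)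
      from integral_mono[OF this this] show ?thesis
        unfolding set_lebesgue_integral_def by this (use k in \<open>auto simp: indicator_def\<close>)
    qed
    also have "\<dots> \<le> C * exp (b * k) * (1 + real k) ^ (?n - 1)"
      unfolding C_def by (rule integral_exp_norm_nat[OF b])
    also have "\<dots> \<le> C * exp (b * (\<rho> + 1)) * (2 * (1 + \<rho>)) ^ (?n - 1)"
      using C k b r by (intro mult_mono power_mono) auto
    also have "\<dots> = C * exp b * 2 ^ (?n - 1) * exp (b * \<rho>) * (1 + \<rho>) ^ (?n - 1)"
      by (simp only: power_mult_distrib) (simp add: distrib_left exp_add mult_ac)
    finally show "(LINT x:cball (0::'a) \<rho>|lebesgue. exp (b * norm x)) \<le>
        C * exp b * 2 ^ (?n - 1) * exp (b * \<rho>) * (1 + \<rho>) ^ (?n - 1)" .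
  qed
qed

text \<open>Since \<open>(1 + \<rho>) / (1 + r) \<le> 1 + (\<rho> - r)\<close>, the polynomial factor can be evaluated on the
  boundary of the ball at the cost of half of the exponential decay.\<close>

lemma powr_exp_boundary:
  fixes r \<rho> a :: real
  assumes "0 \<le> r" "r \<le> \<rho>" "a \<ge> 0"
  shows "(1 + r) powr (- a) * exp r \<le> exp (2 * a\<^sup>2) * (1 + \<rho>) powr (- a) * exp (\<rho> / 2) * exp (r / 2)"
proof -
  have l: "ln (1 + \<rho>) - ln (1 + r) \<le> ln (1 + (\<rho> - r))"
  proof -
    have "1 + \<rho> \<le> (1 + r) * (1 + (\<rho> - r))"
      using assms mult_nonneg_nonneg[of r "\<rho> - r"] by (simp add: algebra_simps)
    then have "ln (1 + \<rho>) \<le> ln ((1 + r) * (1 + (\<rho> - r)))" using assms by (subst ln_le_cancel_iff) auto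
    then show ?thesis using assms by (simp add: ln_mult)
  qed
  have "a * ln (1 + s) \<le> 2 * a\<^sup>2 + s / 2" if s: "s \<ge> 0" for s
  proof -
    \<comment> \<open>Dividing by 1 + 2a before using ln (1 + x) <= x lowers the slope to 1/(1 +
      2a), so that multiplication by \<open>a\<close> leaves at most s/2. The separated term ln (1 +
      2a) <= 2a is the source of 2a^2.\<close>
    have "1 + s / (1 + 2 * a) \<ge> (1 + s) / (1 + 2 * a)" using s assms by (simp add: field_simps)
    then have "ln ((1 + s) / (1 + 2 * a)) \<le> ln (1 + s / (1 + 2 * a))"
      using s assms by (subst ln_le_cancel_iff) (auto intro!: add_pos_nonneg divide_nonneg_pos)
    also have "\<dots> \<le> s / (1 + 2 * a)" using s assms by (intro ln_add_one_self_le_self) auto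
    finally have "ln (1 + s) \<le> s / (1 + 2 * a) + ln (1 + 2 * a)"
      using s assms by (simp add: ln_div)
    also have "ln (1 + 2 * a) \<le> 2 * a" using assms by (intro ln_add_one_self_le_self) auto
    finally have "a * ln (1 + s) \<le> a * (s / (1 + 2 * a) + 2 * a)" using assms by (intro mult_left_mono) auto
    also have "\<dots> \<le> 2 * a\<^sup>2 + s / 2"
      using assms s by (simp add: power2_eq_square field_simps)
    finally show ?thesis .
  qed
  from this[of "\<rho> - r"] l have "a * (ln (1 + \<rho>) - ln (1 + r)) \<le> 2 * a\<^sup>2 + (\<rho> - r) / 2"
    using assms mult_left_mono[OF l, of a] by simp
  then have "- a * ln (1 + r) + r \<le> 2 * a\<^sup>2 + (- a * ln (1 + \<rho>)) + \<rho> / 2 + r / 2"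
    by (simp add: algebra_simps diff_divide_distrib)
  then have "exp (- a * ln (1 + r) + r) \<le> exp (2 * a\<^sup>2 + (- a * ln (1 + \<rho>)) + \<rho> / 2 + r / 2)" by simp
  moreover have "(1 + r) powr (- a) * exp r = exp (- a * ln (1 + r) + r)"
    using assms by (simp add: powr_def flip: exp_add)
  moreover have "exp (2 * a\<^sup>2) * (1 + \<rho>) powr (- a) * exp (\<rho> / 2) * exp (r / 2)
      = exp (2 * a\<^sup>2 + (- a * ln (1 + \<rho>)) + \<rho> / 2 + r / 2)"
    using assms by (simp add: powr_def flip: exp_add)
  ultimately show ?thesis by (simp only:)
qed

lemma bessel_psi_Lq:
  fixes q :: real
  assumes q: "q > 0"
  obtains K where "K > 0" "\<And>\<rho>. \<rho> \<ge> 0 \<Longrightarrow>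
    (LINT x:cball (0::'a::euclidean_space) \<rho>|lebesgue. bessel_psi (DIM('a)) ((norm x)\<^sup>2) powr q)
     \<le> K * (1 + \<rho>) powr ((real DIM('a) - 1) * (1 - q / 2)) * exp (q * \<rho>)"
proof -
  let ?n = "DIM('a)"
  define d where "d = real ?n"
  have d: "d \<ge> 1" by (simp add: d_def DIM_positive Suc_leI)
  obtain K1 where K1: "K1 > 0" "\<And>r. r \<ge> 0 \<Longrightarrow> bessel_psi d (r\<^sup>2) \<le> K1 * (1 + r) powr (- (d - 1) / 2) * exp r"
    by (rule bessel_psi_growth[OF d]) blast
  obtain K2 where K2: "K2 > 0" "\<And>\<rho>. \<rho> \<ge> 0 \<Longrightarrow>
    (LINT x:cball (0::'a::euclidean_space) \<rho>|lebesgue. exp (q / 2 * norm x)) \<le> K2 * exp (q / 2 * \<rho>) * (1 + \<rho>) ^ (DIM('a) - 1)"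
    using integral_exp_norm[of "q / 2"] q by auto
  define a where "a = (d - 1) / 2"
  have a: "a \<ge> 0" using d by (simp add: a_def)
  have ea: "- (d - 1) / 2 = - a" unfolding a_def by (simp only: minus_divide_left)
  define M where "M = K1 * exp (2 * a\<^sup>2)"
  have M: "M > 0" using K1 by (simp add: M_def)
  have pos: "bessel_psi d ((norm x)\<^sup>2) > 0" for x :: 'a using bessel_psi_ge_1[OF d, of "(norm x)\<^sup>2"] by simp
  have cont: "continuous_on UNIV (\<lambda>x::'a. bessel_psi d ((norm x)\<^sup>2))"
    by (rule continuous_on_compose2[OF smooth_on_imp_continuous_on[OF bessel_psi_smooth[OF d]]])
       (auto intro!: continuous_intros)
  show ?thesis
  proof (rule that[of "M powr q * K2"])
    show "M powr q * K2 > 0" using M K2 by simp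
    fix \<rho> :: real assume r: "\<rho> \<ge> 0"
    define L where "L = (M * (1 + \<rho>) powr (- a) * exp (\<rho> / 2)) powr q"
    have "(LINT x:cball (0::'a) \<rho>|lebesgue. bessel_psi d ((norm x)\<^sup>2) powr q)
      \<le> (LINT x:cball (0::'a) \<rho>|lebesgue. L * exp (q / 2 * norm x))"
    proof (rule set_integral_mono)
      have "continuous_on UNIV (\<lambda>x::'a. bessel_psi d ((norm x)\<^sup>2) powr q)"
        by (intro continuous_intros cont) (use pos in \<open>auto simp: less_le\<close>)
      then show "set_integrable lebesgue (cball 0 \<rho>) (\<lambda>x::'a. bessel_psi d ((norm x)\<^sup>2) powr q)"
        by (rule set_integrable_cball)
      show "set_integrable lebesgue (cball 0 \<rho>) (\<lambda>x::'a. L * exp (q / 2 * norm x))"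
        by (intro set_integrable_cball continuous_intros)
      fix x :: 'a assume x: "x \<in> cball 0 \<rho>"
      have "bessel_psi d ((norm x)\<^sup>2) \<le> K1 * ((1 + norm x) powr (- a) * exp (norm x))"
        using K1(2)[of "norm x", unfolded ea] by (simp add: mult.assoc)
      also have "\<dots> \<le> K1 * (exp (2 * a\<^sup>2) * (1 + \<rho>) powr (- a) * exp (\<rho> / 2) * exp (norm x / 2))"
        using K1 x a by (intro mult_left_mono powr_exp_boundary) auto
      also have "\<dots> = (M * (1 + \<rho>) powr (- a) * exp (\<rho> / 2)) * exp (norm x / 2)"
        by (simp add: M_def mult_ac)
      finally have "bessel_psi d ((norm x)\<^sup>2) powr q
          \<le> ((M * (1 + \<rho>) powr (- a) * exp (\<rho> / 2)) * exp (norm x / 2)) powr q"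
        using q pos[of x] by (intro powr_mono2) auto
      also have "\<dots> = L * exp (q / 2 * norm x)"
        using M r by (simp add: L_def powr_mult powr_def[of "exp (norm x / 2)"] mult_ac)
      finally show "bessel_psi d ((norm x)\<^sup>2) powr q \<le> L * exp (q / 2 * norm x)" .
    qed
    also have "\<dots> = L * (LINT x:cball (0::'a) \<rho>|lebesgue. exp (q / 2 * norm x))" by simp
    also have "\<dots> \<le> L * (K2 * exp (q / 2 * \<rho>) * (1 + \<rho>) ^ (?n - 1))"
      by (intro mult_left_mono K2 r) (auto simp: L_def)
    also have "L = M powr q * (1 + \<rho>) powr (- a * q) * exp (q / 2 * \<rho>)"
      using M r by (simp add: L_def powr_mult powr_powr powr_def[of "exp _"] mult_ac)
    also have "(1 + \<rho>) ^ (?n - 1) = (1 + \<rho>) powr (d - 1)"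
      using r DIM_positive[where 'a='a] by (simp add: d_def of_nat_diff Suc_leI flip: powr_realpow)
    also have "M powr q * (1 + \<rho>) powr (- a * q) * exp (q / 2 * \<rho>) * (K2 * exp (q / 2 * \<rho>) * (1 + \<rho>) powr (d - 1))
       = M powr q * K2 * ((1 + \<rho>) powr (- a * q) * (1 + \<rho>) powr (d - 1)) * (exp (q / 2 * \<rho>) * exp (q / 2 * \<rho>))"
      by (simp add: mult_ac)
    also have "(1 + \<rho>) powr (- a * q) * (1 + \<rho>) powr (d - 1) = (1 + \<rho>) powr ((d - 1) * (1 - q / 2))"
      by (simp add: a_def algebra_simps diff_divide_distrib flip: powr_add)
    also have "exp (q / 2 * \<rho>) * exp (q / 2 * \<rho>) = exp (q * \<rho>)" by (simp flip: exp_add)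
    finally show "(LINT x:cball (0::'a) \<rho>|lebesgue. bessel_psi ?n ((norm x)\<^sup>2) powr q)
      \<le> M powr q * K2 * (1 + \<rho>) powr ((real ?n - 1) * (1 - q / 2)) * exp (q * \<rho>)"
      unfolding d_def .
  qed
qed

subsection \<open>Damped ordinary differential inequalities\<close>

text \<open>For estimates available only over short intervals: a uniform partition chains
  them.\<close>

lemma mono_by_small_steps:
  fixes E :: "real \<Rightarrow> real"
  assumes "s \<le> t" "\<delta> > 0"
    and step: "\<And>a b. s \<le> a \<Longrightarrow> a \<le> b \<Longrightarrow> b \<le> t \<Longrightarrow> b - a \<le> \<delta> \<Longrightarrow> E a \<le> E b"
  shows "E s \<le> E t"
proof -
  obtain N :: nat where N: "(t - s) / \<delta> < real N" using reals_Archimedean2 by blast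
  have "(t - s) / \<delta> \<ge> 0" using assms by simp
  then have N0: "N > 0" using N by (cases N) auto
  define h where "h = (t - s) / N"
  have h: "0 \<le> h" "h \<le> \<delta>" "real N * h = t - s"
    using assms N N0 by (auto simp: h_def field_simps)
  have "E s \<le> E (s + real k * h)" if "k \<le> N" for k
    using that
  proof (induction k)
    case (Suc k)
    have "real (Suc k) * h \<le> real N * h" using Suc.prems h by (intro mult_right_mono) auto
    then have "E (s + real k * h) \<le> E (s + real (Suc k) * h)"
      using h by (intro step) (auto simp: algebra_simps)
    then show ?case using Suc by simp
  qed simp
  from this[of N] h show ?thesis by simp
qed

text \<open>The product rule for w V as an inequality, for a \<open>V\<close> controlled only
  through its increments. Subtracting the primitive \<open>H\<close> of \<open>h\<close> leaves a
  continuous nondecreasing \<open>D\<close>, and what remains is the nonnegativity of the Stieltjes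
  integral of \<open>w\<close> against dD, written by parts.\<close>

lemma integrating_factor:
  fixes V h w w' :: "real \<Rightarrow> real"
  assumes st: "s \<le> t"
    and V: "continuous_on {s..t} V" and h: "continuous_on {s..t} h"
    and diff: "\<And>a b. s \<le> a \<Longrightarrow> a \<le> b \<Longrightarrow> b \<le> t \<Longrightarrow> V b - V a \<ge> integral {a..b} h"
    and w: "\<And>r. r \<in> {s..t} \<Longrightarrow> (w has_real_derivative w' r) (at r within {s..t})"
    and w': "continuous_on {s..t} w'" and pos: "\<And>r. r \<in> {s..t} \<Longrightarrow> w r > 0"
  shows "w t * V t - w s * V s \<ge> integral {s..t} (\<lambda>r. w' r * V r + w r * h r)"
proof -
  define H where "H = (\<lambda>x. integral {s..x} h)"
  define D where "D x = V x - H x" for x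
  have H: "(H has_real_derivative h x) (at x within {s..t})" if "x \<in> {s..t}" for x
    unfolding H_def by (rule integral_has_real_derivative[OF h that])
  have Hc: "continuous_on {s..t} H" using H by (intro DERIV_continuous_on)
  have wc: "continuous_on {s..t} w" using w by (intro DERIV_continuous_on)
  have Dc: "continuous_on {s..t} D" unfolding D_def by (intro continuous_intros V Hc)
  have Dmono: "D a \<le> D b" if "s \<le> a" "a \<le> b" "b \<le> t" for a b
  proof -
    have "H b = H a + integral {a..b} h"
      unfolding H_def using that h
      by (intro Henstock_Kurzweil_Integration.integral_combine[symmetric] integrable_continuous_real
          continuous_on_subset[OF h]) auto
    then show ?thesis using diff[OF that] by (simp add: D_def)
  qed
  have int: "g integrable_on {a..b}" if "continuous_on {s..t} g" "s \<le> a" "b \<le> t" for g :: "real \<Rightarrow> real" and a b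
    using that by (intro integrable_continuous_real continuous_on_subset[OF that(1)]) auto
  have wI: "(w' has_integral w b - w a) {a..b}" if "s \<le> a" "a \<le> b" "b \<le> t" for a b
    by (rule fundamental_theorem_of_calculus[OF that(2)], fold has_real_derivative_iff_has_vector_derivative)
      (rule has_field_derivative_subset[OF w]; use that in auto)
  define E where "E x = w x * D x - integral {s..x} (\<lambda>r. w' r * D r)" for x
  obtain m where m: "m > 0" "\<And>r. r \<in> {s..t} \<Longrightarrow> m \<le> w r"
  proof -
    obtain x where "x \<in> {s..t}" "\<forall>y\<in>{s..t}. w x \<le> w y"
      using continuous_attains_inf[OF _ _ wc] st by (auto simp: compact_Icc)
    then show ?thesis using that[of "w x"] pos by auto
  qed
  obtain M where M: "M > 0" "\<And>r. r \<in> {s..t} \<Longrightarrow> \<bar>w' r\<bar> \<le> M"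
  proof -
    have "bounded (w' ` {s..t})" by (intro compact_imp_bounded compact_continuous_image w') auto
    then obtain B where "\<forall>x\<in>w' ` {s..t}. norm x \<le> B" by (auto simp: bounded_iff)
    then show ?thesis by (intro that[of "max B 1"]) (auto simp: le_max_iff_disj)
  qed
  have "E s \<le> E t"
  \<comment> \<open>Replacing D by the constant D a under the integral over [a, b] errs by at most
    (b - a) M (D b - D a). A step of length at most m / M makes this no larger than the available
    gain w b (D b - D a).\<close>
  proof (rule mono_by_small_steps[OF st, of "m / M"])
    show "m / M > 0" using m M by simp
    fix a b assume ab: "s \<le> a" "a \<le> b" "b \<le> t" "b - a \<le> m / M"
    have c: "continuous_on {s..t} (\<lambda>r. w' r * D r)" "continuous_on {s..t} (\<lambda>r. w' r * D a + M * (D b - D a))"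
      by (intro continuous_intros w' Dc)+
    have "integral {a..b} (\<lambda>r. w' r * D r) \<le> integral {a..b} (\<lambda>r. w' r * D a + M * (D b - D a))"
    proof (rule integral_le)
      show "(\<lambda>r. w' r * D r) integrable_on {a..b}" "(\<lambda>r. w' r * D a + M * (D b - D a)) integrable_on {a..b}"
        using c ab by (auto intro: int)
      fix r assume r: "r \<in> {a..b}"
      have "w' r * (D r - D a) \<le> M * (D b - D a)"
        using M(2)[of r] r ab Dmono[of a r] Dmono[of r b] by (intro mult_mono) auto
      then show "w' r * D r \<le> w' r * D a + M * (D b - D a)" by (simp add: algebra_simps)
    qed
    also have "\<dots> = (w b - w a) * D a + (b - a) * (M * (D b - D a))"
    proof (rule integral_unique)
      show "((\<lambda>r. w' r * D a + M * (D b - D a)) has_integral (w b - w a) * D a + (b - a) * (M * (D b - D a))) {a..b}"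
        using has_integral_const_real[of "M * (D b - D a)" a b] ab
        by (intro has_integral_add has_integral_mult_left wI) auto
    qed
    also have "(b - a) * (M * (D b - D a)) \<le> m / M * (M * (D b - D a))"
      using ab Dmono[of a b] M by (intro mult_right_mono) auto
    also have "\<dots> \<le> w b * (D b - D a)"
      using ab Dmono[of a b] M m by (auto intro!: mult_right_mono)
    finally have 1: "integral {a..b} (\<lambda>r. w' r * D r) \<le> w b * D b - w a * D a" by (simp add: algebra_simps)
    have "integral {s..b} (\<lambda>r. w' r * D r) = integral {s..a} (\<lambda>r. w' r * D r) + integral {a..b} (\<lambda>r. w' r * D r)"
      using ab c by (intro Henstock_Kurzweil_Integration.integral_combine[symmetric] int) auto
    then show "E a \<le> E b" using 1 by (simp add: E_def)
  qed
  then have 2: "w t * D t - w s * D s \<ge> integral {s..t} (\<lambda>r. w' r * D r)" by (simp add: E_def)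
  \<comment> \<open>The part \<open>H\<close> is differentiable, so for it the product rule is an
    identity.\<close>
  have 3: "((\<lambda>r. w' r * H r + w r * h r) has_integral w t * H t - w s * H s) {s..t}"
  proof (rule fundamental_theorem_of_calculus[OF st])
    fix x assume x: "x \<in> {s..t}"
    show "((\<lambda>r. w r * H r) has_vector_derivative w' x * H x + w x * h x) (at x within {s..t})"
      using DERIV_mult[OF w[OF x] H[OF x]] by (simp add: has_real_derivative_iff_has_vector_derivative mult_ac add_ac)
  qed
  have "integral {s..t} (\<lambda>r. w' r * V r + w r * h r)
      = integral {s..t} (\<lambda>r. w' r * D r + (w' r * H r + w r * h r))"
    by (simp add: D_def algebra_simps)
  also have "\<dots> = integral {s..t} (\<lambda>r. w' r * D r) + integral {s..t} (\<lambda>r. w' r * H r + w r * h r)"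
    by (intro Henstock_Kurzweil_Integration.integral_add int continuous_intros w' Dc Hc wc h) auto
  also have "integral {s..t} (\<lambda>r. w' r * H r + w r * h r) = w t * H t - w s * H s"
    using 3 by (rule integral_unique)
  finally show ?thesis using 2 by (simp add: D_def algebra_simps)
qed

text \<open>The factor \<open>damping_weight \<mu> \<beta>\<close> removes the damping term: its logarithmic derivative is the
  damping coefficient, which is integrable because \<open>\<beta> > 1\<close>.\<close>

definition damping_weight :: "real \<Rightarrow> real \<Rightarrow> real \<Rightarrow> real" where
  "damping_weight \<mu> \<beta> t = exp (- (\<mu> * (1 + t) powr (1 - \<beta>) / (\<beta> - 1)))"

lemma damping_weight_deriv:
  assumes "\<beta> > 1" "t > -1"
  shows "(damping_weight \<mu> \<beta> has_real_derivative \<mu> / (1 + t) powr \<beta> * damping_weight \<mu> \<beta> t) (at t)"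
proof -
  have "((\<lambda>t. - (\<mu> / (\<beta> - 1)) * (1 + t) powr (1 - \<beta>)) has_real_derivative
      - (\<mu> / (\<beta> - 1)) * ((1 - \<beta>) * (1 + t) powr (1 - \<beta> - 1))) (at t)"
    using assms by (auto intro!: derivative_eq_intros)
  also have "- (\<mu> / (\<beta> - 1)) * ((1 - \<beta>) * (1 + t) powr (1 - \<beta> - 1)) = \<mu> / (1 + t) powr \<beta>"
    using assms by (simp add: powr_minus_divide divide_simps) (simp add: algebra_simps)
  finally have "((\<lambda>t. exp (- (\<mu> / (\<beta> - 1)) * (1 + t) powr (1 - \<beta>))) has_real_derivative
      exp (- (\<mu> / (\<beta> - 1)) * (1 + t) powr (1 - \<beta>)) * (\<mu> / (1 + t) powr \<beta>)) (at t)"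
    by (rule DERIV_fun_exp)
  moreover have "damping_weight \<mu> \<beta> = (\<lambda>t. exp (- (\<mu> / (\<beta> - 1)) * (1 + t) powr (1 - \<beta>)))"
    by (simp add: damping_weight_def fun_eq_iff)
  ultimately show ?thesis by (simp add: mult.commute)
qed

lemma damping_weight_pos: "damping_weight \<mu> \<beta> t > 0"
  by (simp add: damping_weight_def)

lemma damping_weight_bounds:
  assumes "\<beta> > 1" "\<mu> > 0" "t \<ge> 0"
  shows "exp (- (\<mu> / (\<beta> - 1))) \<le> damping_weight \<mu> \<beta> t" "damping_weight \<mu> \<beta> t \<le> 1"
proof -
  have "(1 + t) powr (1 - \<beta>) \<le> (1 + t) powr 0" using assms by (intro powr_mono) auto
  then have "\<mu> * (1 + t) powr (1 - \<beta>) / (\<beta> - 1) \<le> \<mu> * 1 / (\<beta> - 1)"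
    using assms by (intro divide_right_mono mult_left_mono) auto
  then show "exp (- (\<mu> / (\<beta> - 1))) \<le> damping_weight \<mu> \<beta> t" by (simp add: damping_weight_def)
  show "damping_weight \<mu> \<beta> t \<le> 1" using assms by (simp add: damping_weight_def)
qed

lemma damping_continuous: "continuous_on {0..t} (\<lambda>r::real. \<mu> / (1 + r) powr \<beta>)"
  by (intro continuous_intros) auto

text \<open>Multiplication by \<open>damping_weight\<close> absorbs the damping term, and the weight
  stays between exp (-\<mu>/(\<beta>-1)) and 1. The lower bound enters under the integral; the upper
  bound removes the weight from \<open>V t\<close>, which requires knowing
  \<open>V t \<ge> 0\<close> first.\<close>

lemma damped_lower_bound:
  fixes V k :: "real \<Rightarrow> real"
  assumes \<beta>: "\<beta> > 1" and \<mu>: "\<mu> > 0" and t: "0 \<le> t"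
    and V: "continuous_on {0..t} V" and k: "continuous_on {0..t} k"
    and diff: "\<And>a b. 0 \<le> a \<Longrightarrow> a \<le> b \<Longrightarrow> b \<le> t \<Longrightarrow>
      V b - V a \<ge> integral {a..b} (\<lambda>r. k r - \<mu> / (1 + r) powr \<beta> * V r)"
    and V0: "V 0 \<ge> 0" and k0: "\<And>r. r \<in> {0..t} \<Longrightarrow> k r \<ge> 0"
  shows "V t \<ge> exp (- (\<mu> / (\<beta> - 1))) * integral {0..t} k"
proof -
  let ?m = "damping_weight \<mu> \<beta>"
  note mb = damping_weight_bounds[OF \<beta> \<mu>]
  have d: "(?m has_real_derivative \<mu> / (1 + r) powr \<beta> * ?m r) (at r within {0..t})" if "r \<in> {0..t}" for r
    by (rule has_field_derivative_at_within[OF damping_weight_deriv[OF \<beta>]]) (use that in auto)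
  have mc: "continuous_on {0..t} ?m" using d by (intro DERIV_continuous_on)
  have "?m t * V t - ?m 0 * V 0 \<ge>
      integral {0..t} (\<lambda>r. (\<mu> / (1 + r) powr \<beta> * ?m r) * V r + ?m r * (k r - \<mu> / (1 + r) powr \<beta> * V r))"
    by (rule integrating_factor[OF t V _ diff d])
       (auto intro!: continuous_intros V k mc damping_continuous damping_weight_pos)
  also have "(\<lambda>r. (\<mu> / (1 + r) powr \<beta> * ?m r) * V r + ?m r * (k r - \<mu> / (1 + r) powr \<beta> * V r)) = (\<lambda>r. ?m r * k r)"
    by (auto simp: algebra_simps)
  finally have "?m t * V t \<ge> integral {0..t} (\<lambda>r. ?m r * k r)"
    using V0 mult_nonneg_nonneg[of "?m 0" "V 0"] damping_weight_pos[of \<mu> \<beta> 0] by linarith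
  moreover have "integral {0..t} (\<lambda>r. ?m r * k r) \<ge> integral {0..t} (\<lambda>r. exp (- (\<mu> / (\<beta> - 1))) * k r)"
    using k0 mb by (intro integral_le integrable_continuous_real continuous_intros mc k mult_right_mono) auto
  ultimately have 1: "?m t * V t \<ge> exp (- (\<mu> / (\<beta> - 1))) * integral {0..t} k" by simp
  have I: "integral {0..t} k \<ge> 0" using k0 k by (intro integral_nonneg integrable_continuous_real) auto
  then have "?m t * V t \<ge> 0" using 1 by (meson exp_ge_zero mult_nonneg_nonneg order_trans)
  then have "V t \<ge> 0" by (simp add: damping_weight_def zero_le_mult_iff)
  then have "?m t * V t \<le> V t" using mb(2)[OF t] by (simp add: mult_left_le_one_le damping_weight_def)
  then show ?thesis using 1 by linarith
qed

lemma nonneg_deriv_le: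
  fixes U V :: "real \<Rightarrow> real"
  assumes "a \<le> b" "\<And>r. r \<in> {a..b} \<Longrightarrow> (U has_real_derivative V r) (at r within {a..b})"
    "\<And>r. r \<in> {a..b} \<Longrightarrow> V r \<ge> 0"
  shows "U a \<le> U b"
proof -
  have "(V has_integral U b - U a) {a..b}"
    using assms(2) unfolding has_real_derivative_iff_has_vector_derivative
    by (rule fundamental_theorem_of_calculus[OF assms(1)])
  then have "0 \<le> U b - U a" by (rule has_integral_nonneg) (rule assms(3))
  then show ?thesis by simp
qed

text \<open>The sum \<open>A = U + U'\<close> satisfies \<open>A' \<ge> A - b U' \<ge> (1 - b) A\<close> with \<open>b\<close> integrable, and
  \<open>(e^t U)' = e^t A\<close>.\<close>

lemma damped_exponential_growth:
  fixes U V :: "real \<Rightarrow> real"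
  assumes \<beta>: "\<beta> > 1" and \<mu>: "\<mu> > 0" and t: "0 \<le> t"
    and UV: "\<And>r. r \<in> {0..t} \<Longrightarrow> (U has_real_derivative V r) (at r within {0..t})"
    and V: "continuous_on {0..t} V"
    and diff: "\<And>a b. 0 \<le> a \<Longrightarrow> a \<le> b \<Longrightarrow> b \<le> t \<Longrightarrow>
      V b - V a \<ge> integral {a..b} (\<lambda>r. U r - \<mu> / (1 + r) powr \<beta> * V r)"
    and U0: "U 0 > 0" and V0: "V 0 \<ge> 0"
  shows "U t \<ge> exp (- (\<mu> / (\<beta> - 1))) / 2 * U 0 * exp t" and "V t \<ge> 0"
proof -
  let ?b = "\<lambda>r. \<mu> / (1 + r) powr \<beta>" and ?m = "damping_weight \<mu> \<beta>" and ?e = "exp (- (\<mu> / (\<beta> - 1)))"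
  note mb = damping_weight_bounds[OF \<beta> \<mu>]
  have Uc: "continuous_on {0..t} U" using UV by (intro DERIV_continuous_on)
  have sub: "continuous_on {0..x} g" if "continuous_on {0..t} g" "x \<le> t" for x and g :: "real \<Rightarrow> real"
    using that by (intro continuous_on_subset[OF that(1)]) auto
  have step: "V x \<ge> 0" if x: "0 \<le> x" "x \<le> t" and pos: "\<And>r. r \<in> {0..x} \<Longrightarrow> U r \<ge> 0" for x
  proof -
    have "V x \<ge> ?e * integral {0..x} U"
      using x pos diff by (intro damped_lower_bound[OF \<beta> \<mu> x(1) sub[OF V] sub[OF Uc]] V0) auto
    moreover have "integral {0..x} U \<ge> 0"
      using pos x by (intro integral_nonneg integrable_continuous_real sub[OF Uc]) auto
    ultimately show ?thesis by (meson exp_ge_zero mult_nonneg_nonneg order_trans)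
  qed
  have inc: "U 0 \<le> U x" if x: "0 \<le> x" "x \<le> t" and pos: "\<And>r. r \<in> {0..x} \<Longrightarrow> U r \<ge> 0" for x
    using x pos by (intro nonneg_deriv_le[of 0 x U V] has_field_derivative_subset[OF UV] step) auto
  have Upos: "U x \<ge> 0" if x: "x \<in> {0..t}" for x
  proof (rule ccontr)
    assume neg: "\<not> U x \<ge> 0"
    \<comment> \<open>Continuity argument at the first point y where U <= 0: before y the function
      stays at least \<open>U 0\<close> by \<open>inc\<close>, and continuity carries this to y,
      contradicting \<open>U 0 > 0\<close>.\<close>
    define Z where "Z = {r \<in> {0..t}. U r \<le> 0}"
    have "closed Z" unfolding Z_def
      using continuous_closed_preimage[OF Uc, of "{..0}"] by (simp add: vimage_def Int_def)
    moreover have "Z \<noteq> {}" "bdd_below Z" using x neg by (auto simp: Z_def intro!: bdd_belowI[of _ 0])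
    ultimately have iZ: "Inf Z \<in> Z" using closed_contains_Inf by blast
    have lt: "U r > 0" if "r \<in> {0..<Inf Z}" for r
    proof (rule ccontr)
      assume "\<not> 0 < U r"
      then have "r \<in> Z" using that iZ by (auto simp: Z_def)
      then have "Inf Z \<le> r" using \<open>bdd_below Z\<close> by (rule cInf_lower)
      then show False using that by simp
    qed
    define y where "y = Inf Z"
    have y: "0 \<le> y" "y \<le> t" "U y \<le> 0" using iZ by (auto simp: y_def Z_def)
    have "y \<noteq> 0" using y U0 by auto
    then have y0: "y > 0" using y by simp
    have ge: "U 0 \<le> U r" if "r \<in> {0..<y}" for r
      using that y lt by (intro inc) (auto simp: y_def less_imp_le)
    have "(U \<longlongrightarrow> U y) (at y within {0..<y})"
    proof (rule tendsto_within_subset)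
      show "(U \<longlongrightarrow> U y) (at y within {0..t})"
        using Uc y unfolding continuous_on_def by simp
    qed (use y in auto)
    moreover have "\<forall>\<^sub>F r in at y within {0..<y}. U 0 \<le> U r"
      using ge by (auto simp: eventually_at_filter)
    moreover have "at y within {0..<y} \<noteq> bot"
      using y0 by (simp add: trivial_limit_within islimpt_Ico)
    ultimately have "U 0 \<le> U y" by (intro tendsto_lowerbound[of U])
    then show False using y U0 by simp
  qed
  have Vpos: "V x \<ge> 0" if "x \<in> {0..t}" for x using that Upos by (intro step) auto
  then show "V t \<ge> 0" using t by simp
  define A where "A r = U r + V r" for r
  have A: "A x \<ge> ?e * U 0 * exp x" if x: "x \<in> {0..t}" for x
  proof -
    \<comment> \<open>This weight compensates both the growth rate 1 of A and the damping: with it,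
      the integrand of \<open>integrating_factor\<close> collapses to w b U, which is
      nonnegative.\<close>
    define w where "w r = exp (- r) * ?m r" for r
    define w' where "w' r = (?b r - 1) * w r" for r
    have d: "(w has_real_derivative w' r) (at r within {0..x})" if "r \<in> {0..x}" for r
    proof -
      have "(w has_real_derivative (- exp (- r)) * ?m r + (?b r * ?m r) * exp (- r)) (at r)"
        unfolding w_def
      proof (rule DERIV_mult)
        show "((\<lambda>r. exp (- r)) has_real_derivative - exp (- r)) (at r)" by (auto intro!: derivative_eq_intros)
        show "(?m has_real_derivative ?b r * ?m r) (at r)"
          by (rule damping_weight_deriv[OF \<beta>]) (use that in auto)
      qed
      also have "(- exp (- r)) * ?m r + (?b r * ?m r) * exp (- r) = w' r" by (simp add: w'_def w_def algebra_simps)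
      finally show ?thesis by (rule has_field_derivative_at_within)
    qed
    have wc: "continuous_on {0..x} w" using d by (intro DERIV_continuous_on)
    have Ac: "continuous_on {0..x} A" unfolding A_def using x by (intro continuous_on_add sub[OF Uc] sub[OF V]) auto
    have w'c: "continuous_on {0..x} w'" unfolding w'_def by (intro continuous_intros wc damping_continuous)
    define h where "h r = U r + V r - ?b r * V r" for r
    have hc: "continuous_on {0..x} h"
      unfolding h_def using x by (intro continuous_intros sub[OF Uc] sub[OF V] damping_continuous) auto
    have Ad: "A b - A a \<ge> integral {a..b} h" if ab: "0 \<le> a" "a \<le> b" "b \<le> x" for a b
    proof -
      have "(V has_integral U b - U a) {a..b}"
        by (rule fundamental_theorem_of_calculus[OF ab(2)], fold has_real_derivative_iff_has_vector_derivative)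
          (rule has_field_derivative_subset[OF UV]; use ab x in auto)
      moreover have "((\<lambda>r. U r - ?b r * V r) has_integral integral {a..b} (\<lambda>r. U r - ?b r * V r)) {a..b}"
        using ab x by (intro integrable_integral integrable_continuous_real continuous_intros
            continuous_on_subset[OF Uc] continuous_on_subset[OF V] continuous_on_subset[OF damping_continuous[of t]]) auto
      ultimately have "((\<lambda>r. V r + (U r - ?b r * V r)) has_integral U b - U a + integral {a..b} (\<lambda>r. U r - ?b r * V r)) {a..b}"
        by (rule has_integral_add)
      then have "integral {a..b} h = U b - U a + integral {a..b} (\<lambda>r. U r - ?b r * V r)"
        by (simp add: h_def[abs_def] integral_unique add_ac add_diff_eq)
      then show ?thesis using diff[of a b] ab x by (simp add: A_def)
    qed
    have "integral {0..x} (\<lambda>r. w' r * A r + w r * h r) \<le> w x * A x - w 0 * A 0"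
      using x by (intro integrating_factor[OF _ Ac hc Ad d w'c]) (auto simp: w_def damping_weight_def)
    moreover have "integral {0..x} (\<lambda>r. w' r * A r + w r * h r) \<ge> 0"
    proof (intro integral_nonneg integrable_continuous_real continuous_intros w'c wc Ac hc)
      fix r assume r: "r \<in> {0..x}"
      have "w' r * A r + w r * h r = w r * ?b r * U r"
        unfolding w'_def h_def A_def by (simp add: algebra_simps add_divide_distrib)
      also have "\<dots> \<ge> 0" using Upos[of r] r x \<mu> by (auto simp: w_def damping_weight_def intro!: mult_nonneg_nonneg)
      finally show "0 \<le> w' r * A r + w r * h r" .
    qed
    ultimately have "w x * A x \<ge> w 0 * A 0" by simp
    moreover have "w 0 * A 0 \<ge> ?e * U 0"
      using mb(1)[of 0] U0 V0 damping_weight_pos[of \<mu> \<beta> 0]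
      by (auto simp: w_def A_def intro!: mult_mono)
    moreover have "w x * A x \<le> exp (- x) * A x"
    proof (rule mult_right_mono)
      show "w x \<le> exp (- x)" using mult_left_mono[OF mb(2)[of x], of "exp (- x)"] x by (simp add: w_def)
      show "0 \<le> A x" using x Upos[of x] Vpos[of x] by (simp add: A_def)
    qed
    ultimately have "?e * U 0 \<le> exp (- x) * A x" by linarith
    then show ?thesis by (simp add: exp_minus field_simps)
  qed
  have e2: "exp (2 * r) = exp r * exp r" for r :: real by (simp flip: exp_add)
  \<comment> \<open>The derivative of e^r U is e^r A, at least a constant times e^(2r). Integrating
    e^(2r) produces the factor 1/2, and the initial value is absorbed because \<open>?e\<close> is
    at most 1.\<close>
  have "(\<lambda>r. exp r * U r - ?e / 2 * U 0 * exp (2 * r)) 0 \<le> (\<lambda>r. exp r * U r - ?e / 2 * U 0 * exp (2 * r)) t"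
  proof (rule nonneg_deriv_le[OF t])
    fix r assume r: "r \<in> {0..t}"
    show "((\<lambda>r. exp r * U r - ?e / 2 * U 0 * exp (2 * r)) has_real_derivative (exp r * A r - ?e * U 0 * exp (2 * r))) (at r within {0..t})"
      by (auto intro!: derivative_eq_intros UV r simp: A_def algebra_simps)
    have "exp r * (?e * U 0 * exp r) \<le> exp r * A r" using A[OF r] by (intro mult_left_mono) auto
    then show "0 \<le> exp r * A r - ?e * U 0 * exp (2 * r)" unfolding e2 by (simp add: mult_ac)
  qed
  then have "U 0 - ?e / 2 * U 0 \<le> exp t * U t - ?e / 2 * U 0 * exp (2 * t)" by simp
  moreover have "?e / 2 * U 0 \<le> 1 * U 0" using U0 \<beta> \<mu> by (intro mult_right_mono) (auto intro: order_trans[of _ 1])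
  ultimately have "?e / 2 * U 0 * exp (2 * t) \<le> exp t * U t" by linarith
  then have "exp t * (?e / 2 * U 0 * exp t) \<le> exp t * U t" unfolding e2 by (simp only: mult_ac)
  then show "U t \<ge> ?e / 2 * U 0 * exp t" by (simp only: mult_le_cancel_left_pos[OF exp_gt_zero])
qed

subsection \<open>The iteration argument\<close>

text \<open>On [0, r] only signs are used: \<open>h\<close> contributes nothing negative to
  \<open>V\<close>, and \<open>F\<close> does not fall below \<open>F 0\<close>. From r onwards the
  constant \<open>H\<close> is integrated twice.\<close>

lemma double_integral_lower:
  fixes F V h :: "real \<Rightarrow> real"
  assumes F: "\<And>r. r \<in> {0..X} \<Longrightarrow> (F has_real_derivative V r) (at r within {0..X})"
    and F0: "F 0 \<ge> 0"
    and V: "\<And>s. s \<in> {0..X} \<Longrightarrow> V s \<ge> \<kappa> * integral {0..s} h"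
    and h: "continuous_on {0..X} h" and h0: "\<And>s. s \<in> {0..X} \<Longrightarrow> h s \<ge> 0"
    and H: "\<And>s. s \<in> {r..X} \<Longrightarrow> h s \<ge> H" and pos: "\<kappa> \<ge> 0" "H \<ge> 0"
    and t: "0 \<le> r" "r \<le> t" "t \<le> X"
  shows "F t \<ge> \<kappa> * H * (t - r)\<^sup>2 / 2"
proof -
  have sub: "continuous_on {a..b} h" if "0 \<le> a" "b \<le> X" for a b
    using that by (intro continuous_on_subset[OF h]) auto
  have I0: "integral {0..s} h \<ge> 0" if "s \<in> {0..X}" for s
    using that h0 by (intro integral_nonneg integrable_continuous_real sub) auto
  have V0: "V s \<ge> 0" if "s \<in> {0..X}" for s
    using V[OF that] I0[OF that] pos mult_nonneg_nonneg[of \<kappa> "integral {0..s} h"] by linarith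
  have "F 0 \<le> F r"
    by (rule nonneg_deriv_le[OF t(1), of F V]) (rule has_field_derivative_subset[OF F] V0; use t in auto)+
  then have Fr: "F r \<ge> 0" using F0 by simp
  have Vl: "V s \<ge> \<kappa> * H * (s - r)" if s: "s \<in> {r..X}" for s
  proof -
    have "integral {0..s} h = integral {0..r} h + integral {r..s} h"
      using s t by (intro Henstock_Kurzweil_Integration.integral_combine[symmetric] integrable_continuous_real sub) auto
    moreover have "integral {0..r} h \<ge> 0" using t by (intro I0) auto
    moreover have "integral {r..s} h \<ge> integral {r..s} (\<lambda>_. H)"
      using s t H by (intro integral_le integrable_continuous_real sub) auto
    moreover have "integral {r..s} (\<lambda>_. H) = (s - r) * H" using s by simp
    ultimately have "integral {0..s} h \<ge> (s - r) * H" by linarith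
    then have "\<kappa> * integral {0..s} h \<ge> \<kappa> * ((s - r) * H)" using pos by (intro mult_left_mono) auto
    then show ?thesis using V[of s] s t by (simp add: mult_ac)
  qed
  have "(\<lambda>s. F s - \<kappa> * H * (s - r)\<^sup>2 / 2) r \<le> (\<lambda>s. F s - \<kappa> * H * (s - r)\<^sup>2 / 2) t"
  proof (rule nonneg_deriv_le[OF t(2)])
    fix s assume s: "s \<in> {r..t}"
    have "(F has_real_derivative V s) (at s within {r..t})"
      by (rule has_field_derivative_subset[OF F]) (use s t in auto)
    then show "((\<lambda>s. F s - \<kappa> * H * (s - r)\<^sup>2 / 2) has_real_derivative V s - \<kappa> * H * (s - r)) (at s within {r..t})"
      by (auto intro!: derivative_eq_intros)
    show "V s - \<kappa> * H * (s - r) \<ge> 0" using Vl[of s] s t by auto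
  qed
  then show ?thesis using Fr by simp
qed

text \<open>On \<open>[X/2, X]\<close> a lower bound \<open>G\<close> for \<open>F\<close> improves itself: passing from
  \<open>[(1 - 2^(-k-1)) X, X]\<close> to the next interval of this kind multiplies the bound by \<open>M > 1\<close> unless \<open>X\<close> is
  bounded by a negative power of \<open>\<epsilon>\<close>.\<close>

lemma lifespan_iteration:
  fixes p d \<kappa> c1 c2 e :: real
  assumes p: "p > 1" and d: "d \<ge> 0" and pos: "\<kappa> > 0" "c1 > 0" "c2 > 0"
  obtains C where "C > 0"
    "\<And>\<epsilon> X F V. \<epsilon> > 0 \<Longrightarrow> X \<ge> 1 \<Longrightarrow>
      (\<And>r. r \<in> {0..X} \<Longrightarrow> (F has_real_derivative V r) (at r within {0..X})) \<Longrightarrow> F 0 \<ge> 0 \<Longrightarrow>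
      (\<And>s. s \<in> {0..X} \<Longrightarrow> V s \<ge> \<kappa> * integral {0..s} (\<lambda>r. c1 * (1 + r) powr (- d * (p - 1)) * \<bar>F r\<bar> powr p)) \<Longrightarrow>
      (\<And>s. s \<in> {0..X} \<Longrightarrow> V s \<ge> \<kappa> * integral {0..s} (\<lambda>r. c2 * \<epsilon> powr p * (1 + r) powr e)) \<Longrightarrow>
      \<epsilon> powr (p * (p - 1)) * X powr (2 - d * (p - 1) + (2 + e) * (p - 1)) \<le> C"
proof -
  \<comment> \<open>The k-th step of the iteration works on an interval of length proportional to
    2^(-k), whose square costs a factor 4^(-k). With M^(p-1) = 4 one has (M^k)^p = 4^k M^k, which
    repays this loss and leaves M^k.\<close>
  define M where "M = 4 powr (1 / (p - 1))"
  have M1: "M > 1" using p by (auto simp: M_def intro!: gr_one_powr)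
  have Mp: "M powr (p - 1) = 4" using p by (simp add: M_def powr_powr)
  \<comment> \<open>For s in [X/4, X] the quotient (1+s)/X lies in [1/4, 2], as X >= 1; the minimum
    serves both signs of \<open>e\<close>.\<close>
  define ke where "ke = min ((1 / 4) powr e) (2 powr e)"
  have ke: "ke > 0" by (simp add: ke_def)
  \<comment> \<open>The double integration over a stretch of length X/4 contributes (X/4)^2 / 2,
    hence the 32, here and in \<open>l\<close>.\<close>
  define g where "g = \<kappa> * c2 * ke / 32"
  have g: "g > 0" using pos ke by (simp add: g_def)
  define l where "l = \<kappa> * c1 * 2 powr (- d * (p - 1)) / 32 * g powr (p - 1)"
  have l: "l > 0" using pos g by (simp add: l_def)
  show ?thesis
  proof (rule that[of "M / l"])
    show "M / l > 0" using M1 l by simp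
    fix \<epsilon> X :: real and F V :: "real \<Rightarrow> real"
    assume \<epsilon>: "\<epsilon> > 0" and X: "X \<ge> 1"
      and F: "\<And>r. r \<in> {0..X} \<Longrightarrow> (F has_real_derivative V r) (at r within {0..X})" and F0: "F 0 \<ge> 0"
      and V1: "\<And>s. s \<in> {0..X} \<Longrightarrow> V s \<ge> \<kappa> * integral {0..s} (\<lambda>r. c1 * (1 + r) powr (- d * (p - 1)) * \<bar>F r\<bar> powr p)"
      and V2: "\<And>s. s \<in> {0..X} \<Longrightarrow> V s \<ge> \<kappa> * integral {0..s} (\<lambda>r. c2 * \<epsilon> powr p * (1 + r) powr e)"
    have Fc: "continuous_on {0..X} F" using F by (intro DERIV_continuous_on)
    define G where "G = g * \<epsilon> powr p * X powr (2 + e)"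
    have G: "G > 0" using g \<epsilon> X by (simp add: G_def)
    \<comment> \<open>The factor gained by one step: the bound G M^k on one interval becomes L G M^k
      on the next, with the same L for every k.\<close>
    define L where "L = \<kappa> * c1 * 2 powr (- d * (p - 1)) / 32 * X powr (2 - d * (p - 1)) * G powr (p - 1)"
    have L: "L = l * (\<epsilon> powr (p * (p - 1)) * X powr (2 - d * (p - 1) + (2 + e) * (p - 1)))"
    proof -
      have "G powr (p - 1) = g powr (p - 1) * \<epsilon> powr (p * (p - 1)) * X powr ((2 + e) * (p - 1))"
        using g \<epsilon> X by (simp only: G_def powr_mult powr_powr)
      moreover have "X powr (2 - d * (p - 1) + (2 + e) * (p - 1))
          = X powr (2 - d * (p - 1)) * X powr ((2 + e) * (p - 1))" by (rule powr_add)
      ultimately show ?thesis by (simp add: L_def l_def)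
    qed
    have base: "F t \<ge> G" if t: "t \<in> {X / 2..X}" for t
    proof -
      have "F t \<ge> \<kappa> * (c2 * \<epsilon> powr p * (ke * X powr e)) * (t - X / 4)\<^sup>2 / 2"
      proof (rule double_integral_lower[OF F F0 V2])
        show "continuous_on {0..X} (\<lambda>r. c2 * \<epsilon> powr p * (1 + r) powr e)" by (intro continuous_intros) auto
        fix s assume s: "s \<in> {X / 4..X}"
        define z where "z = (1 + s) / X"
        have z: "1 / 4 \<le> z" "z \<le> 2" using s X by (auto simp: z_def field_simps)
        have "ke \<le> z powr e"
        proof (cases "e \<ge> 0")
          case True
          then have "(1 / 4) powr e \<le> z powr e" using z by (intro powr_mono2) auto
          then show ?thesis by (simp add: ke_def)
        next
          case False
          then have "2 powr e \<le> z powr e" using z by (intro powr_mono2') auto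
          then show ?thesis by (simp add: ke_def)
        qed
        then have "ke * X powr e \<le> z powr e * X powr e" by (intro mult_right_mono) auto
        also have "\<dots> = (1 + s) powr e" using s X by (simp add: z_def flip: powr_mult)
        finally show "c2 * \<epsilon> powr p * (ke * X powr e) \<le> c2 * \<epsilon> powr p * (1 + s) powr e"
          using pos by (intro mult_left_mono) auto
      qed (use pos ke t X in auto)
      moreover have "(t - X / 4)\<^sup>2 \<ge> (X / 4)\<^sup>2" using t X by (intro power_mono) auto
      then have "\<kappa> * (c2 * \<epsilon> powr p * (ke * X powr e)) * (t - X / 4)\<^sup>2 / 2
          \<ge> \<kappa> * (c2 * \<epsilon> powr p * (ke * X powr e)) * (X / 4)\<^sup>2 / 2"
        using pos ke by (intro divide_right_mono mult_left_mono) auto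
      moreover have "\<kappa> * (c2 * \<epsilon> powr p * (ke * X powr e)) * (X / 4)\<^sup>2 / 2 = G"
        using X by (simp add: G_def g_def powr_add power2_eq_square)
      ultimately show ?thesis by linarith
    qed
    show "\<epsilon> powr (p * (p - 1)) * X powr (2 - d * (p - 1) + (2 + e) * (p - 1)) \<le> M / l"
    proof (rule ccontr)
      assume "\<not> ?thesis"
      then have LM: "L \<ge> M" using l by (simp add: L not_le divide_less_eq mult_ac less_imp_le)
      have it: "\<forall>t\<in>{X * (1 - (1 / 2) ^ Suc k)..X}. F t \<ge> G * M ^ k" for k
      proof (induction k)
        case 0
        then show ?case using base by simp
      next
        case (Suc k)
        define r where "r = X * (1 - (1 / 2) ^ Suc k)"
        have "(1 / 2 :: real) ^ Suc k \<le> 1" by (intro power_le_one) auto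
        then have r: "0 \<le> r" "r \<le> X"
          using X by (auto simp: r_def simp del: power_Suc intro!: mult_left_le mult_nonneg_nonneg)
        define H where "H = c1 * (2 * X) powr (- d * (p - 1)) * (G * M ^ k) powr p"
        show ?case
        proof
          fix t assume t: "t \<in> {X * (1 - (1 / 2) ^ Suc (Suc k))..X}"
          \<comment> \<open>Consecutive left end points differ by X (1/2)^(k+2).\<close>
          have tr: "t - r \<ge> X / 4 * (1 / 2) ^ k" using t by (auto simp: r_def algebra_simps)
          then have tr': "r \<le> t" using X by (smt (verit) divide_nonneg_nonneg mult_nonneg_nonneg zero_le_power)
          have "F t \<ge> \<kappa> * H * (t - r)\<^sup>2 / 2"
          proof (rule double_integral_lower[OF F F0 V1])
            show "continuous_on {0..X} (\<lambda>r. c1 * (1 + r) powr (- d * (p - 1)) * \<bar>F r\<bar> powr p)"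
              using p by (intro continuous_on_mult continuous_on_const continuous_on_powr' continuous_on_rabs
                  Fc continuous_intros) auto
            fix s assume s: "s \<in> {r..X}"
            have "(2 * X) powr (- d * (p - 1)) \<le> (1 + s) powr (- d * (p - 1))"
              using s r X d p by (intro powr_mono2') (auto simp: mult_nonneg_nonneg)
            moreover have "G * M ^ k \<le> F s" using Suc.IH s by (simp add: r_def)
            then have "(G * M ^ k) powr p \<le> \<bar>F s\<bar> powr p"
              using p G M1 by (intro powr_mono2) auto
            ultimately show "H \<le> c1 * (1 + s) powr (- d * (p - 1)) * \<bar>F s\<bar> powr p"
              unfolding H_def using pos by (intro mult_mono mult_left_mono) auto
          qed (use pos r tr' t in \<open>auto simp: H_def\<close>)
          moreover have "(t - r)\<^sup>2 \<ge> (X / 4 * (1 / 2) ^ k)\<^sup>2" using tr X by (intro power_mono) auto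
          then have "\<kappa> * H * (t - r)\<^sup>2 / 2 \<ge> \<kappa> * H * (X / 4 * (1 / 2) ^ k)\<^sup>2 / 2"
            using pos by (intro divide_right_mono mult_left_mono) (auto simp: H_def)
          moreover have "\<kappa> * H * (X / 4 * (1 / 2) ^ k)\<^sup>2 / 2 = L * (G * M ^ k)"
          proof -
            have a: "(X / 4 * (1 / 2) ^ k)\<^sup>2 = X powr 2 / 16 / 4 ^ k"
            proof -
              have "(2 ^ k)\<^sup>2 = (4::real) ^ k" by (simp add: power2_eq_square flip: power_mult_distrib)
              then show ?thesis using X by (simp add: power_mult_distrib power_divide)
            qed
            have b: "(M ^ k) powr p = 4 ^ k * M ^ k"
            proof -
              have "M powr p = 4 * M" using Mp M1 by (simp add: powr_diff field_simps)
              moreover have "(M ^ k) powr p = (M powr p) ^ k"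
                using M1 by (simp add: powr_powr mult.commute flip: powr_realpow)
              ultimately show ?thesis by (simp add: power_mult_distrib)
            qed
            have c: "G powr p = G powr (p - 1) * G" using G by (simp add: powr_diff)
            have "X powr (2 - d * (p - 1)) = X powr 2 * X powr (- d * (p - 1))" by (simp flip: powr_add)
            then show ?thesis using G M1 X unfolding a H_def L_def
              by (simp add: powr_mult b c)
          qed
          moreover have "L * (G * M ^ k) \<ge> M * (G * M ^ k)"
            using LM G M1 by (intro mult_right_mono) auto
          ultimately show "F t \<ge> G * M ^ Suc k" by (simp add: mult_ac)
        qed
      qed
      obtain k where "F X / G < M ^ k" using real_arch_pow[OF M1] by blast
      moreover have "G * M ^ k \<le> F X" using it[of k] X by (auto intro!: mult_left_le)
      ultimately show False using G by (simp add: field_simps)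
    qed
  qed
qed

subsection \<open>Measure-theoretic preliminaries\<close>

text \<open>\<open>lebesgue\<close> is the completion of the product measure, not a product itself.
  The exceptional set is therefore enclosed in a Borel null set, to which Fubini's theorem
  applies.\<close>

lemma AE_lebesgue_sections:
  fixes P :: "'a::euclidean_space \<times> 'b::euclidean_space \<Rightarrow> bool"
  assumes "AE z in lebesgue. P z"
  shows "AE s in lebesgue. AE x in lebesgue. P (x, s)"
proof -
  have e: "(lborel :: ('a \<times> 'b) measure) = lborel \<Otimes>\<^sub>M lborel" by (rule lborel_prod[symmetric])
  have "AE z in lborel. P z" using assms by (simp add: AE_completion_iff)
  then have "AE z in lborel \<Otimes>\<^sub>M lborel. P z" unfolding e .
  then obtain N where N: "N \<in> null_sets (lborel \<Otimes>\<^sub>M lborel)" "{z. \<not> P z} \<subseteq> N"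
    by (auto simp: eventually_ae_filter space_pair_measure)
  have Ns: "N \<in> sets (lborel \<Otimes>\<^sub>M lborel)" using N by auto
  have "AE z in lborel \<Otimes>\<^sub>M lborel. z \<notin> N" using N(1) by (rule AE_not_in)
  then have "AE x in lborel. AE s in lborel. (x, s) \<notin> N" by (rule lborel_pair.AE_pair)
  moreover have "{z \<in> space (lborel \<Otimes>\<^sub>M lborel). (fst z, snd z) \<notin> N} \<in> sets (lborel \<Otimes>\<^sub>M lborel)"
  proof -
    have "{z \<in> space (lborel \<Otimes>\<^sub>M lborel). (fst z, snd z) \<notin> N} = space (lborel \<Otimes>\<^sub>M lborel) - N" by auto
    also have "\<dots> \<in> sets (lborel \<Otimes>\<^sub>M lborel)" by (rule sets.compl_sets[OF Ns])
    finally show ?thesis .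
  qed
  ultimately have "AE s in lborel. AE x in lborel. (x, s) \<notin> N"
    using lborel_pair.AE_commute[of "\<lambda>x s. (x, s) \<notin> N"] by simp
  then have "AE s in lborel. AE x in lborel. P (x, s)"
  proof eventually_elim
    case (elim s)
    then show ?case by eventually_elim (use N(2) in auto)
  qed
  then show ?thesis by (simp add: AE_completion_iff)
qed

text \<open>Fubini's theorem for the completed measure: \<open>f\<close> is replaced by a Borel
  function \<open>g\<close> equal to it almost everywhere, and \<open>AE_lebesgue_sections\<close>
  transports the equality to almost every section.\<close>

lemma lebesgue_integrable_sections:
  fixes f :: "'a::euclidean_space \<times> 'b::euclidean_space \<Rightarrow> real"
  assumes f: "integrable lebesgue f"
  shows "AE s in lebesgue. integrable lebesgue (\<lambda>x. f (x, s))"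
    and "integrable lebesgue (\<lambda>s. LINT x|lebesgue. f (x, s))"
proof -
  have fm: "f \<in> borel_measurable lebesgue" using f by auto
  obtain g where gm: "g \<in> borel_measurable lborel" and fg: "AE z in lborel. f z = g z"
    using completion_ex_borel_measurable_real[OF fm] by blast
  have "integrable lebesgue g"
    using f by (rule integrable_cong_AE_imp) (use gm fg in \<open>auto simp: AE_completion_iff measurable_completion elim: AE_mp\<close>)
  then have g: "integrable lborel g" using gm by (simp add: integrable_completion)
  then have g': "integrable (lborel \<Otimes>\<^sub>M lborel) (case_prod (\<lambda>x s. g (x, s)))" by (simp add: lborel_prod)
  have eq: "AE s in lebesgue. AE x in lebesgue. f (x, s) = g (x, s)"
    using AE_lebesgue_sections[of "\<lambda>z. f z = g z"] fg by (simp add: AE_completion_iff)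
  have gs: "(\<lambda>x. g (x, s)) \<in> borel_measurable lborel" for s
    using gm by measurable
  have gi: "AE s in lebesgue. integrable lebesgue (\<lambda>x. g (x, s))"
    using lborel_pair.AE_integrable_snd[OF g'] gs by (simp add: AE_completion_iff integrable_completion)
  show 1: "AE s in lebesgue. integrable lebesgue (\<lambda>x. f (x, s))"
    using eq gi
  proof eventually_elim
    case (elim s)
    have "AE x in lebesgue. g (x, s) = f (x, s)" using elim(1) by (auto elim: AE_mp)
    with elim(2) show ?case
      using borel_measurable_AE[of "\<lambda>x. g (x, s)"] by (intro integrable_cong_AE_imp[OF elim(2)]) auto
  qed
  have "(\<lambda>s. LINT x|lborel. g (x, s)) \<in> borel_measurable lborel"
    using lborel_pair.integrable_snd[OF g'] by (simp add: integrable_iff_bounded)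
  then have "integrable lebesgue (\<lambda>s. LINT x|lborel. g (x, s))"
    using lborel_pair.integrable_snd[OF g'] by (simp add: integrable_completion)
  then have gI: "integrable lebesgue (\<lambda>s. LINT x|lebesgue. g (x, s))"
    using gs by (simp add: integral_completion)
  have eqI: "AE s in lebesgue. (LINT x|lebesgue. g (x, s)) = (LINT x|lebesgue. f (x, s))"
    using eq 1 gi
  proof eventually_elim
    case (elim s)
    then show ?case by (intro integral_cong_AE) (auto elim: AE_mp)
  qed
  show "integrable lebesgue (\<lambda>s. LINT x|lebesgue. f (x, s))"
    using gI borel_measurable_AE[OF _ eqI] eqI by (intro integrable_cong_AE_imp[OF gI]) auto
qed

lemma AE_lebesgue_interval_ex:
  fixes a b :: real
  assumes "AE s in lebesgue. Q s" "a < b"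
  shows "\<exists>s. a < s \<and> s < b \<and> Q s"
proof (rule ccontr)
  assume c: "\<not> ?thesis"
  obtain N where N: "N \<in> null_sets lebesgue" "{s. \<not> Q s} \<subseteq> N"
    using assms(1) by (auto simp: eventually_ae_filter)
  have "{a<..<b} \<subseteq> N" using c N(2) by auto
  then have "negligible {a<..<b}" using N(1) negligible_subset negligible_iff_null_sets by blast
  then show False using assms(2) negligible_interval(2)[of a b] by (auto simp: box_real)
qed

section \<open>Hoelder's inequality and square-integrable functions\<close>

lemma Hoelder_inequality:
  fixes f g :: "'a \<Rightarrow> real"
  assumes pq: "p > 1" "q > 1" "1 / p + 1 / q = 1"
    and f[measurable]: "f \<in> borel_measurable M" and g[measurable]: "g \<in> borel_measurable M"
    and fp: "integrable M (\<lambda>x. \<bar>f x\<bar> powr p)" and gq: "integrable M (\<lambda>x. \<bar>g x\<bar> powr q)"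
  shows "integrable M (\<lambda>x. f x * g x)"
    and "\<bar>LINT x|M. f x * g x\<bar> \<le> (LINT x|M. \<bar>f x\<bar> powr p) powr (1 / p) * (LINT x|M. \<bar>g x\<bar> powr q) powr (1 / q)"
proof -
  have Y: "\<bar>f x * g x\<bar> \<le> \<bar>f x\<bar> powr p / p + \<bar>g x\<bar> powr q / q" for x
    using Youngs_inequality[OF pq, of "\<bar>f x\<bar>" "\<bar>g x\<bar>"] by (simp add: abs_mult)
  show int: "integrable M (\<lambda>x. f x * g x)"
  proof (rule Bochner_Integration.integrable_bound)
    show "integrable M (\<lambda>x. \<bar>f x\<bar> powr p / p + \<bar>g x\<bar> powr q / q)"
      using fp gq by (intro Bochner_Integration.integrable_add integrable_divide_zero)
    show "AE x in M. norm (f x * g x) \<le> norm (\<bar>f x\<bar> powr p / p + \<bar>g x\<bar> powr q / q)"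
      using Y pq by (auto intro!: AE_I2 order_trans[OF Y])
  qed simp
  define A where "A = (LINT x|M. \<bar>f x\<bar> powr p)"
  define B where "B = (LINT x|M. \<bar>g x\<bar> powr q)"
  have AB: "A \<ge> 0" "B \<ge> 0" by (auto simp: A_def B_def)
  show "\<bar>LINT x|M. f x * g x\<bar> \<le> A powr (1 / p) * B powr (1 / q)"
  proof (cases "A = 0 \<or> B = 0")
    case True
    have "AE x in M. f x * g x = 0"
    proof (cases "A = 0")
      case True
      then have "AE x in M. \<bar>f x\<bar> powr p = 0"
        using integral_nonneg_eq_0_iff_AE[OF fp] by (simp add: A_def)
      then show ?thesis by (auto elim: AE_mp)
    next
      case False
      then have "AE x in M. \<bar>g x\<bar> powr q = 0"
        using True integral_nonneg_eq_0_iff_AE[OF gq] by (simp add: B_def)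
      then show ?thesis by (auto elim: AE_mp)
    qed
    then have "(LINT x|M. f x * g x) = 0" by (simp add: integral_eq_zero_AE)
    then show ?thesis by simp
  next
    case False
    then have pos: "A > 0" "B > 0" using AB by auto
    define a b where "a = A powr (1 / p)" and "b = B powr (1 / q)"
    have ab: "a > 0" "b > 0" "a powr p = A" "b powr q = B"
      using pos pq by (auto simp: a_def b_def powr_powr)
    have "\<bar>LINT x|M. f x * g x\<bar> \<le> (LINT x|M. \<bar>f x * g x\<bar>)" by (rule integral_abs_bound)
    also have "\<dots> \<le> (LINT x|M. a * b * (\<bar>f x\<bar> powr p / (p * A) + \<bar>g x\<bar> powr q / (q * B)))"
    proof (rule integral_mono)
      show "integrable M (\<lambda>x. \<bar>f x * g x\<bar>)" using int by (rule integrable_abs)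
      show "integrable M (\<lambda>x. a * b * (\<bar>f x\<bar> powr p / (p * A) + \<bar>g x\<bar> powr q / (q * B)))"
        using fp gq by (intro integrable_mult_right Bochner_Integration.integrable_add integrable_divide_zero)
      fix x
      have "(\<bar>f x\<bar> / a) * (\<bar>g x\<bar> / b) \<le> (\<bar>f x\<bar> / a) powr p / p + (\<bar>g x\<bar> / b) powr q / q"
        using ab by (intro Youngs_inequality pq) auto
      also have "\<dots> = \<bar>f x\<bar> powr p / (p * A) + \<bar>g x\<bar> powr q / (q * B)"
        using ab by (simp add: powr_divide mult.commute)
      finally show "\<bar>f x * g x\<bar> \<le> a * b * (\<bar>f x\<bar> powr p / (p * A) + \<bar>g x\<bar> powr q / (q * B))"
        using ab by (simp add: abs_mult field_simps)
    qed
    also have "\<dots> = a * b * (A / (p * A) + B / (q * B))"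
      using fp gq by (simp add: A_def B_def)
    also have "\<dots> = a * b" using pos pq by simp
    finally show ?thesis by (simp add: a_def b_def)
  qed
qed

lemma L2_mult:
  fixes f g :: "'a::euclidean_space \<Rightarrow> real"
  assumes "L2 f" "L2 g"
  shows "integrable lebesgue (\<lambda>x. f x * g x)" "\<bar>LINT x|lebesgue. f x * g x\<bar> \<le> L2_norm f * L2_norm g"
proof -
  have sq: "\<bar>y\<bar> powr 2 = y\<^sup>2" for y :: real by (cases "y = 0") auto
  have m: "f \<in> borel_measurable lebesgue" "g \<in> borel_measurable lebesgue"
    "integrable lebesgue (\<lambda>x. \<bar>f x\<bar> powr 2)" "integrable lebesgue (\<lambda>x. \<bar>g x\<bar> powr 2)"
    using assms unfolding sq by (auto simp: L2_def)
  from Hoelder_inequality(1)[OF _ _ _ m] show "integrable lebesgue (\<lambda>x. f x * g x)" by simp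
  from Hoelder_inequality(2)[OF _ _ _ m]
  show "\<bar>LINT x|lebesgue. f x * g x\<bar> \<le> L2_norm f * L2_norm g"
    unfolding sq by (simp add: L2_norm_def powr_half_sqrt)
qed

lemma L2_cmult: "L2 (f :: _ \<Rightarrow> real) \<Longrightarrow> L2 (\<lambda>x. c * f x)"
  by (auto simp: L2_def power_mult_distrib)

lemma L2_add:
  fixes f g :: "'a::euclidean_space \<Rightarrow> real"
  assumes "L2 f" "L2 g"
  shows "L2 (\<lambda>x. f x + g x)"
proof -
  have "integrable lebesgue (\<lambda>x. (f x)\<^sup>2 + (g x)\<^sup>2 + 2 * (f x * g x))"
    using assms L2_mult(1)[OF assms] by (auto simp: L2_def)
  then show ?thesis using assms by (auto simp: L2_def power2_sum mult.assoc)
qed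

lemma L2_diff:
  fixes f g :: "'a::euclidean_space \<Rightarrow> real"
  assumes "L2 f" "L2 g"
  shows "L2 (\<lambda>x. f x - g x)"
  using L2_add[OF assms(1) L2_cmult[OF assms(2), of "-1"]] by simp

lemma L2_norm: "L2 f \<Longrightarrow> L2 (\<lambda>x. norm (f x))"
  by (auto simp: L2_def)

lemma L2_compact_support:
  fixes a :: "'a::euclidean_space \<Rightarrow> 'b::euclidean_space"
  assumes c: "continuous_on UNIV a" and z: "\<And>x. norm x \<ge> \<rho> \<Longrightarrow> a x = 0"
  shows "L2 a"
proof -
  have "integrable lebesgue (\<lambda>x. indicator (cball 0 \<rho>) x *\<^sub>R (norm (a x))\<^sup>2)"
    unfolding set_integrable_def[symmetric] by (intro set_integrable_cball continuous_intros c)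
  also have "(\<lambda>x. indicator (cball 0 \<rho>) x *\<^sub>R (norm (a x))\<^sup>2) = (\<lambda>x. (norm (a x))\<^sup>2)"
    using z by (intro ext) (auto simp: indicator_def)
  finally show ?thesis
    using borel_measurable_continuous_onI[OF c] by (auto simp: L2_def measurable_completion)
qed

lemma L2_indicator_cball: "L2 (indicator (cball 0 r) :: 'a::euclidean_space \<Rightarrow> real)"
proof -
  have "(norm (indicator (cball 0 r) x :: real))\<^sup>2 = indicator (cball 0 r) x *\<^sub>R 1" for x :: 'a
    by (simp add: indicator_def)
  moreover have "integrable lebesgue (\<lambda>x::'a. indicator (cball 0 r) x *\<^sub>R (1::real))"
    unfolding set_integrable_def[symmetric] by (rule set_integrable_cball) simp
  moreover have "(indicator (cball 0 r) :: 'a \<Rightarrow> real) \<in> borel_measurable lebesgue"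
    by (rule borel_measurable_indicator) simp
  ultimately show ?thesis unfolding L2_def by (simp only:)
qed

lemma integrable_L2_scaleR:
  fixes a :: "'a::euclidean_space \<Rightarrow> 'b::euclidean_space"
  assumes v: "L2 v" and a: "L2 a"
  shows "integrable lebesgue (\<lambda>x. v x *\<^sub>R a x)"
proof (rule Bochner_Integration.integrable_bound)
  show "integrable lebesgue (\<lambda>x. norm (v x) * norm (a x))"
    by (intro L2_mult L2_norm v a)
  have [measurable]: "v \<in> borel_measurable lebesgue" "a \<in> borel_measurable lebesgue"
    using v a by (auto simp: L2_def)
  show "(\<lambda>x. v x *\<^sub>R a x) \<in> borel_measurable lebesgue" by measurable
qed auto

text \<open>Each point of \<open>S\<close> outside the essential support has an open neighbourhood
  in which \<open>f\<close> vanishes almost everywhere. Lindelof's theorem thins this family to a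
  countable one, so that the exceptional sets still form a null set.\<close>

lemma AE_zero_outside_ess_support:
  fixes f :: "'a::euclidean_space \<Rightarrow> real"
  assumes "ess_support S f \<subseteq> A"
  shows "AE w in lebesgue. w \<in> S \<and> w \<notin> A \<longrightarrow> f w = 0"
proof -
  define \<F> where "\<F> = {U. open U \<and> (AE w in lebesgue. w \<in> U \<inter> S \<longrightarrow> f w = 0)}"
  obtain \<F>' where F': "\<F>' \<subseteq> \<F>" "countable \<F>'" "\<Union>\<F>' = \<Union>\<F>"
    using Lindelof[of \<F>] by (auto simp: \<F>_def)
  have "AE w in lebesgue. \<forall>U\<in>\<F>'. w \<in> U \<inter> S \<longrightarrow> f w = 0"
    using F' by (subst AE_ball_countable) (auto simp: \<F>_def)
  then show ?thesis
  proof (rule AE_mp, intro AE_I2 impI)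
    fix w assume w: "\<forall>U\<in>\<F>'. w \<in> U \<inter> S \<longrightarrow> f w = 0" "w \<in> S \<and> w \<notin> A"
    then have "w \<notin> ess_support S f" using assms by auto
    then have "w \<in> \<Union>\<F>" using w(2) by (auto simp: ess_support_def \<F>_def)
    then show "f w = 0" using w F'(3) by (metis IntI UnionE)
  qed
qed

text \<open>The support condition yields the vanishing outside radius s + R only for almost every
  time s. For an arbitrary t, the part of u(., t) beyond radius t + R + 1 is compared with good
  times s tending to t: there u(., s) is zero, so its L2 norm is at most that of u(., s) - u(.,
  t).\<close>

lemma finite_propagation_slices:
  fixes u :: "real^'n \<Rightarrow> real \<Rightarrow> real"
  assumes supp: "ess_support (UNIV \<times> {0..<T}) (\<lambda>(x, t). u x t)
      \<subseteq> {(x, t). 0 \<le> t \<and> t < T \<and> norm x \<le> t + R}"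
    and C: "C_L2 T u" and t: "t \<in> {0..<T}"
  shows "AE x in lebesgue. norm x > t + R + 1 \<longrightarrow> u x t = 0"
proof -
  have good: "AE s in lebesgue. AE x in lebesgue. s \<in> {0..<T} \<and> norm x > s + R \<longrightarrow> u x s = 0"
    using AE_lebesgue_sections[OF AE_zero_outside_ess_support[OF supp]] by (auto elim!: AE_mp)
  have L2: "L2 (\<lambda>x. u x s)" if "s \<in> {0..<T}" for s using C that by (auto simp: C_L2_def)
  define D where "D = {x::real^'n. norm x > t + R + 1}"
  have Dm: "D \<in> sets lebesgue"
  proof -
    have "open D" unfolding D_def by (intro open_Collect_less continuous_intros)
    then show ?thesis by simp
  qed
  define v where "v x = indicator D x * (u x t)\<^sup>2" for x
  have v_int: "integrable lebesgue v"
    using L2[OF t] integrable_mult_indicator[OF Dm, of "\<lambda>x. (u x t)\<^sup>2"] by (simp add: v_def[abs_def] L2_def)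
  have bound: "(LINT x|lebesgue. v x) \<le> e" if e: "e > 0" for e
  proof -
    have "((\<lambda>s. L2_norm (\<lambda>x. u x s - u x t)) \<longlongrightarrow> 0) (at t within {0..<T})"
      using C t by (auto simp: C_L2_def)
    then have "\<forall>\<^sub>F s in at t within {0..<T}. L2_norm (\<lambda>x. u x s - u x t) < sqrt e"
      using e by (intro order_tendstoD) auto
    then obtain d where d: "d > 0" "\<And>s. s \<in> {0..<T} \<Longrightarrow> s \<noteq> t \<Longrightarrow> dist s t < d \<Longrightarrow> L2_norm (\<lambda>x. u x s - u x t) < sqrt e"
      by (auto simp: eventually_at)
    \<comment> \<open>Good times occur in every interval to the right of \<open>t\<close>, also for
      t = 0; s < t + 1 puts the ball of radius s + R inside that of radius t + R + 1.\<close>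
    obtain s where s: "t < s" "s < min (t + d) (min T (t + 1))"
      "AE x in lebesgue. s \<in> {0..<T} \<and> norm x > s + R \<longrightarrow> u x s = 0"
      using AE_lebesgue_interval_ex[OF good, of t "min (t + d) (min T (t + 1))"] d t by auto
    have sT: "s \<in> {0..<T}" using s t by auto
    have "L2_norm (\<lambda>x. u x s - u x t) < sqrt e" using s sT by (intro d(2)) (auto simp: dist_real_def)
    then have "sqrt (LINT x|lebesgue. (u x s - u x t)\<^sup>2) < sqrt e" by (simp add: L2_norm_def)
    then have le: "(LINT x|lebesgue. (u x s - u x t)\<^sup>2) < e" by simp
    have "(LINT x|lebesgue. v x) \<le> (LINT x|lebesgue. (u x s - u x t)\<^sup>2)"
    proof (rule integral_mono_AE[OF v_int])
      show "integrable lebesgue (\<lambda>x. (u x s - u x t)\<^sup>2)"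
        using L2_diff[OF L2[OF sT] L2[OF t]] by (simp add: L2_def)
      show "AE x in lebesgue. v x \<le> (u x s - u x t)\<^sup>2"
        using s(3)
      proof (rule AE_mp, intro AE_I2 impI)
        fix x assume "s \<in> {0..<T} \<and> norm x > s + R \<longrightarrow> u x s = 0"
        then show "v x \<le> (u x s - u x t)\<^sup>2" using sT s(2) by (auto simp: v_def D_def indicator_def)
      qed
    qed
    then show ?thesis using le by simp
  qed
  have nn: "AE x in lebesgue. 0 \<le> v x" by (auto simp: v_def)
  have "(LINT x|lebesgue. v x) \<le> 0" using bound by (rule field_le_epsilon) (use bound in simp)
  then have "(LINT x|lebesgue. v x) = 0" using integral_nonneg_AE[OF nn] by simp
  then have "AE x in lebesgue. v x = 0" using integral_nonneg_eq_0_iff_AE[OF v_int nn] by simp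
  then show ?thesis by (rule AE_mp) (auto simp: v_def D_def)
qed

lemma Hoelder_ball:
  fixes v w :: "'a::euclidean_space \<Rightarrow> real"
  assumes pq: "p > 1" "q > 1" "1 / p + 1 / q = 1"
    and v: "v \<in> borel_measurable lebesgue" "integrable lebesgue (\<lambda>x. \<bar>v x\<bar> powr p)"
    and supp: "AE x in lebesgue. norm x > r \<longrightarrow> v x = 0"
    and w: "continuous_on UNIV w"
  shows "\<bar>LINT x|lebesgue. v x * w x\<bar> \<le>
    (LINT x|lebesgue. \<bar>v x\<bar> powr p) powr (1 / p) * (LINT x:cball 0 r|lebesgue. \<bar>w x\<bar> powr q) powr (1 / q)"
proof -
  define g where "g x = indicator (cball 0 r) x * w x" for x
  have wm: "w \<in> borel_measurable lebesgue"
    using borel_measurable_continuous_onI[OF w] by (auto simp: measurable_completion)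
  have gm: "g \<in> borel_measurable lebesgue"
    unfolding g_def using wm by (intro borel_measurable_times borel_measurable_indicator) auto
  have gq: "(\<lambda>x. \<bar>g x\<bar> powr q) = (\<lambda>x. indicator (cball 0 r) x *\<^sub>R (\<bar>w x\<bar> powr q))"
    by (auto simp: g_def indicator_def)
  have "integrable lebesgue (\<lambda>x. \<bar>g x\<bar> powr q)"
    unfolding gq set_integrable_def[symmetric]
    using pq by (intro set_integrable_cball continuous_on_powr' continuous_on_rabs w continuous_on_const) auto
  note H = Hoelder_inequality(2)[OF pq v(1) gm v(2) this]
  have "(LINT x|lebesgue. v x * w x) = (LINT x|lebesgue. v x * g x)"
    using supp by (intro integral_cong_AE borel_measurable_times v wm gm) (auto simp: g_def indicator_def elim: AE_mp)
  then show ?thesis using H by (simp add: gq set_lebesgue_integral_def)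
qed

subsection \<open>Radial test functions\<close>

text \<open>The profile is a function of the squared norm because that is smooth at the origin, so a
  smooth \<open>h\<close> always gives a smooth function on space.\<close>

definition radial :: "(real \<Rightarrow> real) \<Rightarrow> real^'n \<Rightarrow> real" where
  "radial h x = h ((norm x)\<^sup>2)"

text \<open>The Laplacian of \<open>radial h\<close> by the chain rule;
  \<open>weak_grad_radial\<close> is what justifies the name.\<close>

definition radial_laplacian :: "(real \<Rightarrow> real) \<Rightarrow> real^'n \<Rightarrow> real" where
  "radial_laplacian h x =
     4 * (norm x)\<^sup>2 * deriv (deriv h) ((norm x)\<^sup>2) + 2 * real CARD('n) * deriv h ((norm x)\<^sup>2)"

lemma grad_eqI:
  assumes "(\<phi> has_derivative (\<lambda>v. G \<bullet> v)) (at x)"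
  shows "grad \<phi> x = G"
  using frechet_derivative_at[OF assms, symmetric]
  by (simp add: grad_def vec_eq_iff inner_axis)

lemma has_derivative_norm_sq:
  "((\<lambda>x::'a::real_inner. (norm x)\<^sup>2) has_derivative (\<lambda>v. 2 * (x \<bullet> v))) (at x)"
  unfolding power2_norm_eq_inner by (auto intro!: derivative_eq_intros simp: inner_commute)

lemma radial_has_derivative:
  assumes "smooth_on h UNIV"
  shows "(radial h has_derivative (\<lambda>v. deriv h ((norm x)\<^sup>2) * (2 * (x \<bullet> v)))) (at x)"
  unfolding radial_def[abs_def]
  using has_derivative_compose[OF has_derivative_norm_sq, of h] smooth_on_deriv(1)[OF assms]
  by (auto simp: has_field_derivative_def)

lemma grad_radial:
  fixes x :: "real^'n"
  assumes "smooth_on h UNIV"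
  shows "grad (radial h) x = (2 * deriv h ((norm x)\<^sup>2)) *\<^sub>R x"
  by (rule grad_eqI, rule has_derivative_eq_rhs[OF radial_has_derivative[OF assms]]) (simp add: mult_ac)

lemma grad_radial_component:
  fixes x :: "real^'n"
  assumes "smooth_on h UNIV"
  shows "grad (\<lambda>x. 2 * radial (deriv h) x * x $ i) x
    = (4 * deriv (deriv h) ((norm x)\<^sup>2) * x $ i) *\<^sub>R x + (2 * deriv h ((norm x)\<^sup>2)) *\<^sub>R axis i 1"
proof (rule grad_eqI)
  note d = radial_has_derivative[OF smooth_on_deriv(2)[OF assms]]
  have "((\<lambda>x. 2 * radial (deriv h) x * x $ i) has_derivative
      (\<lambda>v. 2 * radial (deriv h) x * v $ i + 2 * (deriv (deriv h) ((norm x)\<^sup>2) * (2 * (x \<bullet> v))) * x $ i)) (at x)"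
    by (intro has_derivative_mult has_derivative_mult_right d bounded_linear_imp_has_derivative bounded_linear_vec_nth)
  then show "((\<lambda>x. 2 * radial (deriv h) x * x $ i) has_derivative
      (\<lambda>v. ((4 * deriv (deriv h) ((norm x)\<^sup>2) * x $ i) *\<^sub>R x + (2 * deriv h ((norm x)\<^sup>2)) *\<^sub>R axis i 1) \<bullet> v)) (at x)"
    by (rule has_derivative_eq_rhs)
       (simp add: fun_eq_iff radial_def inner_add_left inner_axis' mult_ac)
qed

lemma smooth_radial: "smooth_on h UNIV \<Longrightarrow> smooth_on (radial h :: real^'n \<Rightarrow> real) UNIV"
  unfolding radial_def[abs_def]
  using smooth_on_compose[OF thick_UNIV _ smooth_on_sqnorm[OF thick_UNIV bounded_linear_ident], of h] by simp

lemma deriv_zero_beyond: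
  fixes h :: "real \<Rightarrow> real"
  assumes "\<And>r. r > c \<Longrightarrow> h r = 0" "r > c"
  shows "deriv h r = 0"
proof -
  have "\<forall>\<^sub>F y in nhds r. h y = 0"
    using assms by (intro eventually_nhds_in_open[of "{c<..}", THEN eventually_mono]) auto
  then have "deriv h r = deriv (\<lambda>_. 0) r" by (intro deriv_cong_ev) auto
  then show ?thesis by simp
qed

lemma sq_greater: "0 \<le> \<rho> \<Longrightarrow> \<rho> < norm x \<Longrightarrow> \<rho>\<^sup>2 < (norm x)\<^sup>2"
  by (intro power_strict_mono) auto

lemma test_function_cball:
  assumes "smooth_on \<phi> UNIV" "\<And>x. norm x > \<rho> \<Longrightarrow> \<phi> x = 0"
  shows "test_function UNIV \<phi>"
  unfolding test_function_def using assms by (auto intro!: exI[of _ "cball 0 \<rho>"])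

text \<open>Testing the weak gradient against \<open>\<partial>\<^sub>i\<close> of a radial test function gives Green's formula.\<close>

lemma weak_grad_radial:
  fixes v :: "real^'n \<Rightarrow> real"
  assumes v: "H1 v" and h: "smooth_on h UNIV" and \<rho>: "\<rho> \<ge> 0" and h0: "\<And>r. r > \<rho>\<^sup>2 \<Longrightarrow> h r = 0"
  shows "(LINT x|lebesgue. weak_grad v x \<bullet> grad (radial h) x) = - (LINT x|lebesgue. v x * radial_laplacian h x)"
proof -
  define G where "G = weak_grad v"
  have "\<exists>G. L2 G \<and> has_weak_grad v G" using v by (auto simp: H1_def)
  then have G: "L2 G" "has_weak_grad v G" unfolding G_def weak_grad_def by (metis (mono_tags, lifting) someI_ex)+
  have vL: "L2 v" using v by (auto simp: H1_def)
  define \<phi> :: "'n \<Rightarrow> real^'n \<Rightarrow> real" where "\<phi> i x = 2 * radial (deriv h) x * x $ i" for i x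
  note h' = smooth_on_deriv(2)[OF h]
  note h'' = smooth_on_deriv(2)[OF h']
  have h'0: "deriv h r = 0" if "r > \<rho>\<^sup>2" for r using deriv_zero_beyond[of "\<rho>\<^sup>2" h] h0 that by blast
  have h''0: "deriv (deriv h) r = 0" if "r > \<rho>\<^sup>2" for r using deriv_zero_beyond[of "\<rho>\<^sup>2" "deriv h"] h'0 that by blast
  have \<phi>0: "\<phi> i x = 0" if "norm x > \<rho>" for i x
    using h'0[OF sq_greater[OF \<rho> that]] by (simp add: \<phi>_def radial_def)
  have \<phi>s: "smooth_on (\<phi> i) UNIV" for i
    unfolding \<phi>_def by (intro smooth_on_mult smooth_on_const smooth_radial h' smooth_on_linear) (auto intro: bounded_linear_vec_nth)
  have gr: "grad (\<phi> i) x = (4 * deriv (deriv h) ((norm x)\<^sup>2) * x $ i) *\<^sub>R x + (2 * deriv h ((norm x)\<^sup>2)) *\<^sub>R axis i 1" for i x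
    unfolding \<phi>_def by (rule grad_radial_component[OF h])
  have c: "continuous_on UNIV (\<lambda>x::real^'n. k ((norm x)\<^sup>2))" if "smooth_on k UNIV" for k
    by (rule continuous_on_compose2[OF smooth_on_imp_continuous_on[OF that]]) (auto intro!: continuous_intros)
  have gL: "L2 (grad (\<phi> i))" for i
  proof (rule L2_compact_support)
    show "continuous_on UNIV (grad (\<phi> i))"
      unfolding gr by (intro continuous_intros c h' h'')
    show "grad (\<phi> i) x = 0" if "norm x \<ge> \<rho> + 1" for x
      using h'0 h''0 sq_greater[OF \<rho>, of x] that by (simp add: gr)
  qed
  have \<phi>L: "L2 (\<phi> i)" for i
    by (rule L2_compact_support[of _ "\<rho> + 1"]) (use \<phi>0 smooth_on_imp_continuous_on[OF \<phi>s] in auto)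
  have int1: "integrable lebesgue (\<lambda>x. v x *\<^sub>R grad (\<phi> i) x)" for i
    by (rule integrable_L2_scaleR[OF vL gL])
  have int2: "integrable lebesgue (\<lambda>x. \<phi> i x *\<^sub>R G x)" for i
    by (rule integrable_L2_scaleR[OF \<phi>L G(1)])
  have comp: "integrable lebesgue (\<lambda>x. f x $ i)" "(LINT x|lebesgue. f x $ i) = (LINT x|lebesgue. f x) $ i"
    if "integrable lebesgue f" for f :: "real^'n \<Rightarrow> real^'n" and i
    using integrable_bounded_linear[OF bounded_linear_vec_nth that]
      integral_bounded_linear[OF bounded_linear_vec_nth that] by auto
  have eq: "(LINT x|lebesgue. v x * grad (\<phi> i) x $ i) = - (LINT x|lebesgue. \<phi> i x * G x $ i)" for i
  proof -
    have "test_function UNIV (\<phi> i)" using \<phi>s \<phi>0 by (rule test_function_cball)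
    then have "(LINT x|lebesgue. v x *\<^sub>R grad (\<phi> i) x) = - (LINT x|lebesgue. \<phi> i x *\<^sub>R G x)"
      using G(2) by (auto simp: has_weak_grad_def)
    then show ?thesis using comp(2)[OF int1, of i i] comp(2)[OF int2, of i i] by simp
  qed
  have "(LINT x|lebesgue. G x \<bullet> grad (radial h) x) = (LINT x|lebesgue. (\<Sum>i\<in>UNIV. \<phi> i x * G x $ i))"
    by (rule Bochner_Integration.integral_cong)
       (auto simp: grad_radial[OF h] inner_vec_def \<phi>_def radial_def sum_distrib_left mult_ac)
  also have "\<dots> = (\<Sum>i\<in>UNIV. LINT x|lebesgue. \<phi> i x * G x $ i)"
    using comp(1)[OF int2] by (intro Bochner_Integration.integral_sum) simp
  also have "\<dots> = - (\<Sum>i\<in>UNIV. LINT x|lebesgue. v x * grad (\<phi> i) x $ i)"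
    by (simp add: eq sum_negf)
  also have "(\<Sum>i\<in>UNIV. LINT x|lebesgue. v x * grad (\<phi> i) x $ i) = (LINT x|lebesgue. (\<Sum>i\<in>UNIV. v x * grad (\<phi> i) x $ i))"
    using comp(1)[OF int1] by (intro Bochner_Integration.integral_sum[symmetric]) simp
  also have "\<dots> = (LINT x|lebesgue. v x * radial_laplacian h x)"
  proof (rule Bochner_Integration.integral_cong[OF refl])
    fix x :: "real^'n"
    have "(norm x)\<^sup>2 = (\<Sum>i\<in>UNIV. x $ i * x $ i)" by (simp add: power2_norm_eq_inner inner_vec_def)
    then have "(\<Sum>i\<in>UNIV. grad (\<phi> i) x $ i) = radial_laplacian h x"
      by (simp add: gr radial_laplacian_def sum.distrib axis_def sum_distrib_left mult_ac)
    then show "(\<Sum>i\<in>UNIV. v x * grad (\<phi> i) x $ i) = v x * radial_laplacian h x"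
      by (simp flip: sum_distrib_left)
  qed
  finally show ?thesis by (simp add: G_def)
qed

section \<open>Moments of the solution as functions of time\<close>

lemma L2_pairing_continuous:
  assumes v: "C_L2 T v" and a: "L2 a"
  shows "continuous_on {0..<T} (\<lambda>t. LINT x|lebesgue. v x t * a x)"
  unfolding continuous_on_def
proof
  fix t assume t: "t \<in> {0..<T}"
  have L: "L2 (\<lambda>x. v x s)" if "s \<in> {0..<T}" for s using v that by (auto simp: C_L2_def)
  have "((\<lambda>s. L2_norm (\<lambda>x. v x s - v x t)) \<longlongrightarrow> 0) (at t within {0..<T})"
    using v t by (auto simp: C_L2_def)
  then have z: "((\<lambda>s. L2_norm (\<lambda>x. v x s - v x t) * L2_norm a) \<longlongrightarrow> 0) (at t within {0..<T})"
    by (rule tendsto_mult_left_zero)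
  have "((\<lambda>s. (LINT x|lebesgue. v x s * a x) - (LINT x|lebesgue. v x t * a x)) \<longlongrightarrow> 0) (at t within {0..<T})"
  proof (rule Lim_null_comparison[OF _ z])
    show "\<forall>\<^sub>F s in at t within {0..<T}. norm ((LINT x|lebesgue. v x s * a x) - (LINT x|lebesgue. v x t * a x))
        \<le> L2_norm (\<lambda>x. v x s - v x t) * L2_norm a"
      unfolding eventually_at_filter
    proof (intro always_eventually allI impI)
      fix s assume s: "s \<in> {0..<T}"
      have "(LINT x|lebesgue. v x s * a x) - (LINT x|lebesgue. v x t * a x) = (LINT x|lebesgue. (v x s - v x t) * a x)"
        using L2_mult(1)[OF L a] s t by (simp add: left_diff_distrib)
      then show "norm ((LINT x|lebesgue. v x s * a x) - (LINT x|lebesgue. v x t * a x))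
          \<le> L2_norm (\<lambda>x. v x s - v x t) * L2_norm a"
        using L2_mult(2)[OF L2_diff[OF L L] a] s t by simp
    qed
  qed
  then show "((\<lambda>t. LINT x|lebesgue. v x t * a x) \<longlongrightarrow> (LINT x|lebesgue. v x t * a x)) (at t within {0..<T})"
    by (rule LIM_zero_cancel)
qed

lemma L2_pairing_derivative:
  assumes u: "C1_L2 T u ut" and a: "L2 a" and t: "t \<in> {0..<T}"
  shows "((\<lambda>t. LINT x|lebesgue. u x t * a x) has_real_derivative (LINT x|lebesgue. ut x t * a x)) (at t within {0..<T})"
proof -
  have L: "L2 (\<lambda>x. u x s)" "L2 (\<lambda>x. ut x s)" if "s \<in> {0..<T}" for s
    using u that by (auto simp: C1_L2_def C_L2_def)
  have "((\<lambda>s. L2_norm (\<lambda>x. (u x s - u x t) / (s - t) - ut x t)) \<longlongrightarrow> 0) (at t within {0..<T})"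
    using u t by (auto simp: C1_L2_def)
  then have z: "((\<lambda>s. L2_norm (\<lambda>x. (u x s - u x t) / (s - t) - ut x t) * L2_norm a) \<longlongrightarrow> 0) (at t within {0..<T})"
    by (rule tendsto_mult_left_zero)
  have "((\<lambda>s. ((LINT x|lebesgue. u x s * a x) - (LINT x|lebesgue. u x t * a x)) / (s - t)
      - (LINT x|lebesgue. ut x t * a x)) \<longlongrightarrow> 0) (at t within {0..<T})"
  proof (rule Lim_null_comparison[OF _ z])
    show "\<forall>\<^sub>F s in at t within {0..<T}. norm (((LINT x|lebesgue. u x s * a x) - (LINT x|lebesgue. u x t * a x)) / (s - t)
        - (LINT x|lebesgue. ut x t * a x)) \<le> L2_norm (\<lambda>x. (u x s - u x t) / (s - t) - ut x t) * L2_norm a"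
      unfolding eventually_at_filter
    proof (intro always_eventually allI impI)
      fix s assume s: "s \<in> {0..<T}"
      have d: "L2 (\<lambda>x. (u x s - u x t) / (s - t))"
        using L2_cmult[OF L2_diff[OF L(1)[OF s] L(1)[OF t]], of "1 / (s - t)"] by simp
      have "((LINT x|lebesgue. u x s * a x) - (LINT x|lebesgue. u x t * a x)) / (s - t) - (LINT x|lebesgue. ut x t * a x)
          = (LINT x|lebesgue. (u x s * a x - u x t * a x) / (s - t)) - (LINT x|lebesgue. ut x t * a x)"
        using L2_mult(1)[OF L(1) a] s t by simp
      also have "(\<lambda>x. (u x s * a x - u x t * a x) / (s - t)) = (\<lambda>x. (u x s - u x t) / (s - t) * a x)"
        by (simp add: left_diff_distrib)
      also have "(LINT x|lebesgue. (u x s - u x t) / (s - t) * a x) - (LINT x|lebesgue. ut x t * a x)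
          = (LINT x|lebesgue. (u x s - u x t) / (s - t) * a x - ut x t * a x)"
        by (rule Bochner_Integration.integral_diff[symmetric]) (intro L2_mult(1) d L a t)+
      also have "\<dots> = (LINT x|lebesgue. ((u x s - u x t) / (s - t) - ut x t) * a x)"
        by (simp only: left_diff_distrib)
      finally show "norm (((LINT x|lebesgue. u x s * a x) - (LINT x|lebesgue. u x t * a x)) / (s - t)
        - (LINT x|lebesgue. ut x t * a x)) \<le> L2_norm (\<lambda>x. (u x s - u x t) / (s - t) - ut x t) * L2_norm a"
        using L2_mult(2)[OF L2_diff[OF d L(2)[OF t]] a] by simp
    qed
  qed
  then show ?thesis unfolding has_field_derivative_iff by (rule LIM_zero_cancel)
qed

subsection \<open>The weak identity in time\<close>

lemma test_function_strip:
  fixes h \<eta> :: "real \<Rightarrow> real"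
  assumes h: "smooth_on h UNIV" and \<eta>: "smooth_on \<eta> UNIV" and \<rho>: "\<rho> \<ge> 0" and h0: "\<And>r. r > \<rho>\<^sup>2 \<Longrightarrow> h r = 0"
    and b: "b < T" "\<And>s. s \<ge> b \<Longrightarrow> \<eta> s = 0"
  shows "test_function (UNIV \<times> {0..<T}) (\<lambda>z :: (real^'n) \<times> real. radial h (fst z) * \<eta> (snd z))"
proof -
  have "smooth_on (\<lambda>z :: (real^'n) \<times> real. h ((norm (fst z))\<^sup>2) * \<eta> (snd z)) (UNIV \<times> {0..<T})"
    by (intro smooth_on_mult smooth_on_compose[OF _ h] smooth_on_compose[OF _ \<eta>] smooth_on_sqnorm
        smooth_on_linear thick_strip bounded_linear_fst bounded_linear_snd)
  moreover have "compact (cball (0 :: real^'n) \<rho> \<times> {0..b})" by (intro compact_Times) auto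
  moreover have "\<forall>z\<in>UNIV \<times> {0..<T} - cball (0 :: real^'n) \<rho> \<times> {0..b}. radial h (fst z) * \<eta> (snd z) = 0"
  proof
    fix z :: "(real^'n) \<times> real" assume "z \<in> UNIV \<times> {0..<T} - cball 0 \<rho> \<times> {0..b}"
    then have "norm (fst z) > \<rho> \<or> snd z \<ge> b" by (cases z) auto
    then show "radial h (fst z) * \<eta> (snd z) = 0"
      using h0[OF sq_greater[OF \<rho>]] b(2) by (auto simp: radial_def)
  qed
  ultimately show ?thesis
    unfolding test_function_def radial_def using b(1)
    by (intro conjI exI[of _ "cball 0 \<rho> \<times> {0..b}"]) auto
qed

lemma vector_derivative_zero_strip:
  fixes f :: "real \<Rightarrow> real"
  assumes s: "s \<in> {0..<T}" "s < c" and f: "\<And>r. r < c \<Longrightarrow> f r = k"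
  shows "vector_derivative f (at s within {0..<T}) = 0"
proof -
  have ne: "at s within {0..<T} \<noteq> bot"
    using s by (auto simp: trivial_limit_within)
  have "(f has_vector_derivative 0) (at s)"
    by (rule has_vector_derivative_transform_within_open[of "\<lambda>_. k" _ _ "{..<c}"])
       (use s f in auto)
  then have "(f has_vector_derivative 0) (at s within {0..<T})"
    by (rule has_vector_derivative_at_within)
  then show ?thesis
    by (rule vector_derivative_within[OF ne])
qed

lemma absolutely_integrable_continuous_LINT:
  fixes f :: "real \<Rightarrow> real"
  assumes "continuous_on {a..b} f"
  shows "set_integrable lebesgue {a..b} f" "(LINT s:{a..b}|lebesgue. f s) = integral {a..b} f"
  using absolutely_integrable_continuous_real[OF assms] set_lebesgue_integral_eq_integral(2) by blast+

text \<open>The test function is \<open>radial h\<close> times a cutoff in time equal to 1 beyond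
  \<open>t0\<close>, so its time derivative drops out on [0, t0] and the weak equation becomes an
  integrated first-order equation for the moment \<open>V\<close> of the time derivative. Green's
  formula moves the gradient term onto \<open>h\<close>. Since test functions have compact support
  in [0, T), \<open>t0\<close> must stay below \<open>T\<close>.\<close>

lemma energy_identity:
  fixes u :: "real^'n \<Rightarrow> real \<Rightarrow> real" and h :: "real \<Rightarrow> real"
  assumes sol: "energy_solution \<mu> \<beta> p \<epsilon> f g T u"
    and t0: "0 \<le> t0" "t0 < T"
    and h: "smooth_on h UNIV" and \<rho>: "\<rho> \<ge> 0" and h0: "\<And>r. r > \<rho>\<^sup>2 \<Longrightarrow> h r = 0"
    and g: "L2 g"
  obtains V P where "continuous_on {0..t0} V"
    "\<And>t. t \<in> {0..t0} \<Longrightarrow> ((\<lambda>t. LINT x|lebesgue. u x t * radial h x) has_real_derivative V t) (at t within {0..t0})"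
    "V 0 = (LINT x|lebesgue. \<epsilon> * g x * radial h x)"
    "continuous_on {0..t0} (\<lambda>s. LINT x|lebesgue. u x s * radial_laplacian h x)"
    "P absolutely_integrable_on {0..t0}"
    "AE s in lebesgue. s \<in> {0..t0} \<longrightarrow> integrable lebesgue (\<lambda>x. \<bar>u x s\<bar> powr p * radial h x)
       \<and> P s = (LINT x|lebesgue. \<bar>u x s\<bar> powr p * radial h x)"
    "\<And>a b. 0 \<le> a \<Longrightarrow> a \<le> b \<Longrightarrow> b \<le> t0 \<Longrightarrow> V b - V a =
       integral {a..b} (\<lambda>s. (LINT x|lebesgue. u x s * radial_laplacian h x) - \<mu> / (1 + s) powr \<beta> * V s)
       + integral {a..b} P"
proof -
  obtain ut where ut: "C1_L2 T u ut" "AE x in lebesgue. ut x 0 = \<epsilon> * g x"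
    and eq: "\<And>\<phi> t. test_function (UNIV \<times> {0..<T}) \<phi> \<Longrightarrow> t \<in> {0..<T} \<Longrightarrow>
          set_integrable lebesgue (UNIV \<times> {0..t}) (\<lambda>(x, s). \<bar>u x s\<bar> powr p * \<phi> (x, s)) \<and>
          (LINT x|lebesgue. ut x t * \<phi> (x, t)) - (LINT x|lebesgue. ut x 0 * \<phi> (x, 0))
          + (LINT s:{0..t}|lebesgue. (LINT x|lebesgue.
               - ut x s * vector_derivative (\<lambda>r. \<phi> (x, r)) (at s within {0..<T})
               + weak_grad (\<lambda>y. u y s) x \<bullet> grad (\<lambda>y. \<phi> (y, s)) x))
          + (LINT s:{0..t}|lebesgue. (LINT x|lebesgue.
               \<mu> * ut x s / (1 + s) powr \<beta> * \<phi> (x, s)))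
          = (LINT s:{0..t}|lebesgue. (LINT x|lebesgue. \<bar>u x s\<bar> powr p * \<phi> (x, s)))"
    using sol unfolding energy_solution_def by blast
  have H1: "H1 (\<lambda>x. u x s)" if "s \<in> {0..<T}" for s
    using sol that by (auto simp: energy_solution_def C_H1_def)
  define a :: "real^'n \<Rightarrow> real" where "a = radial h"
  note h' = smooth_on_deriv(2)[OF h]
  note h'' = smooth_on_deriv(2)[OF h']
  have h'0: "deriv h r = 0" if "r > \<rho>\<^sup>2" for r using deriv_zero_beyond[of "\<rho>\<^sup>2" h] h0 that by blast
  have h''0: "deriv (deriv h) r = 0" if "r > \<rho>\<^sup>2" for r using deriv_zero_beyond[of "\<rho>\<^sup>2" "deriv h"] h'0 that by blast
  have c: "continuous_on UNIV (\<lambda>x::real^'n. k ((norm x)\<^sup>2))" if "smooth_on k UNIV" for k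
    by (rule continuous_on_compose2[OF smooth_on_imp_continuous_on[OF that]]) (auto intro!: continuous_intros)
  have z: "h ((norm x)\<^sup>2) = 0" "deriv h ((norm x)\<^sup>2) = 0" "deriv (deriv h) ((norm x)\<^sup>2) = 0"
    if "norm x > \<rho>" for x :: "real^'n"
    using h0 h'0 h''0 sq_greater[OF \<rho> that] by auto
  have aL: "L2 a"
    unfolding a_def
    by (rule L2_compact_support[of _ "\<rho> + 1"]) (use z c[OF h] in \<open>auto simp: radial_def[abs_def]\<close>)
  have lL: "L2 (radial_laplacian h :: real^'n \<Rightarrow> real)"
  proof (rule L2_compact_support[of _ "\<rho> + 1"])
    show "continuous_on UNIV (radial_laplacian h :: real^'n \<Rightarrow> real)"
      unfolding radial_laplacian_def[abs_def] by (intro continuous_intros c h' h'')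
  qed (use z in \<open>auto simp: radial_laplacian_def\<close>)
  define V where "V t = (LINT x|lebesgue. ut x t * a x)" for t
  define L where "L s = (LINT x|lebesgue. u x s * radial_laplacian h x)" for s
  define P where "P s = (LINT x|lebesgue. \<bar>u x s\<bar> powr p * a x)" for s
  \<comment> \<open>One third of the remaining time each for the plateau beyond \<open>t0\<close>,
    the descent of the cutoff, and the distance of its support from \<open>T\<close>. The plateau
    extends past \<open>t0\<close> so that the time derivative vanishes at \<open>t0\<close>
    itself.\<close>
  define d where "d = (T - t0) / 3"
  have d: "d > 0" "t0 + 2 * d < T" using t0 by (auto simp: d_def field_simps)
  obtain \<eta> where \<eta>: "smooth_on \<eta> UNIV" "\<And>s. s \<le> t0 + d \<Longrightarrow> \<eta> s = 1" "\<And>s. s \<ge> t0 + 2 * d \<Longrightarrow> \<eta> s = 0"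
    by (rule smooth_cutoff[of "t0 + d" "t0 + 2 * d"]) (use d in auto)
  define \<phi> :: "(real^'n) \<times> real \<Rightarrow> real" where "\<phi> z = a (fst z) * \<eta> (snd z)" for z
  have test: "test_function (UNIV \<times> {0..<T}) \<phi>"
    unfolding \<phi>_def a_def by (rule test_function_strip[OF h \<eta>(1) \<rho> h0 d(2) \<eta>(3)])
  have \<phi>1: "\<phi> (x, s) = a x" if "s \<le> t0" for x s using \<eta>(2)[of s] that d by (simp add: \<phi>_def)
  have vd: "vector_derivative (\<lambda>r. \<phi> (x, r)) (at s within {0..<T}) = 0" if "s \<in> {0..t0}" for x s
    by (rule vector_derivative_zero_strip[of s T "t0 + d" _ "a x"]) (use that d t0 \<eta>(2) in \<open>auto simp: \<phi>_def\<close>)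
  have Vc: "continuous_on {0..t0} V"
    unfolding V_def using ut(1) t0
    by (intro continuous_on_subset[OF L2_pairing_continuous[OF _ aL]]) (auto simp: C1_L2_def)
  have Lc: "continuous_on {0..t0} L"
    unfolding L_def using ut(1) t0
    by (intro continuous_on_subset[OF L2_pairing_continuous[OF _ lL]]) (auto simp: C1_L2_def)
  have Ud: "((\<lambda>t. LINT x|lebesgue. u x t * a x) has_real_derivative V t) (at t within {0..t0})" if "t \<in> {0..t0}" for t
    unfolding V_def
    by (rule has_field_derivative_subset[OF L2_pairing_derivative[OF ut(1) aL]]) (use that t0 in auto)
  have V0: "V 0 = (LINT x|lebesgue. \<epsilon> * g x * a x)"
  proof -
    have "(\<lambda>x. ut x 0) \<in> borel_measurable lebesgue" "g \<in> borel_measurable lebesgue" "a \<in> borel_measurable lebesgue"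
      using ut(1) t0 g aL by (auto simp: C1_L2_def C_L2_def L2_def)
    then show ?thesis
      unfolding V_def using ut(2) by (intro integral_cong_AE) (auto elim: AE_mp)
  qed
  have P: "P absolutely_integrable_on {0..t0}"
    and PA: "AE s in lebesgue. s \<in> {0..t0} \<longrightarrow> integrable lebesgue (\<lambda>x. \<bar>u x s\<bar> powr p * a x)"
  proof -
    \<comment> \<open>A Bochner integral with value 0 says nothing about integrability, so the
      slices have to be shown integrable. Space-time integrability provides this for almost every
      time.\<close>
    define F where "F z = indicator (UNIV \<times> {0..t0}) z *\<^sub>R (case z of (x, s) \<Rightarrow> \<bar>u x s\<bar> powr p * \<phi> (x, s))" for z
    have "integrable lebesgue F"
      using eq[OF test, of t0] t0 by (simp add: set_integrable_def F_def[abs_def])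
    note F = lebesgue_integrable_sections[OF this]
    have Fe: "F (x, s) = \<bar>u x s\<bar> powr p * a x" if "s \<in> {0..t0}" for x s
      using that \<phi>1[of s x] by (simp add: F_def)
    have F0: "F (x, s) = 0" if "s \<notin> {0..t0}" for x s
      using that by (simp add: F_def indicator_def)
    show "AE s in lebesgue. s \<in> {0..t0} \<longrightarrow> integrable lebesgue (\<lambda>x. \<bar>u x s\<bar> powr p * a x)"
      using F(1) by (rule AE_mp) (auto simp: Fe)
    have "(\<lambda>s. LINT x|lebesgue. F (x, s)) = (\<lambda>s. indicator {0..t0} s *\<^sub>R P s)"
    proof
      fix s show "(LINT x|lebesgue. F (x, s)) = indicator {0..t0} s *\<^sub>R P s"
        by (cases "s \<in> {0..t0}") (simp_all add: Fe F0 P_def)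
    qed
    then show "P absolutely_integrable_on {0..t0}" using F(2) by (simp add: set_integrable_def)
  qed
  have bVc: "continuous_on {0..t0} (\<lambda>s. \<mu> / (1 + s) powr \<beta> * V s)"
    by (intro continuous_intros Vc damping_continuous)
  have ident: "V t - V 0 = integral {0..t} (\<lambda>s. L s - \<mu> / (1 + s) powr \<beta> * V s) + integral {0..t} P"
    if t: "t \<in> {0..t0}" for t
  proof -
    have sub: "continuous_on {0..t} k" if "continuous_on {0..t0} k" for k :: "real \<Rightarrow> real"
      using that t by (intro continuous_on_subset[OF that]) auto
    have "t \<in> {0..<T}" using t t0 by auto
    note E = conjunct2[OF eq[OF test this]]
    have 1: "(LINT x|lebesgue. ut x t * \<phi> (x, t)) = V t" "(LINT x|lebesgue. ut x 0 * \<phi> (x, 0)) = V 0"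
      using t \<phi>1 t0 by (auto simp: V_def)
    have 2: "(LINT s:{0..t}|lebesgue. (LINT x|lebesgue.
               - ut x s * vector_derivative (\<lambda>r. \<phi> (x, r)) (at s within {0..<T})
               + weak_grad (\<lambda>y. u y s) x \<bullet> grad (\<lambda>y. \<phi> (y, s)) x)) = (LINT s:{0..t}|lebesgue. - L s)"
    proof (rule set_lebesgue_integral_cong, simp, intro allI impI)
      fix s assume s: "s \<in> {0..t}"
      then have "s \<in> {0..t0}" "s \<in> {0..<T}" using t t0 by auto
      then show "(LINT x|lebesgue.
               - ut x s * vector_derivative (\<lambda>r. \<phi> (x, r)) (at s within {0..<T})
               + weak_grad (\<lambda>y. u y s) x \<bullet> grad (\<lambda>y. \<phi> (y, s)) x) = - L s"
        using weak_grad_radial[OF H1 h \<rho> h0, of s] \<phi>1[of s]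
        by (simp add: vd L_def a_def)
    qed
    have 3: "(LINT s:{0..t}|lebesgue. (LINT x|lebesgue. \<mu> * ut x s / (1 + s) powr \<beta> * \<phi> (x, s)))
        = (LINT s:{0..t}|lebesgue. \<mu> / (1 + s) powr \<beta> * V s)"
    proof (rule set_lebesgue_integral_cong, simp, intro allI impI)
      fix s assume "s \<in> {0..t}"
      then have "s \<le> t0" using t by auto
      then have "(\<lambda>x. \<mu> * ut x s / (1 + s) powr \<beta> * \<phi> (x, s)) = (\<lambda>x. \<mu> / (1 + s) powr \<beta> * (ut x s * a x))"
        by (simp add: \<phi>1 mult_ac)
      then show "(LINT x|lebesgue. \<mu> * ut x s / (1 + s) powr \<beta> * \<phi> (x, s)) = \<mu> / (1 + s) powr \<beta> * V s"
        by (simp add: V_def)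
    qed
    have 4: "(LINT s:{0..t}|lebesgue. (LINT x|lebesgue. \<bar>u x s\<bar> powr p * \<phi> (x, s))) = (LINT s:{0..t}|lebesgue. P s)"
      by (rule set_lebesgue_integral_cong) (use t \<phi>1 in \<open>auto simp: P_def\<close>)
    have Pt: "P absolutely_integrable_on {0..t}"
      by (rule set_integrable_subset[OF P]) (use t in auto)
    have 5: "(LINT s:{0..t}|lebesgue. - L s) = - integral {0..t} L"
      using absolutely_integrable_continuous_LINT(2)[OF continuous_on_minus[OF sub[OF Lc]]] by simp
    have 6: "(LINT s:{0..t}|lebesgue. \<mu> / (1 + s) powr \<beta> * V s) = integral {0..t} (\<lambda>s. \<mu> / (1 + s) powr \<beta> * V s)"
      by (rule absolutely_integrable_continuous_LINT(2)[OF sub[OF bVc]])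
    have 7: "(LINT s:{0..t}|lebesgue. P s) = integral {0..t} P"
      by (rule set_lebesgue_integral_eq_integral(2)[OF Pt])
    have "integral {0..t} (\<lambda>s. L s - \<mu> / (1 + s) powr \<beta> * V s)
        = integral {0..t} L - integral {0..t} (\<lambda>s. \<mu> / (1 + s) powr \<beta> * V s)"
      by (intro Henstock_Kurzweil_Integration.integral_diff integrable_continuous_real sub Lc bVc)
    then show ?thesis using E unfolding 1 2 3 4 5 6 7 by simp
  qed
  show ?thesis
  proof (rule that[of V P])
    show "AE s in lebesgue. s \<in> {0..t0} \<longrightarrow> integrable lebesgue (\<lambda>x. \<bar>u x s\<bar> powr p * radial h x)
       \<and> P s = (LINT x|lebesgue. \<bar>u x s\<bar> powr p * radial h x)"
      using PA by (rule AE_mp) (auto simp: P_def a_def)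
    fix x y assume ab: "0 \<le> x" "x \<le> y" "y \<le> t0"
    have Pi: "P integrable_on {0..y}"
      by (rule integrable_on_subinterval[OF set_lebesgue_integral_eq_integral(1)[OF P]]) (use ab in auto)
    have Li: "(\<lambda>s. L s - \<mu> / (1 + s) powr \<beta> * V s) integrable_on {0..y}"
      using ab by (intro integrable_continuous_real continuous_on_subset[OF continuous_on_diff[OF Lc bVc]]) auto
    show "V y - V x = integral {x..y} (\<lambda>s. (LINT x|lebesgue. u x s * radial_laplacian h x) - \<mu> / (1 + s) powr \<beta> * V s)
       + integral {x..y} P"
      unfolding L_def[symmetric]
      using ident[of x] ident[of y] ab
        Henstock_Kurzweil_Integration.integral_combine[OF ab(1,2) Pi]
        Henstock_Kurzweil_Integration.integral_combine[OF ab(1,2) Li]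
      by simp
  qed (use Vc Ud V0 Lc P in \<open>simp_all add: a_def L_def[abs_def]\<close>)
qed

lemma integral_ge_AE:
  fixes P k :: "real \<Rightarrow> real"
  assumes P: "P absolutely_integrable_on {0..t0}" and k: "continuous_on {0..t0} k"
    and le: "AE s in lebesgue. s \<in> {0..t0} \<longrightarrow> k s \<le> P s" and ab: "0 \<le> a" "b \<le> t0"
  shows "integral {a..b} k \<le> integral {a..b} P"
proof -
  have Pi: "P absolutely_integrable_on {a..b}"
    by (rule set_integrable_subset[OF P]) (use ab in auto)
  have ki: "k absolutely_integrable_on {a..b}"
    using ab by (intro absolutely_integrable_continuous_real continuous_on_subset[OF k]) auto
  have "(LINT s:{a..b}|lebesgue. k s) \<le> (LINT s:{a..b}|lebesgue. P s)"
    unfolding set_lebesgue_integral_def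
    using Pi ki le ab by (intro integral_mono_AE) (auto simp: set_integrable_def indicator_def elim: AE_mp)
  then show ?thesis
    using set_lebesgue_integral_eq_integral(2)[OF Pi] set_lebesgue_integral_eq_integral(2)[OF ki] by simp
qed

subsection \<open>Lower bounds for solutions\<close>

text \<open>Hoelder's inequality solved for the integral \<open>P\<close> of |u|^p: raising to the
  power p turns B^(1/q) into B^(p-1), since p/q = p - 1.\<close>

lemma powr_Hoelder_lower:
  fixes A B P p q :: real
  assumes pq: "p > 1" "1 / p + 1 / q = 1" and "A \<ge> 0" "B > 0" "P \<ge> 0" "A \<le> P powr (1 / p) * B powr (1 / q)"
  shows "A powr p * B powr (- (p - 1)) \<le> P"
proof -
  have "1 / q = (p - 1) / p" using pq by (simp add: diff_divide_distrib)
  then have e: "p / q = p - 1" using pq by (simp add: divide_inverse)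
  have "A powr p \<le> (P powr (1 / p) * B powr (1 / q)) powr p" using assms by (intro powr_mono2) auto
  also have "\<dots> = P * B powr (p - 1)"
  proof (cases "P = 0")
    case False
    then show ?thesis using assms by (simp add: powr_mult powr_powr e)
  qed (use assms in auto)
  finally have "A powr p * B powr (- (p - 1)) \<le> P * B powr (p - 1) * B powr (- (p - 1))"
    by (rule mult_right_mono) auto
  also have "\<dots> = P" using assms by (simp flip: powr_add add: mult.assoc)
  finally show ?thesis .
qed

text \<open>Derivatives see a neighbourhood, hence the strict inequality. For this reason the space
  cutoff is later 1 up to radius X + R + 2, although the slices of \<open>u\<close> live within X +
  R + 1.\<close>

lemma deriv_times_cutoff:
  fixes k \<zeta> :: "real \<Rightarrow> real"
  assumes "\<And>r. r < c \<Longrightarrow> \<zeta> r = 1" "r < c"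
  shows "deriv (\<lambda>r. k r * \<zeta> r) r = deriv k r" "deriv (deriv (\<lambda>r. k r * \<zeta> r)) r = deriv (deriv k) r"
proof -
  have ev: "\<forall>\<^sub>F y in nhds r. y < c" if "r < c" for r
    using eventually_nhds_in_open[of "{..<c}" r] that by auto
  have 1: "deriv (\<lambda>r. k r * \<zeta> r) r = deriv k r" if "r < c" for r
    by (rule deriv_cong_ev[OF eventually_mono[OF ev[OF that]]]) (simp_all add: assms(1))
  show "deriv (\<lambda>r. k r * \<zeta> r) r = deriv k r" using 1 assms(2) by blast
  show "deriv (deriv (\<lambda>r. k r * \<zeta> r)) r = deriv (deriv k) r"
    by (rule deriv_cong_ev[OF eventually_mono[OF ev[OF assms(2)]]]) (simp_all add: 1)
qed

lemma radial_laplacian_times_cutoff: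
  fixes x :: "real^'n"
  assumes "\<And>r. r < \<rho>\<^sup>2 \<Longrightarrow> \<zeta> r = 1" "norm x < \<rho>"
  shows "radial_laplacian (\<lambda>r. k r * \<zeta> r) x = radial_laplacian k x"
proof -
  have "(norm x)\<^sup>2 < \<rho>\<^sup>2" using assms(2) by (intro power_strict_mono) auto
  then show ?thesis using deriv_times_cutoff[of "\<rho>\<^sup>2" \<zeta> "(norm x)\<^sup>2" k] assms(1)
    by (simp add: radial_laplacian_def)
qed

lemma radial_laplacian_bessel_psi:
  "radial_laplacian (bessel_psi CARD('n)) x = radial (bessel_psi CARD('n)) (x :: real^'n)"
proof -
  have "real CARD('n) \<ge> 1" using one_le_card_finite[where 'a='n] by linarith
  from bessel_psi_ode[OF this, of "(norm x)\<^sup>2"] show ?thesis by (simp add: radial_laplacian_def radial_def)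
qed

lemma radial_laplacian_const: "radial_laplacian (\<lambda>_. c) x = 0"
proof -
  have "deriv (\<lambda>_::real. c::real) = (\<lambda>_. 0)" by (simp add: fun_eq_iff)
  then show ?thesis by (simp add: radial_laplacian_def)
qed

lemma integral_eq_on_support:
  fixes v a b :: "'a::euclidean_space \<Rightarrow> real"
  assumes "v \<in> borel_measurable lebesgue" "a \<in> borel_measurable lebesgue" "b \<in> borel_measurable lebesgue"
    and "AE x in lebesgue. norm x > r \<longrightarrow> v x = 0" "\<And>x. norm x \<le> r \<Longrightarrow> a x = b x"
  shows "(LINT x|lebesgue. v x * a x) = (LINT x|lebesgue. v x * b x)"
proof (rule integral_cong_AE)
  show "AE x in lebesgue. v x * a x = v x * b x"
    using assms(4)
  proof eventually_elim
    case (elim x)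
    then show ?case using assms(5)[of x] by (cases "norm x \<le> r") auto
  qed
qed (intro borel_measurable_times assms(1-3))+

text \<open>Treats both multipliers at once: the constant 1 with \<open>\<kappa> = 0\<close>, and
  psi with \<open>\<kappa> = 1\<close>. The cutoff \<open>\<zeta>\<close> gives them compact support
  without changing their pairings with \<open>u\<close> or the Laplacians that occur there. The free
  function \<open>l\<close> is a continuous minorant of \<open>P\<close>, because the lemmas on
  differential inequalities ask for continuous right-hand sides whereas \<open>P\<close> is only
  integrable. The mass of \<open>f\<close> is taken over a ball fixed in advance, so the bound at
  time 0 does not depend on X.\<close>

lemma damped_energy_bounds:
  fixes u :: "real^'n \<Rightarrow> real \<Rightarrow> real" and f g :: "real^'n \<Rightarrow> real"
  assumes pos: "\<mu> > 0" "\<beta> > 1" "R > 0" "\<epsilon> > 0"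
    and sol: "energy_solution \<mu> \<beta> p \<epsilon> f g T u"
    and supp: "ess_support (UNIV \<times> {0..<T}) (\<lambda>(x, t). u x t)
         \<subseteq> {(x, t). 0 \<le> t \<and> t < T \<and> norm x \<le> t + R}"
    and X: "0 \<le> X" "X < T" and f: "L2 f" "AE x in lebesgue. f x \<ge> 0" and g: "L2 g" "AE x in lebesgue. g x \<ge> 0"
    and \<zeta>: "smooth_on \<zeta> UNIV" "\<And>r. r \<le> (X + R + 2)\<^sup>2 \<Longrightarrow> \<zeta> r = 1" "\<And>r. r \<ge> (X + R + 3)\<^sup>2 \<Longrightarrow> \<zeta> r = 0"
      "\<And>r. \<zeta> r \<ge> 0"
    and k: "smooth_on k UNIV" "\<And>r. r \<ge> 0 \<Longrightarrow> k r \<ge> 1"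
    and lap: "\<And>x::real^'n. radial_laplacian k x = \<kappa> * radial k x"
  obtains V P where "continuous_on {0..X} V"
    "\<And>t. t \<in> {0..X} \<Longrightarrow> ((\<lambda>t. LINT x|lebesgue. u x t * radial (\<lambda>r. k r * \<zeta> r) x) has_real_derivative V t) (at t within {0..X})"
    "V 0 \<ge> 0" "(LINT x|lebesgue. u x 0 * radial (\<lambda>r. k r * \<zeta> r) x) \<ge> \<epsilon> * (LINT x:cball 0 (R + 1)|lebesgue. f x)"
    "AE s in lebesgue. s \<in> {0..X} \<longrightarrow> integrable lebesgue (\<lambda>x. \<bar>u x s\<bar> powr p * radial (\<lambda>r. k r * \<zeta> r) x)
       \<and> P s = (LINT x|lebesgue. \<bar>u x s\<bar> powr p * radial (\<lambda>r. k r * \<zeta> r) x)"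
    "\<And>l a b. continuous_on {0..X} l \<Longrightarrow> AE s in lebesgue. s \<in> {0..X} \<longrightarrow> l s \<le> P s \<Longrightarrow> 0 \<le> a \<Longrightarrow> a \<le> b \<Longrightarrow> b \<le> X \<Longrightarrow> V b - V a \<ge>
       integral {a..b} (\<lambda>s. \<kappa> * (LINT x|lebesgue. u x s * radial (\<lambda>r. k r * \<zeta> r) x) + l s - \<mu> / (1 + s) powr \<beta> * V s)"
proof -
  define h where "h r = k r * \<zeta> r" for r
  have h: "smooth_on h UNIV" unfolding h_def by (intro smooth_on_mult k \<zeta>) auto
  have h0: "h r = 0" if "r > (X + R + 3)\<^sup>2" for r using \<zeta>(3)[of r] that by (simp add: h_def)
  have \<rho>: "X + R + 3 \<ge> 0" using X pos by simp
  define U where "U t = (LINT x|lebesgue. u x t * radial h x)" for t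
  define L where "L t = (LINT x|lebesgue. u x t * radial_laplacian h x)" for t
  obtain V P where V: "continuous_on {0..X} V"
    "\<And>t. t \<in> {0..X} \<Longrightarrow> (U has_real_derivative V t) (at t within {0..X})"
    "V 0 = (LINT x|lebesgue. \<epsilon> * g x * radial h x)" and Lc: "continuous_on {0..X} L"
    and P: "P absolutely_integrable_on {0..X}"
    "AE s in lebesgue. s \<in> {0..X} \<longrightarrow> integrable lebesgue (\<lambda>x. \<bar>u x s\<bar> powr p * radial h x)
       \<and> P s = (LINT x|lebesgue. \<bar>u x s\<bar> powr p * radial h x)"
    and id: "\<And>a b. 0 \<le> a \<Longrightarrow> a \<le> b \<Longrightarrow> b \<le> X \<Longrightarrow> V b - V a =
       integral {a..b} (\<lambda>s. L s - \<mu> / (1 + s) powr \<beta> * V s) + integral {a..b} P"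
    unfolding U_def L_def by (rule energy_identity[OF sol X h \<rho> h0 g(1)]) blast+
  have hpos: "h r \<ge> 0" if "r \<ge> 0" for r using k(2)[OF that] \<zeta>(4)[of r] by (simp add: h_def)
  have h1: "h r \<ge> 1" if "r \<ge> 0" "r \<le> (X + R + 2)\<^sup>2" for r using k(2) \<zeta>(2) that by (simp add: h_def)
  have C: "C_L2 T u" using sol by (auto simp: energy_solution_def C1_L2_def)
  have uL: "L2 (\<lambda>x. u x t)" if "t \<in> {0..X}" for t using C that X by (auto simp: C_L2_def)
  have c: "continuous_on UNIV (\<lambda>x::real^'n. k ((norm x)\<^sup>2))" if "smooth_on k UNIV" for k
    by (rule continuous_on_compose2[OF smooth_on_imp_continuous_on[OF that]]) (auto intro!: continuous_intros)
  have hc: "continuous_on UNIV (radial h :: real^'n \<Rightarrow> real)"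
    using c[OF h] by (simp add: radial_def[abs_def])
  have lc: "continuous_on UNIV (radial_laplacian h :: real^'n \<Rightarrow> real)"
    unfolding radial_laplacian_def[abs_def] by (intro continuous_intros c smooth_on_deriv(2) h)
  have hm: "radial h \<in> borel_measurable (lebesgue :: (real^'n) measure)"
    "radial_laplacian h \<in> borel_measurable (lebesgue :: (real^'n) measure)"
    using borel_measurable_continuous_onI[OF hc] borel_measurable_continuous_onI[OF lc] by (auto simp: measurable_completion)
  have hL: "L2 (radial h :: real^'n \<Rightarrow> real)"
  proof (rule L2_compact_support[OF hc])
    show "radial h x = 0" if "norm x \<ge> X + R + 4" for x :: "real^'n"
      unfolding radial_def by (rule h0, rule sq_greater) (use that \<rho> in auto)
  qed
  have LU: "L t = \<kappa> * U t" if t: "t \<in> {0..X}" for t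
  proof -
    have "AE x in lebesgue. norm x > t + R + 1 \<longrightarrow> u x t = 0"
      by (rule finite_propagation_slices[OF supp C]) (use t X in auto)
    moreover have "radial_laplacian h x = \<kappa> * radial h x" if "norm x \<le> t + R + 1" for x :: "real^'n"
    proof -
      have n: "norm x < X + R + 2" using that t by auto
      have "radial_laplacian h x = \<kappa> * radial k x"
        unfolding h_def lap[symmetric] by (rule radial_laplacian_times_cutoff[OF _ n]) (simp add: \<zeta>(2))
      moreover have "(norm x)\<^sup>2 \<le> (X + R + 2)\<^sup>2" using n by (intro power_mono) auto
      ultimately show ?thesis using \<zeta>(2) by (simp add: radial_def h_def)
    qed
    ultimately have "L t = (LINT x|lebesgue. u x t * (\<kappa> * radial h x))"
      unfolding L_def using uL[OF t] hm by (intro integral_eq_on_support) (auto simp: L2_def)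
    then show ?thesis by (simp add: U_def mult.left_commute)
  qed
  show ?thesis
  proof (rule that[of V P])
    show "V 0 \<ge> 0"
      unfolding V(3)
    proof (rule integral_nonneg_AE)
      show "AE x in lebesgue. 0 \<le> \<epsilon> * g x * radial h x"
        using g(2) by eventually_elim (simp add: radial_def hpos pos(4) less_imp_le)
    qed
    have u0: "AE x in lebesgue. u x 0 = \<epsilon> * f x" using sol by (simp add: energy_solution_def)
    have "\<epsilon> * (LINT x:cball 0 (R + 1)|lebesgue. f x) = (LINT x|lebesgue. \<epsilon> * (indicator (cball 0 (R + 1)) x * f x))"
      by (simp add: set_lebesgue_integral_def)
    also have "\<dots> \<le> (LINT x|lebesgue. u x 0 * radial h x)"
    proof (rule integral_mono_AE)
      show "integrable lebesgue (\<lambda>x. \<epsilon> * (indicator (cball 0 (R + 1)) x * f x))"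
        by (intro integrable_mult_right L2_mult(1) L2_indicator_cball f)
      show "integrable lebesgue (\<lambda>x. u x 0 * radial h x)" using X by (intro L2_mult(1) uL hL) auto
      show "AE x in lebesgue. \<epsilon> * (indicator (cball 0 (R + 1)) x * f x) \<le> u x 0 * radial h x"
        using u0 f(2)
      proof eventually_elim
        case (elim x)
        have "indicator (cball 0 (R + 1)) x \<le> radial h x"
        proof (cases "norm x \<le> R + 1")
          case True
          then have "(norm x)\<^sup>2 \<le> (X + R + 2)\<^sup>2" using X by (intro power_mono) auto
          then show ?thesis using h1[of "(norm x)\<^sup>2"] by (simp add: radial_def indicator_def)
        qed (use hpos[of "(norm x)\<^sup>2"] in \<open>auto simp: radial_def\<close>)
        then have "(\<epsilon> * f x) * indicator (cball 0 (R + 1)) x \<le> (\<epsilon> * f x) * radial h x"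
          using elim pos by (intro mult_left_mono) auto
        then show ?case using elim by (simp add: mult_ac)
      qed
    qed
    finally show "(LINT x|lebesgue. u x 0 * radial (\<lambda>r. k r * \<zeta> r) x) \<ge> \<epsilon> * (LINT x:cball 0 (R + 1)|lebesgue. f x)"
      by (simp add: h_def[abs_def])
    fix l a b assume l: "continuous_on {0..X} l" "AE s in lebesgue. s \<in> {0..X} \<longrightarrow> l s \<le> P s"
      and ab: "0 \<le> a" "a \<le> b" "b \<le> X"
    have c1: "continuous_on {a..b} (\<lambda>s. L s - \<mu> / (1 + s) powr \<beta> * V s)" "continuous_on {a..b} l"
      by (rule continuous_on_subset[of "{0..X}"]; use ab in \<open>auto intro!: continuous_intros Lc V(1) damping_continuous l(1)\<close>)+
    have "integral {a..b} (\<lambda>s. \<kappa> * U s + l s - \<mu> / (1 + s) powr \<beta> * V s)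
        = integral {a..b} (\<lambda>s. (L s - \<mu> / (1 + s) powr \<beta> * V s) + l s)"
      using ab by (intro Henstock_Kurzweil_Integration.integral_cong) (auto simp: LU)
    also have "\<dots> = integral {a..b} (\<lambda>s. L s - \<mu> / (1 + s) powr \<beta> * V s) + integral {a..b} l"
      by (intro Henstock_Kurzweil_Integration.integral_add integrable_continuous_real c1)
    also have "\<dots> \<le> V b - V a" using integral_ge_AE[OF P(1) l ab(1,3)] id[OF ab] by simp
    finally show "V b - V a \<ge> integral {a..b} (\<lambda>s. \<kappa> * (LINT x|lebesgue. u x s * radial (\<lambda>r. k r * \<zeta> r) x) + l s - \<mu> / (1 + s) powr \<beta> * V s)"
      by (simp add: U_def h_def[abs_def])
  qed (use V P in \<open>simp_all add: U_def[abs_def] h_def[abs_def]\<close>)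
qed

lemma slice_power_integral:
  fixes v a :: "'a::euclidean_space \<Rightarrow> real"
  assumes v: "v \<in> borel_measurable lebesgue" and supp: "AE x in lebesgue. norm x > r \<longrightarrow> v x = 0"
    and a: "\<And>x. norm x \<le> r \<Longrightarrow> a x = 1" and int: "integrable lebesgue (\<lambda>x. \<bar>v x\<bar> powr p * a x)"
  shows "integrable lebesgue (\<lambda>x. \<bar>v x\<bar> powr p)"
    and "(LINT x|lebesgue. \<bar>v x\<bar> powr p * a x) = (LINT x|lebesgue. \<bar>v x\<bar> powr p)"
proof -
  have m: "(\<lambda>x. \<bar>v x\<bar> powr p) \<in> borel_measurable lebesgue" using v by measurable
  have eq: "AE x in lebesgue. \<bar>v x\<bar> powr p * a x = \<bar>v x\<bar> powr p"
    using supp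
  proof eventually_elim
    case (elim x)
    then show ?case using a[of x] by (cases "norm x \<le> r") auto
  qed
  show "integrable lebesgue (\<lambda>x. \<bar>v x\<bar> powr p)"
    by (rule integrable_cong_AE_imp[OF int m]) (use eq in eventually_elim, simp)
  show "(LINT x|lebesgue. \<bar>v x\<bar> powr p * a x) = (LINT x|lebesgue. \<bar>v x\<bar> powr p)"
    by (rule integral_cong_AE[OF _ m eq]) (use int in auto)
qed

text \<open>Trades the radius of the light cone, shifted by \<open>R\<close>, for 1 + s; the minimum
  covers both signs of \<open>e\<close>.\<close>

lemma powr_shift_lower:
  fixes c e s :: real
  assumes "c \<ge> 1" "s \<ge> 0"
  shows "min 1 (c powr e) * (1 + s) powr e \<le> (s + c) powr e"
proof (cases "e \<ge> 0")
  case True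
  have "min 1 (c powr e) * (1 + s) powr e \<le> 1 * (1 + s) powr e" by (intro mult_right_mono) auto
  also have "\<dots> \<le> (s + c) powr e" using True assms by (simp add: powr_mono2)
  finally show ?thesis .
next
  case False
  have "min 1 (c powr e) * (1 + s) powr e \<le> c powr e * (1 + s) powr e" by (intro mult_right_mono) auto
  also have "\<dots> = (c * (1 + s)) powr e" using assms by (simp add: powr_mult)
  also have "\<dots> \<le> (s + c) powr e"
    using False assms mult_right_mono[of 1 c s] by (intro powr_mono2') (auto simp: algebra_simps)
  finally show ?thesis .
qed

text \<open>\<open>c1\<close> and \<open>c2\<close> are fixed before \<epsilon>, T, u and X, which
  is what makes the final constant independent of \<epsilon>. The functions F and V are chosen for
  each X separately, since the space cutoff is adapted to X.\<close>

lemma solution_bounds: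
  fixes f g :: "real^'n \<Rightarrow> real" and \<mu> \<beta> R p :: real
  defines "n \<equiv> real CARD('n)" and "\<kappa> \<equiv> exp (- (\<mu> / (\<beta> - 1)))"
  assumes pos: "\<mu> > 0" "\<beta> > 1" "R > 0" and p: "p > 1"
    and f: "L2 f" "AE x in lebesgue. f x \<ge> 0" and g: "L2 g" "AE x in lebesgue. g x \<ge> 0"
    and mass: "(LINT x:cball 0 (R + 1)|lebesgue. f x) > 0"
  obtains c1 c2 where "c1 > 0" "c2 > 0"
    "\<And>\<epsilon> T u X. \<epsilon> > 0 \<Longrightarrow> energy_solution \<mu> \<beta> p \<epsilon> f g T u \<Longrightarrow>
      ess_support (UNIV \<times> {0..<T}) (\<lambda>(x, t). u x t) \<subseteq> {(x, t). 0 \<le> t \<and> t < T \<and> norm x \<le> t + R} \<Longrightarrow>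
      0 \<le> X \<Longrightarrow> X < T \<Longrightarrow>
      \<exists>F V. (\<forall>r\<in>{0..X}. (F has_real_derivative V r) (at r within {0..X})) \<and> F 0 \<ge> 0 \<and>
        (\<forall>s\<in>{0..X}. V s \<ge> \<kappa> * integral {0..s} (\<lambda>r. c1 * (1 + r) powr (- n * (p - 1)) * \<bar>F r\<bar> powr p)) \<and>
        (\<forall>s\<in>{0..X}. V s \<ge> \<kappa> * integral {0..s} (\<lambda>r. c2 * \<epsilon> powr p * (1 + r) powr ((n - 1) * (1 - p / 2))))"
proof -
  define q where "q = p / (p - 1)"
  have q: "q > 1" "1 / p + 1 / q = 1" using p by (auto simp: q_def divide_simps)
  have qp: "q * (p - 1) = p" using p by (simp add: q_def)
  have n: "n \<ge> 1" using one_le_card_finite[where 'a='n] unfolding n_def by linarith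
  obtain K where K: "K > 0" "\<And>\<rho>. \<rho> \<ge> 0 \<Longrightarrow>
    (LINT x:cball (0::real^'n) \<rho>|lebesgue. bessel_psi n ((norm x)\<^sup>2) powr q)
     \<le> K * (1 + \<rho>) powr ((n - 1) * (1 - q / 2)) * exp (q * \<rho>)"
    using bessel_psi_Lq[of q, where 'a="real^'n"] q unfolding n_def by auto
  define c where "c = (LINT x:cball 0 (R + 1)|lebesgue. f x)"
  have c: "c > 0" using mass by (simp add: c_def)
  have \<kappa>: "\<kappa> > 0" by (simp add: \<kappa>_def)
  define \<omega> where "\<omega> = unit_ball_vol n"
  have \<omega>: "\<omega> > 0" using n by (simp add: \<omega>_def)
  define e where "e = (n - 1) * (1 - p / 2)"
  \<comment> \<open>\<open>\<omega> * (R + 1) powr n\<close> comes from the volume of the ball of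
    radius r = s + R + 1, as r <= (R + 1)(1 + s).\<close>
  define c1 where "c1 = (\<omega> * (R + 1) powr n) powr (- (p - 1))"
  define c2 where "c2 = (\<kappa> / 2 * c) powr p * (K powr (- (p - 1)) * exp (- (p * (R + 1))) * min 1 ((R + 2) powr e))"
  show ?thesis
  proof (rule that[of c1 c2, folded e_def])
    show "c1 > 0" using \<omega> pos by (simp add: c1_def)
    show "c2 > 0" using K c \<kappa> pos by (auto simp: c2_def intro!: mult_pos_pos)
    fix \<epsilon> T X :: real and u :: "real^'n \<Rightarrow> real \<Rightarrow> real"
    assume \<epsilon>: "\<epsilon> > 0" and sol: "energy_solution \<mu> \<beta> p \<epsilon> f g T u"
      and supp: "ess_support (UNIV \<times> {0..<T}) (\<lambda>(x, t). u x t) \<subseteq> {(x, t). 0 \<le> t \<and> t < T \<and> norm x \<le> t + R}"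
      and X: "0 \<le> X" "X < T"
    obtain \<zeta> where \<zeta>: "smooth_on \<zeta> UNIV" "\<And>r. r \<le> (X + R + 2)\<^sup>2 \<Longrightarrow> \<zeta> r = 1"
      "\<And>r. r \<ge> (X + R + 3)\<^sup>2 \<Longrightarrow> \<zeta> r = 0" "\<And>r. \<zeta> r \<ge> 0"
      by (rule smooth_cutoff[of "(X + R + 2)\<^sup>2" "(X + R + 3)\<^sup>2"]) (use X pos in \<open>auto intro!: power_strict_mono\<close>)
    have C: "C_L2 T u" using sol by (auto simp: energy_solution_def C1_L2_def)
    have um: "(\<lambda>x. u x t) \<in> borel_measurable lebesgue" if "t \<in> {0..X}" for t
      using C that X by (auto simp: C_L2_def L2_def)
    have slice: "AE x in lebesgue. norm x > t + R + 1 \<longrightarrow> u x t = 0" if "t \<in> {0..X}" for t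
      by (rule finite_propagation_slices[OF supp C]) (use that X in auto)
    have cont: "continuous_on UNIV (\<lambda>x::real^'n. k ((norm x)\<^sup>2))" if "smooth_on k UNIV" for k
      by (rule continuous_on_compose2[OF smooth_on_imp_continuous_on[OF that]]) (auto intro!: continuous_intros)
    have radm: "radial k \<in> borel_measurable (lebesgue :: (real^'n) measure)" if "smooth_on k UNIV" for k
      using borel_measurable_continuous_onI[OF cont[OF that]] by (auto simp: measurable_completion radial_def[abs_def])
    have \<zeta>1: "\<zeta> ((norm x)\<^sup>2) = 1" if "norm x \<le> t + R + 1" "t \<in> {0..X}" for t and x :: "real^'n"
      using that pos by (intro \<zeta>(2) power_mono) auto
    have \<psi>s: "smooth_on (bessel_psi n) UNIV" by (rule bessel_psi_smooth[OF n])
    have \<psi>1: "bessel_psi n r \<ge> 1" if "r \<ge> 0" for r using bessel_psi_ge_1[OF n that] .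
    have sm\<psi>: "smooth_on (\<lambda>r. bessel_psi n r * \<zeta> r) UNIV" by (intro smooth_on_mult \<psi>s \<zeta>) auto
    have sm1: "smooth_on (\<lambda>r. 1 * \<zeta> r) UNIV" using \<zeta> by simp

    define U where "U s = (LINT x|lebesgue. u x s * radial (\<lambda>r. bessel_psi n r * \<zeta> r) x)" for s
    have U: "U s \<ge> \<kappa> / 2 * (\<epsilon> * c) * exp s" if s: "s \<in> {0..X}" for s
    proof -
      have lap: "radial_laplacian (bessel_psi n) x = 1 * radial (bessel_psi n) x" for x :: "real^'n"
        using radial_laplacian_bessel_psi[of x] by (simp add: n_def)
      obtain V P where V: "continuous_on {0..X} V"
        "\<And>t. t \<in> {0..X} \<Longrightarrow> (U has_real_derivative V t) (at t within {0..X})"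
        "V 0 \<ge> 0" "U 0 \<ge> \<epsilon> * c"
        and P: "AE s in lebesgue. s \<in> {0..X} \<longrightarrow> integrable lebesgue (\<lambda>x. \<bar>u x s\<bar> powr p * radial (\<lambda>r. bessel_psi n r * \<zeta> r) x)
          \<and> P s = (LINT x|lebesgue. \<bar>u x s\<bar> powr p * radial (\<lambda>r. bessel_psi n r * \<zeta> r) x)"
        and diff: "\<And>l a b. continuous_on {0..X} l \<Longrightarrow> AE s in lebesgue. s \<in> {0..X} \<longrightarrow> l s \<le> P s \<Longrightarrow>
          0 \<le> a \<Longrightarrow> a \<le> b \<Longrightarrow> b \<le> X \<Longrightarrow> V b - V a \<ge> integral {a..b} (\<lambda>s. 1 * U s + l s - \<mu> / (1 + s) powr \<beta> * V s)"
        unfolding U_def c_def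
        by (rule damped_energy_bounds[OF pos \<epsilon> sol supp X f g \<zeta> \<psi>s \<psi>1 lap]) blast+
      \<comment> \<open>For the psi moment the nonlinear term is used only through its sign, with
        \<open>l = 0\<close>: linear growth of order e^s is all that is wanted.\<close>
      have P0: "AE s in lebesgue. s \<in> {0..X} \<longrightarrow> 0 \<le> P s"
        using P
      proof eventually_elim
        case (elim s)
        have "(LINT x|lebesgue. \<bar>u x s\<bar> powr p * radial (\<lambda>r. bessel_psi n r * \<zeta> r) x) \<ge> 0"
          using order_trans[OF zero_le_one \<psi>1] \<zeta>(4)
          by (intro integral_nonneg_AE AE_I2 mult_nonneg_nonneg) (auto simp: radial_def)
        then show ?case using elim by auto
      qed
      have "U s \<ge> exp (- (\<mu> / (\<beta> - 1))) / 2 * U 0 * exp s"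
      proof (rule damped_exponential_growth(1)[OF pos(2,1)])
        show "continuous_on {0..s} V" by (rule continuous_on_subset[OF V(1)]) (use s in auto)
        show "(U has_real_derivative V r) (at r within {0..s})" if "r \<in> {0..s}" for r
          by (rule has_field_derivative_subset[OF V(2)]) (use s that in auto)
        show "integral {a..b} (\<lambda>r. U r - \<mu> / (1 + r) powr \<beta> * V r) \<le> V b - V a" if "0 \<le> a" "a \<le> b" "b \<le> s" for a b
          using diff[OF continuous_on_const P0, of a b] that s by simp
        show "U 0 > 0" using V(4) \<epsilon> c mult_pos_pos[of \<epsilon> c] by linarith
      qed (use s V in auto)
      moreover have "\<kappa> / 2 * (\<epsilon> * c) * exp s \<le> \<kappa> / 2 * U 0 * exp s"
        using V(4) \<kappa> by (intro mult_right_mono mult_left_mono) auto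
      ultimately show ?thesis unfolding \<kappa>_def by linarith
    qed

    have s1: "smooth_on (\<lambda>_. 1) (UNIV :: real set)" by (simp add: smooth_on_const)
    have lap0: "radial_laplacian (\<lambda>_. 1) x = 0 * radial (\<lambda>_. 1) x" for x :: "real^'n"
      by (simp add: radial_laplacian_const)
    define F where "F s = (LINT x|lebesgue. u x s * radial (\<lambda>r. 1 * \<zeta> r) x)" for s
    obtain V P where V: "continuous_on {0..X} V"
      "\<And>t. t \<in> {0..X} \<Longrightarrow> (F has_real_derivative V t) (at t within {0..X})"
      "V 0 \<ge> 0" "F 0 \<ge> \<epsilon> * c"
      and P: "AE s in lebesgue. s \<in> {0..X} \<longrightarrow> integrable lebesgue (\<lambda>x. \<bar>u x s\<bar> powr p * radial (\<lambda>r. 1 * \<zeta> r) x)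
          \<and> P s = (LINT x|lebesgue. \<bar>u x s\<bar> powr p * radial (\<lambda>r. 1 * \<zeta> r) x)"
      and diff: "\<And>l a b. continuous_on {0..X} l \<Longrightarrow> AE s in lebesgue. s \<in> {0..X} \<longrightarrow> l s \<le> P s \<Longrightarrow>
          0 \<le> a \<Longrightarrow> a \<le> b \<Longrightarrow> b \<le> X \<Longrightarrow> V b - V a \<ge> integral {a..b} (\<lambda>s. 0 * F s + l s - \<mu> / (1 + s) powr \<beta> * V s)"
      unfolding F_def c_def
      by (rule damped_energy_bounds[OF pos \<epsilon> sol supp X f g \<zeta> s1 order_refl lap0]) blast+
    define l1 where "l1 r = c1 * (1 + r) powr (- n * (p - 1)) * \<bar>F r\<bar> powr p" for r
    define l2 where "l2 r = c2 * \<epsilon> powr p * (1 + r) powr e" for r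
    have low: "l1 s \<le> P s \<and> l2 s \<le> P s"
      if s: "s \<in> {0..X}" and int: "integrable lebesgue (\<lambda>x. \<bar>u x s\<bar> powr p * radial (\<lambda>r. 1 * \<zeta> r) x)"
        and Ps: "P s = (LINT x|lebesgue. \<bar>u x s\<bar> powr p * radial (\<lambda>r. 1 * \<zeta> r) x)" for s
    proof
      define r where "r = s + R + 1"
      have r: "r > 0" using s pos by (simp add: r_def)
      note sl = slice[OF s, folded r_def]
      have a1: "radial (\<lambda>r. 1 * \<zeta> r) x = 1" if "norm x \<le> r" for x :: "real^'n"
        using \<zeta>1[OF _ s, of x] that by (simp add: radial_def r_def)
      have pw: "integrable lebesgue (\<lambda>x. \<bar>u x s\<bar> powr p)"
        "(LINT x|lebesgue. \<bar>u x s\<bar> powr p * radial (\<lambda>r. 1 * \<zeta> r) x) = (LINT x|lebesgue. \<bar>u x s\<bar> powr p)"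
        by (rule slice_power_integral[OF um[OF s] sl _ int]; use a1 in blast)+
      have Ps': "P s = (LINT x|lebesgue. \<bar>u x s\<bar> powr p)" using Ps pw(2) by simp
      have P0: "P s \<ge> 0" unfolding Ps' by simp
      note Ho = Hoelder_ball[OF p q um[OF s] pw(1) sl, folded Ps']
      show "l1 s \<le> P s"
      proof -
        define B where "B = \<omega> * r powr n"
        have B: "B > 0" using \<omega> r by (simp add: B_def)
        have "(LINT x:cball (0::real^'n) r|lebesgue. \<bar>1\<bar> powr q) = measure lebesgue (cball (0::real^'n) r)"
          by (simp add: set_lebesgue_integral_def)
        also have "\<dots> = B"
          using r content_cball[of r "0::real^'n"] by (simp add: B_def \<omega>_def n_def powr_realpow)
        finally have vol: "(LINT x:cball (0::real^'n) r|lebesgue. \<bar>1\<bar> powr q) = B" .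
        have "F s = (LINT x|lebesgue. u x s * 1)"
          unfolding F_def by (rule integral_eq_on_support[OF um[OF s] radm[OF sm1] _ sl]) (use a1 in auto)
        then have "\<bar>F s\<bar> \<le> P s powr (1 / p) * B powr (1 / q)" using Ho[OF continuous_on_const, of 1] vol by simp
        then have "\<bar>F s\<bar> powr p * B powr (- (p - 1)) \<le> P s"
          using powr_Hoelder_lower[OF p q(2) _ B P0] by simp
        moreover have "c1 * (1 + s) powr (- n * (p - 1)) \<le> B powr (- (p - 1))"
        proof -
          have "r \<le> (R + 1) * (1 + s)"
            using s pos mult_nonneg_nonneg[of R s] by (simp add: r_def algebra_simps)
          then have "B \<le> \<omega> * ((R + 1) * (1 + s)) powr n"
            unfolding B_def using \<omega> r n by (intro mult_left_mono powr_mono2) auto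
          also have "\<dots> = \<omega> * (R + 1) powr n * (1 + s) powr n" using pos s by (simp add: powr_mult)
          finally have "(\<omega> * (R + 1) powr n * (1 + s) powr n) powr (- (p - 1)) \<le> B powr (- (p - 1))"
            using B p by (intro powr_mono2') auto
          moreover have "(\<omega> * (R + 1) powr n * (1 + s) powr n) powr (- (p - 1)) = c1 * (1 + s) powr (- n * (p - 1))"
          proof -
            have "(\<omega> * (R + 1) powr n * (1 + s) powr n) powr (- (p - 1))
                = (\<omega> * (R + 1) powr n) powr (- (p - 1)) * ((1 + s) powr n) powr (- (p - 1))"
              using \<omega> by (intro powr_mult)
            also have "((1 + s) powr n) powr (- (p - 1)) = (1 + s) powr (- n * (p - 1))"
              by (simp add: powr_powr algebra_simps)
            finally show ?thesis by (simp add: c1_def)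
          qed
          ultimately show ?thesis by simp
        qed
        then have "c1 * (1 + s) powr (- n * (p - 1)) * \<bar>F s\<bar> powr p \<le> B powr (- (p - 1)) * \<bar>F s\<bar> powr p"
          by (rule mult_right_mono) auto
        ultimately show ?thesis by (simp add: l1_def mult.commute)
      qed
      show "l2 s \<le> P s"
      proof -
        define B where "B = K * (1 + r) powr ((n - 1) * (1 - q / 2)) * exp (q * r)"
        have B: "B > 0" using K r by (simp add: B_def)
        have w: "continuous_on UNIV (\<lambda>x::real^'n. bessel_psi n ((norm x)\<^sup>2))" by (rule cont[OF \<psi>s])
        have \<psi>abs: "\<bar>bessel_psi n ((norm x)\<^sup>2)\<bar> = bessel_psi n ((norm x)\<^sup>2)" for x :: "real^'n"
          using \<psi>1[of "(norm x)\<^sup>2"] by simp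
        have "U s = (LINT x|lebesgue. u x s * bessel_psi n ((norm x)\<^sup>2))"
          unfolding U_def
        proof (rule integral_eq_on_support[OF um[OF s] radm[OF sm\<psi>] _ sl])
          show "(\<lambda>x::real^'n. bessel_psi n ((norm x)\<^sup>2)) \<in> borel_measurable lebesgue"
            using radm[OF \<psi>s] by (simp add: radial_def[abs_def])
          show "radial (\<lambda>r. bessel_psi n r * \<zeta> r) x = bessel_psi n ((norm x)\<^sup>2)" if "norm x \<le> r" for x :: "real^'n"
            using a1[OF that] by (simp add: radial_def)
        qed
        then have "U s \<le> P s powr (1 / p) * (LINT x:cball (0::real^'n) r|lebesgue. bessel_psi n ((norm x)\<^sup>2) powr q) powr (1 / q)"
          using Ho[OF w] unfolding \<psi>abs by linarith
        also have "\<dots> \<le> P s powr (1 / p) * B powr (1 / q)"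
          using K(2)[of r] r q unfolding B_def
          by (intro mult_left_mono powr_mono2) (auto simp: set_lebesgue_integral_def)
        finally have "U s \<le> P s powr (1 / p) * B powr (1 / q)" .
        then have "\<kappa> / 2 * (\<epsilon> * c) * exp s \<le> P s powr (1 / p) * B powr (1 / q)" using U[OF s] by linarith
        then have "(\<kappa> / 2 * (\<epsilon> * c) * exp s) powr p * B powr (- (p - 1)) \<le> P s"
          using \<kappa> \<epsilon> c by (intro powr_Hoelder_lower[OF p q(2) _ B P0]) auto
        moreover have "l2 s \<le> (\<kappa> / 2 * (\<epsilon> * c) * exp s) powr p * B powr (- (p - 1))"
        proof -
          \<comment> \<open>Here q(p-1) = p turns the exponent of the L^q bound for psi into the
            exponent (n-1)(1-p/2) of the second lower bound.\<close>
          have x1: "(n - 1) * (1 - q / 2) * (- (p - 1)) = e"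
          proof -
            have "(n - 1) * (1 - q / 2) * (- (p - 1)) = (n - 1) * (q * (p - 1) / 2 - (p - 1))"
              by (simp add: algebra_simps diff_divide_distrib)
            then show ?thesis unfolding qp by (simp add: e_def algebra_simps)
          qed
          have x2: "exp (q * r) powr (- (p - 1)) = exp (- (p * r))"
          proof -
            have "exp (q * r) powr (- (p - 1)) = exp (- ((q * (p - 1)) * r))" by (simp add: powr_def algebra_simps)
            then show ?thesis unfolding qp .
          qed
          have "B powr (- (p - 1)) = K powr (- (p - 1)) * ((1 + r) powr ((n - 1) * (1 - q / 2))) powr (- (p - 1)) * exp (q * r) powr (- (p - 1))"
            using K unfolding B_def by (simp only: powr_mult)
          also have "\<dots> = K powr (- (p - 1)) * (1 + r) powr e * exp (- (p * r))"
            by (simp only: powr_powr x1 x2)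
          finally have Bp: "B powr (- (p - 1)) = K powr (- (p - 1)) * (1 + r) powr e * exp (- (p * r))" .
          have Ap: "(\<kappa> / 2 * (\<epsilon> * c) * exp s) powr p = (\<kappa> / 2 * c) powr p * \<epsilon> powr p * exp (p * s)"
          proof -
            have "(\<kappa> / 2 * (\<epsilon> * c) * exp s) powr p = ((\<kappa> / 2 * c) * \<epsilon> * exp s) powr p" by (simp add: mult_ac)
            also have "\<dots> = (\<kappa> / 2 * c) powr p * \<epsilon> powr p * exp s powr p" by (simp only: powr_mult)
            finally show ?thesis by (simp add: powr_def[of "exp s"])
          qed
          \<comment> \<open>The decisive cancellation: U^p grows like e^(ps), and the L^q bound for
            psi contributes e^(-pr). Since r - s = R + 1, only a constant remains, and the power of
            1 + r decides.\<close>
          have ex: "exp (p * s) * exp (- (p * r)) = exp (- (p * (R + 1)))"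
            by (simp add: r_def algebra_simps flip: exp_add)
          have "l2 s = (\<kappa> / 2 * c) powr p * \<epsilon> powr p * (K powr (- (p - 1)) * exp (- (p * (R + 1)))) *
              (min 1 ((R + 2) powr e) * (1 + s) powr e)"
            by (simp add: l2_def c2_def mult_ac)
          also have "\<dots> \<le> (\<kappa> / 2 * c) powr p * \<epsilon> powr p * (K powr (- (p - 1)) * exp (- (p * (R + 1)))) * (1 + r) powr e"
            using powr_shift_lower[of "R + 2" s e] s pos
            by (intro mult_left_mono) (auto simp: r_def add_ac)
          also have "\<dots> = (\<kappa> / 2 * (\<epsilon> * c) * exp s) powr p * B powr (- (p - 1))"
            unfolding Ap Bp ex[symmetric] by (simp only: mult_ac)
          finally show ?thesis .
        qed
        ultimately show ?thesis by linarith
      qed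
    qed
    have Fc: "continuous_on {0..X} F" using V(2) by (intro DERIV_continuous_on)
    have bound: "V s \<ge> \<kappa> * integral {0..s} l"
      if s: "s \<in> {0..X}" and l: "continuous_on {0..X} l" "AE s in lebesgue. s \<in> {0..X} \<longrightarrow> l s \<le> P s"
        "\<And>r. r \<in> {0..X} \<Longrightarrow> l r \<ge> 0" for l s
      unfolding \<kappa>_def
    proof (rule damped_lower_bound[OF pos(2,1)])
      show "continuous_on {0..s} V" by (rule continuous_on_subset[OF V(1)]) (use s in auto)
      show "continuous_on {0..s} l" by (rule continuous_on_subset[OF l(1)]) (use s in auto)
      show "integral {a..b} (\<lambda>r. l r - \<mu> / (1 + r) powr \<beta> * V r) \<le> V b - V a" if "0 \<le> a" "a \<le> b" "b \<le> s" for a b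
        using diff[OF l(1,2), of a b] that s by simp
    qed (use s V l in auto)
    have ae: "AE s in lebesgue. s \<in> {0..X} \<longrightarrow> l1 s \<le> P s" "AE s in lebesgue. s \<in> {0..X} \<longrightarrow> l2 s \<le> P s"
      using P by (eventually_elim, use low in blast)+
    have lc: "continuous_on {0..X} l1" "continuous_on {0..X} l2"
      unfolding l1_def l2_def using p
      by (intro continuous_on_mult continuous_on_const continuous_on_powr' continuous_on_rabs Fc continuous_intros; auto)+
    have l0: "l1 r \<ge> 0" "l2 r \<ge> 0" for r
      using \<open>c1 > 0\<close> \<open>c2 > 0\<close> by (auto simp: l1_def l2_def)
    show "\<exists>F V. (\<forall>r\<in>{0..X}. (F has_real_derivative V r) (at r within {0..X})) \<and> F 0 \<ge> 0 \<and>
        (\<forall>s\<in>{0..X}. V s \<ge> \<kappa> * integral {0..s} (\<lambda>r. c1 * (1 + r) powr (- n * (p - 1)) * \<bar>F r\<bar> powr p)) \<and>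
        (\<forall>s\<in>{0..X}. V s \<ge> \<kappa> * integral {0..s} (\<lambda>r. c2 * \<epsilon> powr p * (1 + r) powr e))"
    proof (rule exI[of _ F], rule exI[of _ V], intro conjI ballI)
      show "F 0 \<ge> 0" using V(4) \<epsilon> c mult_pos_pos[of \<epsilon> c] by linarith
    qed (use V(2) bound[OF _ lc(1) ae(1) l0(1)] bound[OF _ lc(2) ae(2) l0(2)] in \<open>auto simp: l1_def l2_def\<close>)
  qed
qed

text \<open>Combining \<gamma>(p) and \<gamma>(S) with factors S and -p removes the linear term and
  leaves (S - p)(2 + (m-1) p S), so the sign follows without discussing the roots.\<close>

lemma strauss_gamma_pos:
  assumes "p > 1" "m \<ge> 1" "m \<ge> 2 \<longrightarrow> p < strauss_exponent m"
  shows "strauss_gamma p m > 0"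
proof (cases "m \<ge> 2")
  case True
  define S where "S = strauss_exponent m"
  have S: "S > 0" "strauss_gamma S m = 0" using strauss_exponent_iff[OF True, of S] by (auto simp: S_def)
  have pS: "p < S" using assms True by (simp add: S_def)
  have "S * strauss_gamma p m - p * strauss_gamma S m = 2 * (S - p) + (real m - 1) * p * S * (S - p)"
    by (simp add: strauss_gamma_def power2_eq_square algebra_simps)
  also have "\<dots> > 0" using pS assms True S by (intro add_pos_nonneg mult_nonneg_nonneg) auto
  finally show ?thesis using S by (simp add: zero_less_mult_iff)
next
  case False
  then have "m = 1" using assms by simp
  then show ?thesis using assms by (simp add: strauss_gamma_def)
qed

lemma vanishing_mass:
  fixes f :: "real^'n \<Rightarrow> real"
  assumes f: "L2 f" "AE x in lebesgue. f x \<ge> 0" and out: "AE x in lebesgue. norm x > r \<longrightarrow> f x = 0"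
    and mass: "(LINT x:cball 0 r|lebesgue. f x) \<le> 0"
  shows "AE x in lebesgue. f x = 0"
proof -
  note int = L2_mult(1)[OF L2_indicator_cball f(1)]
  have nn: "AE x in lebesgue. 0 \<le> indicator (cball 0 r) x * f x"
    using f(2) by eventually_elim simp
  have "(LINT x|lebesgue. indicator (cball 0 r) x * f x) = 0"
    using mass integral_nonneg_AE[OF nn] by (simp add: set_lebesgue_integral_def)
  then have "AE x in lebesgue. indicator (cball 0 r) x * f x = 0"
    using integral_nonneg_eq_0_iff_AE[OF int nn] by simp
  then show ?thesis using out
  proof eventually_elim
    case (elim x)
    then show ?case by (cases "norm x \<le> r") auto
  qed
qed

theorem theorem2p1:
  fixes f g :: "real^'n \<Rightarrow> real" and \<mu> \<beta> R p :: real
  assumes "\<mu> > 0" and "\<beta> > 1" and "R \<ge> 1"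
    and "1 < p" and "CARD('n) \<ge> 2 \<longrightarrow> p < strauss_exponent CARD('n)"
    and "H1 f" and "L2 g"
    and "AE x in lebesgue. f x \<ge> 0" and "AE x in lebesgue. g x \<ge> 0"
    and "\<not> (AE x in lebesgue. f x = 0)"
  shows "\<exists>\<epsilon>\<^sub>0>0. \<exists>C>0. \<forall>\<epsilon>. 0 < \<epsilon> \<and> \<epsilon> \<le> \<epsilon>\<^sub>0 \<longrightarrow>
    (\<forall>T>0. \<forall>u. energy_solution \<mu> \<beta> p \<epsilon> f g T u \<longrightarrow>
       ess_support (UNIV \<times> {0..<T}) (\<lambda>(x, t). u x t)
         \<subseteq> {(x, t). 0 \<le> t \<and> t < T \<and> norm x \<le> t + R} \<longrightarrow>
       T \<le> C * \<epsilon> powr (- (2 * p * (p - 1)) / strauss_gamma p CARD('n)))"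
proof (cases "(LINT x:cball 0 (R + 1)|lebesgue. f x) > 0")
  case True
  define n where "n = real CARD('n)"
  define G where "G = strauss_gamma p CARD('n)"
  have G: "G > 0" unfolding G_def using assms by (intro strauss_gamma_pos) (auto simp: Suc_leI)
  have f: "L2 f" using assms by (simp add: H1_def)
  have R: "R > 0" using assms by simp
  obtain c1 c2 where c: "c1 > 0" "c2 > 0" and
    bounds: "\<And>\<epsilon> T u X. \<epsilon> > 0 \<Longrightarrow> energy_solution \<mu> \<beta> p \<epsilon> f g T u \<Longrightarrow>
      ess_support (UNIV \<times> {0..<T}) (\<lambda>(x, t). u x t) \<subseteq> {(x, t). 0 \<le> t \<and> t < T \<and> norm x \<le> t + R} \<Longrightarrow>
      0 \<le> X \<Longrightarrow> X < T \<Longrightarrow>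
      \<exists>F V. (\<forall>r\<in>{0..X}. (F has_real_derivative V r) (at r within {0..X})) \<and> F 0 \<ge> 0 \<and>
        (\<forall>s\<in>{0..X}. V s \<ge> exp (- (\<mu> / (\<beta> - 1))) * integral {0..s} (\<lambda>r. c1 * (1 + r) powr (- n * (p - 1)) * \<bar>F r\<bar> powr p)) \<and>
        (\<forall>s\<in>{0..X}. V s \<ge> exp (- (\<mu> / (\<beta> - 1))) * integral {0..s} (\<lambda>r. c2 * \<epsilon> powr p * (1 + r) powr ((n - 1) * (1 - p / 2))))"
    unfolding n_def by (rule solution_bounds[OF assms(1,2) R assms(4) f assms(8,7,9) True]) blast
  obtain C where C: "C > 0"
    "\<And>\<epsilon> X F V. \<epsilon> > 0 \<Longrightarrow> X \<ge> 1 \<Longrightarrow>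
      (\<And>r. r \<in> {0..X} \<Longrightarrow> (F has_real_derivative V r) (at r within {0..X})) \<Longrightarrow> F 0 \<ge> 0 \<Longrightarrow>
      (\<And>s. s \<in> {0..X} \<Longrightarrow> V s \<ge> exp (- (\<mu> / (\<beta> - 1))) * integral {0..s} (\<lambda>r. c1 * (1 + r) powr (- n * (p - 1)) * \<bar>F r\<bar> powr p)) \<Longrightarrow>
      (\<And>s. s \<in> {0..X} \<Longrightarrow> V s \<ge> exp (- (\<mu> / (\<beta> - 1))) * integral {0..s} (\<lambda>r. c2 * \<epsilon> powr p * (1 + r) powr ((n - 1) * (1 - p / 2)))) \<Longrightarrow>
      \<epsilon> powr (p * (p - 1)) * X powr (2 - n * (p - 1) + (2 + (n - 1) * (1 - p / 2)) * (p - 1)) \<le> C"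
    by (rule lifespan_iteration[OF assms(4) _ exp_gt_zero c, of n "- (\<mu> / (\<beta> - 1))" "(n - 1) * (1 - p / 2)"])
       (simp add: n_def, blast)
  \<comment> \<open>The gain of the iteration is governed by \<gamma>/2; this produces the factor 2
    in the exponent of the lifespan bound.\<close>
  have expo: "2 - n * (p - 1) + (2 + (n - 1) * (1 - p / 2)) * (p - 1) = G / 2"
    by (simp add: G_def n_def strauss_gamma_def power2_eq_square field_simps)
  \<comment> \<open>Solving \<epsilon>^(p(p-1)) X^(G/2) <= C for X gives the power of C. The maximum
    with 1, together with E >= 1, secures the condition X >= 1 of the iteration.\<close>
  define D where "D = max 1 (C powr (2 / G))"
  show ?thesis
  \<comment> \<open>The threshold 1 suffices: the exponent of \<epsilon> is nonpositive, so
    \<epsilon> <= 1 makes its power at least 1.\<close>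
  proof (rule exI[of _ 1], intro conjI exI[of _ D] allI impI, goal_cases)
    case (3 \<epsilon> T u)
    show ?case
    proof (rule ccontr)
      assume "\<not> ?thesis"
      then have lt: "D * \<epsilon> powr (- (2 * p * (p - 1)) / G) < T" by (simp add: G_def)
      define E where "E = \<epsilon> powr (- (2 * p * (p - 1)) / G)"
      have E: "E \<ge> 1"
      proof -
        have "- (2 * p * (p - 1)) / G \<le> 0" using G assms by (intro divide_nonpos_pos) auto
        then have "1 powr (- (2 * p * (p - 1)) / G) \<le> E" unfolding E_def using 3 by (intro powr_mono2') auto
        then show ?thesis by simp
      qed
      \<comment> \<open>The bounds hold on closed intervals [0, X] with X < T; an X strictly between
        the claimed bound and T already gives the contradiction.\<close>
      obtain X where X: "D * E < X" "X < T" using dense lt unfolding E_def by blast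
      have "1 * 1 \<le> D * E" using E by (intro mult_mono) (auto simp: D_def)
      then have X1: "X \<ge> 1" using X by simp
      obtain F V where FV: "\<forall>r\<in>{0..X}. (F has_real_derivative V r) (at r within {0..X})" "F 0 \<ge> 0"
        "\<forall>s\<in>{0..X}. V s \<ge> exp (- (\<mu> / (\<beta> - 1))) * integral {0..s} (\<lambda>r. c1 * (1 + r) powr (- n * (p - 1)) * \<bar>F r\<bar> powr p)"
        "\<forall>s\<in>{0..X}. V s \<ge> exp (- (\<mu> / (\<beta> - 1))) * integral {0..s} (\<lambda>r. c2 * \<epsilon> powr p * (1 + r) powr ((n - 1) * (1 - p / 2)))"
        using bounds[of \<epsilon> T u X] 3 X X1 by auto
      have le: "\<epsilon> powr (p * (p - 1)) * X powr (G / 2) \<le> C"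
        unfolding expo[symmetric] by (rule C(2)[of \<epsilon> X F V]) (use 3 X1 FV in auto)
      have "C powr (2 / G) * E < X"
        using X(1) E by (intro le_less_trans[OF mult_right_mono X(1)]) (auto simp: D_def)
      then have "(C powr (2 / G) * E) powr (G / 2) < X powr (G / 2)"
        using G E by (intro powr_less_mono2) auto
      moreover have "(C powr (2 / G) * E) powr (G / 2) = C * \<epsilon> powr (- (p * (p - 1)))"
      proof -
        have "E powr (G / 2) = \<epsilon> powr (- (p * (p - 1)))" unfolding E_def using G by (simp add: powr_powr)
        moreover have "(C powr (2 / G)) powr (G / 2) = C" using G C(1) by (simp add: powr_powr)
        ultimately show ?thesis by (simp add: powr_mult)
      qed
      ultimately have "C * \<epsilon> powr (- (p * (p - 1))) < X powr (G / 2)" by simp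
      then have "\<epsilon> powr (p * (p - 1)) * (C * \<epsilon> powr (- (p * (p - 1)))) < \<epsilon> powr (p * (p - 1)) * X powr (G / 2)"
        using 3 by (intro mult_strict_left_mono) auto
      moreover have "\<epsilon> powr (p * (p - 1)) * (C * \<epsilon> powr (- (p * (p - 1)))) = C"
        using 3 by (simp add: powr_minus)
      ultimately show False using le by simp
    qed
  qed (auto simp: D_def)
next
  case False
  \<comment> \<open>Here \<open>f\<close> lives outside the ball of radius \<open>R + 1\<close>, so no solution has the required support.\<close>
  have False if sol: "energy_solution \<mu> \<beta> p \<epsilon> f g T u"
    and supp: "ess_support (UNIV \<times> {0..<T}) (\<lambda>(x, t). u x t) \<subseteq> {(x, t). 0 \<le> t \<and> t < T \<and> norm x \<le> t + R}"
    and T: "T > 0" and \<epsilon>: "\<epsilon> > 0" for T \<epsilon> and u :: "real^'n \<Rightarrow> real \<Rightarrow> real"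
  proof -
    have C: "C_L2 T u" using sol by (auto simp: energy_solution_def C1_L2_def)
    have "AE x in lebesgue. u x 0 = \<epsilon> * f x" using sol by (simp add: energy_solution_def)
    moreover have "AE x in lebesgue. norm x > 0 + R + 1 \<longrightarrow> u x 0 = 0"
      by (rule finite_propagation_slices[OF supp C]) (use T in auto)
    ultimately have "AE x in lebesgue. norm x > R + 1 \<longrightarrow> f x = 0"
      by eventually_elim (use \<epsilon> in auto)
    then have "AE x in lebesgue. f x = 0"
      using False assms by (intro vanishing_mass[of f "R + 1"]) (auto simp: H1_def)
    then show False using assms by blast
  qed
  then have "\<forall>\<epsilon>. 0 < \<epsilon> \<and> \<epsilon> \<le> 1 \<longrightarrow>
    (\<forall>T>0. \<forall>u. energy_solution \<mu> \<beta> p \<epsilon> f g T u \<longrightarrow>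
       ess_support (UNIV \<times> {0..<T}) (\<lambda>(x, t). u x t)
         \<subseteq> {(x, t). 0 \<le> t \<and> t < T \<and> norm x \<le> t + R} \<longrightarrow>
       T \<le> 1 * \<epsilon> powr (- (2 * p * (p - 1)) / strauss_gamma p CARD('n)))" by blast
  then show ?thesis by (meson zero_less_one)
qed

end
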